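(* Let $p$ be a prime with $p\equiv 1\pmod 8$, let $k=\mathbb{Q}(\sqrt{p})\subset\mathbb{R}$, and let $\epsilon>0$ be a unit of norm $-1$ in $\mathcal{O}_k$. Then the field $k(\sqrt{\epsilon})$ has odd class number.
   Context: The norm is the norm from $k$ to $\mathbb{Q}$. *)

theory Defs
  imports
    Complex_Main
    "HOL-Computational_Algebra.Computational_Algebra"
    "HOL-Number_Theory.Cong"
    "HOL-Algebra.Algebra"
    "HOL-Algebra.Algebraic_Closure_Type"
begin

text \<open>
  Fields are represented as subsets of an ambient field type, viewed as subfields of the
  ring record \<^term>\<open>ring_of_type_algebra\<close> of that type.
\<close>

definition subfield_ring :: "'a::field_char_0 set \<Rightarrow> 'a ring"
  where "subfield_ring K = ring_of_type_algebra \<lparr>carrier := K\<rparr>"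

text \<open>The subfield generated by \<open>S\<close>; it contains the prime field \<open>\<rat>\<close>.\<close>

definition field_gen :: "'a::field_char_0 set \<Rightarrow> 'a set"
  where "field_gen S = generate_field ring_of_type_algebra S"

definition field_adjoin :: "'a::field_char_0 set \<Rightarrow> 'a \<Rightarrow> 'a set"
  where "field_adjoin K x = field_gen (insert x K)"

definition ring_of_integers :: "'a::field_char_0 set \<Rightarrow> 'a ring"
  where "ring_of_integers K = subfield_ring {x \<in> K. algebraic_int x}"

text \<open>
  Functions in HOL are total, so embeddings of \<open>K\<close> are made extensional on \<open>K\<close>: each embedding
  is then a single element of the set.
\<close>

definition field_embeddings :: "'a::field_char_0 set \<Rightarrow> ('a \<Rightarrow> complex) set"
  where "field_embeddings K =
    ring_hom (subfield_ring K) (subfield_ring (UNIV :: complex set)) \<inter> extensional K"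

text \<open>
  The norm from \<open>K\<close> to \<open>\<rat>\<close>, as the product of the images under the complex embeddings of \<open>K\<close>.
  It is only meaningful for number fields, which have finitely many embeddings.
\<close>

definition field_norm :: "'a::field_char_0 set \<Rightarrow> 'a \<Rightarrow> complex"
  where "field_norm K x = (\<Prod>\<sigma>\<in>field_embeddings K. \<sigma> x)"

definition nonzero_ideals :: "('a, 'b) ring_scheme \<Rightarrow> 'a set set"
  where "nonzero_ideals R = {I. ideal I R \<and> I \<noteq> {\<zero>\<^bsub>R\<^esub>}}"

text \<open>Nonzero ideals \<open>I\<close>, \<open>J\<close> are in the same class iff \<open>aI = bJ\<close> for some nonzero \<open>a\<close>, \<open>b\<close>.\<close>

definition ideal_class_rel :: "('a, 'b) ring_scheme \<Rightarrow> ('a set \<times> 'a set) set"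
  where "ideal_class_rel R =
    {(I, J). I \<in> nonzero_ideals R \<and> J \<in> nonzero_ideals R \<and>
      (\<exists>a \<in> carrier R - {\<zero>\<^bsub>R\<^esub>}. \<exists>b \<in> carrier R - {\<zero>\<^bsub>R\<^esub>}. a <#\<^bsub>R\<^esub> I = b <#\<^bsub>R\<^esub> J)}"

lemma (in domain) equiv_ideal_class_rel: "equiv (nonzero_ideals R) (ideal_class_rel R)"
proof (rule equivI)
  show "ideal_class_rel R \<subseteq> nonzero_ideals R \<times> nonzero_ideals R"
    by (auto simp: ideal_class_rel_def)
  show "refl_on (nonzero_ideals R) (ideal_class_rel R)"
  proof (rule refl_onI)
    fix I assume "I \<in> nonzero_ideals R"
    moreover have "\<one> \<in> carrier R - {\<zero>}" by simp
    ultimately show "(I, I) \<in> ideal_class_rel R"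
      unfolding ideal_class_rel_def by blast
  qed
  show "sym (ideal_class_rel R)"
  proof (rule symI)
    fix I J assume "(I, J) \<in> ideal_class_rel R"
    then obtain a b where "a \<in> carrier R - {\<zero>}" "b \<in> carrier R - {\<zero>}" "l_coset R b J = l_coset R a I"
        "I \<in> nonzero_ideals R" "J \<in> nonzero_ideals R"
      unfolding ideal_class_rel_def by auto
    then show "(J, I) \<in> ideal_class_rel R"
      unfolding ideal_class_rel_def by blast
  qed
  show "trans (ideal_class_rel R)"
  proof (rule transI)
    fix I J L assume "(I, J) \<in> ideal_class_rel R" "(J, L) \<in> ideal_class_rel R"
    then obtain a b c d
      where abcd: "a \<in> carrier R - {\<zero>}" "b \<in> carrier R - {\<zero>}"
          "c \<in> carrier R - {\<zero>}" "d \<in> carrier R - {\<zero>}"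
        and eqs: "l_coset R a I = l_coset R b J" "l_coset R c J = l_coset R d L"
        and ids: "I \<in> nonzero_ideals R" "J \<in> nonzero_ideals R" "L \<in> nonzero_ideals R"
      unfolding ideal_class_rel_def by blast
    have sub: "I \<subseteq> carrier R" "J \<subseteq> carrier R" "L \<subseteq> carrier R"
      using ids by (auto simp: nonzero_ideals_def dest: ideal.Icarr)
    have assoc: "l_coset R x (l_coset R y M) = l_coset R (x \<otimes> y) M"
      if "x \<in> carrier R" "y \<in> carrier R" "M \<subseteq> carrier R" for x y M
    proof -
      have "x \<otimes> (y \<otimes> m) = (x \<otimes> y) \<otimes> m" if "m \<in> M" for m
        using that \<open>x \<in> carrier R\<close> \<open>y \<in> carrier R\<close> \<open>M \<subseteq> carrier R\<close> by (simp add: m_assoc subsetD)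
      then show ?thesis
        unfolding l_coset_def by auto
    qed
    have carr: "a \<in> carrier R" "b \<in> carrier R" "c \<in> carrier R" "d \<in> carrier R"
      using abcd by auto
    have "l_coset R (c \<otimes> a) I = l_coset R c (l_coset R b J)"
      using assoc[OF carr(3,1) sub(1)] eqs(1) by metis
    also have "\<dots> = l_coset R b (l_coset R c J)"
      using assoc[OF carr(3,2) sub(2)] assoc[OF carr(2,3) sub(2)] m_comm[OF carr(2,3)] by metis
    also have "\<dots> = l_coset R (b \<otimes> d) L"
      using assoc[OF carr(2,4) sub(3)] eqs(2) by metis
    finally have "l_coset R (c \<otimes> a) I = l_coset R (b \<otimes> d) L" .
    moreover have "c \<otimes> a \<in> carrier R - {\<zero>}" "b \<otimes> d \<in> carrier R - {\<zero>}"
      using abcd by (auto simp: integral_iff)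
    ultimately show "(I, L) \<in> ideal_class_rel R"
      unfolding ideal_class_rel_def using ids by blast
  qed
qed

text \<open>
  The number of ideal classes. By the convention for \<^const>\<open>card\<close> it would be \<open>0\<close>, in particular
  even, if there were infinitely many.
\<close>

definition class_number :: "('a, 'b) ring_scheme \<Rightarrow> nat"
  where "class_number R = card (nonzero_ideals R // ideal_class_rel R)"

end

theory Submission
  imports
    Defs
    "Jordan_Normal_Form.Char_Poly"
    "HOL-Analysis.Kronecker_Approximation_Theorem"
begin

text \<open>
  The class group of \<open>L = k(\<surd>\<epsilon>)\<close> has odd order iff it has no element of order 2, so let \<open>I\<^sup>2\<close> be
  principal. The relative norm of \<open>I\<close> is an ideal of \<open>k\<close> with principal square; as \<open>\<epsilon>\<close> has norm
  \<open>-1\<close>, genus theory over \<open>\<rat>\<close> shows that it is principal. Hence \<open>I\<close> is equivalent to its conjugate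
  \<open>I'\<close>, say \<open>I = \<alpha> I'\<close>, and the norm of \<open>\<alpha>\<close> is a unit of \<open>k\<close>. The conjugate of \<open>\<epsilon>\<close> is
  \<open>-1/\<epsilon> < 0\<close>, which makes norms from \<open>L\<close> positive at the second real place of \<open>k\<close>; so this unit is
  \<open>v\<^sup>2\<close> or \<open>-\<epsilon> v\<^sup>2\<close>, the norm of a unit of \<open>L\<close>, and by Hilbert 90 one may assume that \<open>I\<close> is
  ambiguous, that is \<open>I = I'\<close>.

  Since \<open>p \<equiv> 1 (mod 8)\<close>, 2 splits in \<open>k\<close>, and \<open>\<epsilon>\<close> is 1 modulo 4 at exactly one of the two places above 2.
  So only one finite prime \<open>Q\<close> of \<open>k\<close> ramifies in \<open>L\<close>, and up to ideals from \<open>k\<close> an ambiguous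
  ideal is trivial or the prime above \<open>Q\<close>. Dirichlet's theorem gives a unit of relative norm 1
  which is not a square up to sign; by Hilbert 90 it is \<open>x/x'\<close>, where \<open>x\<close> generates an ambiguous
  ideal which does not come from \<open>k\<close>. Hence all ambiguous ideals with principal square are
  principal.
\<close>

text \<open>No prime factorization is used. A Dedekind ring is one whose fractional ideals are all
  invertible, which is lifted from \<open>\<int>\<close> through two quadratic steps. Primes are
  replaced by inclusions. Integral closedness makes square roots of principal ideals unique. For an
  ambiguous \<open>J\<close> the traces generate an ideal \<open>T\<close> squeezed between
  \<open>D J\<close> and \<open>J\<close>, with \<open>D\<close> an explicit ideal inside the
  different: over \<open>\<rat>\<close> it is generated by the square root of \<open>p\<close>, over
  \<open>k\<close> it is \<open>Q = (2, s)\<close>, which has at most two residues. Squaring leaves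
  few possibilities, and this is how ambiguous ideals are listed. Integral bases are avoided as
  well: coordinates exist after multiplication by \<open>p\<close>, harmless at 2 since
  \<open>p\<close> is 1 modulo 8, or by \<open>2 p\<close>, harmless for finiteness.
  \<open>L\<close> has two real places and one complex place, so the units of relative norm 1 have
  rank 1; a least one above 1 is the unit sought. Finiteness of the class group has to be proved
  too, since an infinite one would count as 0. Both rest on simultaneous approximation, in place of
  Minkowski's theorem.\<close>

subsection \<open>Products of additive subgroups of a field\<close>

text \<open>One operation serves three purposes: the product of two ideals, the extension
  \<open>A \<star> OK\<close> of an ideal to a larger ring, and the additive group
  \<open>\<int> \<star> B\<close> generated by a set. Negatives come from the factors, one of which
  is always closed under negation.\<close>

inductive_set prod_span :: "'a::field set \<Rightarrow> 'a set \<Rightarrow> 'a set" (infixl \<open>\<star>\<close> 70)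
  for I J where
  zero: "0 \<in> I \<star> J"
| add: "x \<in> I \<star> J \<Longrightarrow> a \<in> I \<Longrightarrow> b \<in> J \<Longrightarrow> x + a * b \<in> I \<star> J"

definition scale :: "'a::field \<Rightarrow> 'a set \<Rightarrow> 'a set" (infixr \<open>\<cdot>\<close> 75)
  where "a \<cdot> I = (*) a ` I"

lemma prod_span_incl: "a \<in> I \<Longrightarrow> b \<in> J \<Longrightarrow> a * b \<in> I \<star> J"
  using prod_span.add[OF prod_span.zero] by fastforce

lemma prod_span_plus: "x \<in> I \<star> J \<Longrightarrow> y \<in> I \<star> J \<Longrightarrow> x + y \<in> I \<star> J"
proof -
  assume x: "x \<in> I \<star> J" and "y \<in> I \<star> J"
  from this(2) show ?thesis
    by induction (use x in \<open>simp_all add: add.assoc[symmetric] prod_span.add\<close>)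
qed

lemma prod_span_least:
  assumes "\<And>a b. a \<in> I \<Longrightarrow> b \<in> J \<Longrightarrow> a * b \<in> M"
    and "0 \<in> M" "\<And>x y. x \<in> M \<Longrightarrow> y \<in> M \<Longrightarrow> x + y \<in> M"
  shows "I \<star> J \<subseteq> M"
proof
  fix x assume "x \<in> I \<star> J"
  then show "x \<in> M" by induction (use assms in auto)
qed

lemma prod_span_commute: "I \<star> J = J \<star> I"
proof -
  have "A \<star> B \<subseteq> B \<star> A" for A B :: "'a set"
  proof (rule prod_span_least)
    fix a b assume "a \<in> A" "b \<in> B"
    then show "a * b \<in> B \<star> A" using prod_span_incl[of b B a A] by (simp add: mult.commute)
  qed (auto intro: prod_span_plus prod_span.zero)
  then show ?thesis by blast
qed

lemma prod_span_mono: "A \<subseteq> B \<Longrightarrow> C \<subseteq> D \<Longrightarrow> A \<star> C \<subseteq> B \<star> D"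
  by (rule prod_span_least) (auto intro: prod_span_plus prod_span.zero prod_span_incl)

lemma prod_span_mult_left:
  assumes "\<And>x. x \<in> I \<Longrightarrow> c * x \<in> I'" and "x \<in> I \<star> J"
  shows "c * x \<in> I' \<star> J"
  using assms(2)
proof induction
  case (add x a b)
  have "(c * a) * b \<in> I' \<star> J" using add assms(1) by (intro prod_span_incl)
  from prod_span_plus[OF add.IH this] show ?case by (simp add: algebra_simps)
qed (simp add: prod_span.zero)

lemma prod_span_assoc: "(A \<star> B) \<star> C = A \<star> (B \<star> C)"
proof -
  have *: "(A \<star> B) \<star> C \<subseteq> A \<star> (B \<star> C)" for A B C :: "'a set"
  proof (rule prod_span_least)
    fix x c assume "x \<in> A \<star> B" and c: "c \<in> C"
    from this(1) show "x * c \<in> A \<star> (B \<star> C)"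
    proof induction
      case (add x a b)
      have "a * (b * c) \<in> A \<star> (B \<star> C)" using add c by (intro prod_span_incl)
      from prod_span_plus[OF add.IH this] show ?case by (simp add: algebra_simps)
    qed (simp add: prod_span.zero)
  qed (auto intro: prod_span.zero prod_span_plus)
  from *[of A B C] *[of C B A] show ?thesis
    by (metis prod_span_commute subset_antisym)
qed

lemma prod_span_left_commute: "A \<star> (B \<star> C) = B \<star> (A \<star> C)"
  by (metis prod_span_assoc prod_span_commute)

lemmas prod_span_ac = prod_span_assoc prod_span_commute prod_span_left_commute

lemma scale_mem: "x \<in> I \<Longrightarrow> a * x \<in> a \<cdot> I"
  unfolding scale_def by (rule imageI)

lemma scale_iff: "a \<noteq> 0 \<Longrightarrow> x \<in> a \<cdot> I \<longleftrightarrow> x / a \<in> I"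
  by (force simp: scale_def image_iff field_simps)

lemma scale_scale: "a \<cdot> b \<cdot> I = (a * b) \<cdot> I"
  by (auto simp: scale_def image_image mult.assoc)

lemma scale_one [simp]: "1 \<cdot> I = I"
  by (simp add: scale_def)

lemma scale_mono: "I \<subseteq> J \<Longrightarrow> a \<cdot> I \<subseteq> a \<cdot> J"
  by (auto simp: scale_def)

lemma scale_prod_left: "(a \<cdot> I) \<star> J = a \<cdot> (I \<star> J)"
proof (intro equalityI subsetI)
  fix x assume "x \<in> (a \<cdot> I) \<star> J"
  then show "x \<in> a \<cdot> (I \<star> J)"
  proof induction
    case (add x u b)
    then obtain y v where "x = a * y" "y \<in> I \<star> J" "u = a * v" "v \<in> I" by (auto simp: scale_def)
    then have "x + u * b = a * (y + v * b)" "y + v * b \<in> I \<star> J"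
      using add.hyps(3) prod_span.add[of y I J v b] by (simp_all add: algebra_simps)
    then show ?case by (simp add: scale_mem)
  qed (use prod_span.zero in \<open>force simp: scale_def\<close>)
next
  fix x assume "x \<in> a \<cdot> (I \<star> J)"
  then show "x \<in> (a \<cdot> I) \<star> J"
    by (auto simp: scale_def intro: prod_span_mult_left)
qed

lemma scale_prod_right: "I \<star> (a \<cdot> J) = a \<cdot> (I \<star> J)"
  by (metis prod_span_commute scale_prod_left)

subsection \<open>The ring of algebraic integers\<close>

lemma int_span_finite:
  fixes B :: "'a::field_char_0 set"
  assumes "finite B" "x \<in> \<int> \<star> B"
  shows "\<exists>c :: 'a \<Rightarrow> int. x = (\<Sum>b\<in>B. of_int (c b) * b)"
  using assms(2)
proof induction
  case zero
  show ?case by (rule exI[of _ "\<lambda>_. 0"]) simp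
next
  case (add x a b)
  then obtain c n where c: "x = (\<Sum>b\<in>B. of_int (c b) * b)" and n: "a = of_int n"
    by (auto elim: Ints_cases)
  have "(\<Sum>b'\<in>B. of_int ((c(b := c b + n)) b') * b') =
        (\<Sum>b'\<in>B. of_int (c b') * b' + (if b' = b then of_int n * b' else 0))"
    by (rule sum.cong) (auto simp: algebra_simps)
  also have "\<dots> = x + a * b"
    using add.hyps assms(1) by (simp add: sum.distrib c n)
  finally show ?case by metis
qed

lemma int_span_scale: "n \<in> \<int> \<Longrightarrow> x \<in> \<int> \<star> B \<Longrightarrow> n * x \<in> \<int> \<star> B"
  by (rule prod_span_mult_left[where I = \<int>]) auto

lemma int_span_superset: "b \<in> B \<Longrightarrow> b \<in> \<int> \<star> B"
  using prod_span_incl[of 1 \<int> b B] by simp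

lemma int_span_closed:
  assumes "\<And>b. b \<in> B \<Longrightarrow> w * b \<in> \<int> \<star> B" and "x \<in> \<int> \<star> B"
  shows "w * x \<in> \<int> \<star> B"
  using assms(2)
proof induction
  case (add x a b)
  have "a * (w * b) \<in> \<int> \<star> B"     using add assms(1)[of b] by (auto intro: int_span_scale)
  from prod_span_plus[OF add.IH this] show ?case by (simp add: algebra_simps)
qed (simp add: prod_span.zero)

text \<open>The integer is a root of the characteristic polynomial of the matrix of multiplication
  by \<open>w\<close> on the generators.\<close>

lemma algebraic_int_if_stable:
  fixes w :: "'a::field_char_0"
  assumes fin: "finite B" and b0: "b0 \<in> B" "b0 \<noteq> 0"
    and stable: "\<And>b. b \<in> B \<Longrightarrow> w * b \<in> \<int> \<star> B"
  shows "algebraic_int w"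
proof -
  obtain bs where bs: "set bs = B" "distinct bs"
    using finite_distinct_list[OF fin] by auto
  define n where "n = length bs"
  have bij: "bij_betw ((!) bs) {0..<n} B"
    unfolding n_def using bs bij_betw_nth[of bs "{0..<length bs}" B] by (simp add: atLeast0LessThan)
  have "\<exists>c :: 'a \<Rightarrow> int. w * b = (\<Sum>b\<in>B. of_int (c b) * b)" if "b \<in> B" for b
    using int_span_finite[OF fin stable[OF that]] .
  then obtain c :: "'a \<Rightarrow> 'a \<Rightarrow> int"
    where c: "\<And>b. b \<in> B \<Longrightarrow> w * b = (\<Sum>b'\<in>B. of_int (c b b') * b')" by metis
  define A :: "int mat" where "A = Matrix.mat n n (\<lambda>(i, j). c (bs ! i) (bs ! j))"
  define v :: "'a Matrix.vec" where "v = Matrix.vec n (\<lambda>i. bs ! i)"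
  have A: "A \<in> carrier_mat n n" "(map_mat of_int A :: 'a Matrix.mat) \<in> carrier_mat n n"
    by (auto simp: A_def)
  have "vec_index (map_mat of_int A *\<^sub>v v) i = vec_index (w \<cdot>\<^sub>v v) i" if "i < n" for i
  proof -
    have "vec_index (map_mat of_int A *\<^sub>v v) i = (\<Sum>j\<in>{0..<n}. of_int (c (bs ! i) (bs ! j)) * bs ! j)"
      using that by (simp add: A_def v_def scalar_prod_def)
    also have "\<dots> = (\<Sum>b\<in>B. of_int (c (bs ! i) b) * b)"
      using sum.reindex_bij_betw[OF bij, of "\<lambda>b. of_int (c (bs ! i) b) * b"] by simp
    also have "\<dots> = w * bs ! i"
      using c[OF nth_mem[of i bs, unfolded bs]] that bs by (simp add: n_def)
    finally show ?thesis using that by (simp add: v_def)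
  qed
  then have "map_mat of_int A *\<^sub>v v = w \<cdot>\<^sub>v v"
    by (intro eq_vecI) (auto simp: A_def v_def)
  moreover obtain i where i: "i < n" "bs ! i = b0"
    using b0 bs by (metis n_def in_set_conv_nth)
  then have "vec_index v i \<noteq> vec_index (0\<^sub>v n) i" using b0 by (simp add: v_def)
  then have "v \<noteq> 0\<^sub>v n" by metis
  ultimately have "eigenvalue (map_mat of_int A :: 'a Matrix.mat) w"
    unfolding eigenvalue_def eigenvector_def using A by (intro exI[of _ v]) (simp add: v_def)
  then have "poly (char_poly (map_mat of_int A :: 'a Matrix.mat)) w = 0"
    using eigenvalue_root_char_poly[OF A(2)] by simp
  then have "poly (map_poly of_int (char_poly A)) w = 0"
    by (simp only: of_int_hom.char_poly_hom[OF A(1)])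
  moreover have "lead_coeff (char_poly A) = 1"
    using degree_monic_char_poly[OF A(1)] by simp
  ultimately show ?thesis
    using algebraic_int_altdef_ipoly by blast
qed

text \<open>The monic equation of \<open>x\<close> rewrites its top power by lower ones.
  \<open>n\<close> is positive because a constant monic polynomial has no root.\<close>

lemma algebraic_int_stable_powers:
  fixes x :: "'a::field_char_0"
  assumes "algebraic_int x"
  shows "\<exists>n>0. \<forall>i<n. x * x ^ i \<in> \<int> \<star> ((^) x ` {..<n})"
proof -
  obtain p where p: "lead_coeff p = 1" "\<forall>i. Polynomial.coeff p i \<in> \<int>" "poly p x = 0"
    using assms by (auto elim: algebraic_int.cases)
  define n where "n = degree p"
  have "n > 0"
  proof (rule ccontr)
    assume "\<not> n > 0"
    then obtain c where "p = [:c:]" using degree_eq_zeroE[of p] by (auto simp: n_def)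
    then show False using p by auto
  qed
  moreover have "x * x ^ i \<in> \<int> \<star> ((^) x ` {..<n})" (is "_ \<in> ?S") if "i < n" for i
  proof (cases "Suc i < n")
    case True
    then show ?thesis by (metis image_eqI int_span_superset lessThan_iff power_Suc)
  next
    case False
    have sum_mem: "(\<Sum>j\<in>J. - Polynomial.coeff p j * x ^ j) \<in> ?S" if "finite J" "J \<subseteq> {..<n}" for J
      using that
    proof (induction J rule: finite_induct)
      case (insert j J)
      have "- Polynomial.coeff p j * x ^ j \<in> ?S" using insert p(2) by (intro prod_span_incl) auto
      then have "- Polynomial.coeff p j * x ^ j + (\<Sum>j\<in>J. - Polynomial.coeff p j * x ^ j) \<in> ?S"
        using insert by (intro prod_span_plus) auto
      then show ?case using insert by simp
    qed (simp add: prod_span.zero)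
    have "0 = (\<Sum>j\<le>n. Polynomial.coeff p j * x ^ j)"
      using p(3) by (simp add: poly_altdef n_def)
    also have "\<dots> = x ^ n + (\<Sum>j<n. Polynomial.coeff p j * x ^ j)"
      using p(1) by (simp add: lessThan_Suc_atMost[symmetric] n_def)
    finally have "x ^ n = (\<Sum>j<n. - Polynomial.coeff p j * x ^ j)"
      by (simp add: sum_negf eq_neg_iff_add_eq_0)
    moreover have "Suc i = n" using False that by simp
    ultimately show ?thesis using sum_mem[of "{..<n}"] by (metis finite_lessThan order_refl power_Suc)
  qed
  ultimately show ?thesis by blast
qed

text \<open>The products \<open>x ^ i * y ^ j\<close> span a module stable under both numbers, hence
  under their sum and product. With \<open>algebraic_int_if_stable\<close> this makes the algebraic
  integers a ring.\<close>

lemma algebraic_int_common_module: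
  fixes x y :: "'a::field_char_0"
  assumes "algebraic_int x" "algebraic_int y"
  obtains B where "finite B" "1 \<in> B" "\<And>b. b \<in> B \<Longrightarrow> x * b \<in> \<int> \<star> B" "\<And>b. b \<in> B \<Longrightarrow> y * b \<in> \<int> \<star> B"
proof -
  obtain n where n: "n > 0" "\<And>i. i < n \<Longrightarrow> x * x ^ i \<in> \<int> \<star> ((^) x ` {..<n})"
    using algebraic_int_stable_powers[OF assms(1)] by blast
  obtain m where m: "m > 0" "\<And>i. i < m \<Longrightarrow> y * y ^ i \<in> \<int> \<star> ((^) y ` {..<m})"
    using algebraic_int_stable_powers[OF assms(2)] by blast
  define B where "B = (\<lambda>(i, j). x ^ i * y ^ j) ` ({..<n} \<times> {..<m})"
  have x_mult: "c * d \<in> \<int> \<star> B" if "c \<in> \<int> \<star> ((^) x ` {..<n})" "d \<in> (^) y ` {..<m}" for c d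
    using that(1)
  proof induction
    case (add c a b)
    have "b * d \<in> B" using add that(2) by (force simp: B_def)
    then show ?case using add.IH add.hyps
      by (auto simp: distrib_right mult.assoc intro!: prod_span.add)
  qed (simp add: prod_span.zero)
  have y_mult: "c * d \<in> \<int> \<star> B" if "c \<in> \<int> \<star> ((^) y ` {..<m})" "d \<in> (^) x ` {..<n}" for c d
    using that(1)
  proof induction
    case (add c a b)
    have "b * d \<in> B" using add that(2) by (force simp: B_def mult.commute)
    then show ?case using add.IH add.hyps
      by (auto simp: distrib_right mult.assoc intro!: prod_span.add)
  qed (simp add: prod_span.zero)
  show thesis
  proof (rule that[of B])
    show "finite B" by (simp add: B_def)
    show "1 \<in> B" unfolding B_def using n m by (auto intro!: image_eqI[of _ _ "(0, 0)"])
  next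
    fix b assume "b \<in> B"
    then obtain i j where ij: "i < n" "j < m" "b = x ^ i * y ^ j" by (auto simp: B_def)
    show "x * b \<in> \<int> \<star> B" using x_mult[OF n(2)[OF ij(1)], of "y ^ j"] ij by (simp add: mult.assoc)
    show "y * b \<in> \<int> \<star> B" using y_mult[OF m(2)[OF ij(2)], of "x ^ i"] ij by (simp add: ac_simps)
  qed
qed

lemma algebraic_int_add:
  fixes x y :: "'a::field_char_0"
  assumes "algebraic_int x" "algebraic_int y"
  shows "algebraic_int (x + y)"
proof -
  obtain B where "finite B" "1 \<in> B" "\<And>b. b \<in> B \<Longrightarrow> x * b \<in> \<int> \<star> B" "\<And>b. b \<in> B \<Longrightarrow> y * b \<in> \<int> \<star> B"
    using algebraic_int_common_module[OF assms] by blast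
  then show ?thesis
    by (intro algebraic_int_if_stable[of B 1]) (auto simp: distrib_right intro: prod_span_plus)
qed

lemma algebraic_int_mult:
  fixes x y :: "'a::field_char_0"
  assumes "algebraic_int x" "algebraic_int y"
  shows "algebraic_int (x * y)"
proof -
  obtain B where "finite B" "1 \<in> B" "\<And>b. b \<in> B \<Longrightarrow> x * b \<in> \<int> \<star> B" "\<And>b. b \<in> B \<Longrightarrow> y * b \<in> \<int> \<star> B"
    using algebraic_int_common_module[OF assms] by blast
  then show ?thesis
    by (intro algebraic_int_if_stable[of B 1]) (auto simp: mult.assoc intro: int_span_closed)
qed

lemma algebraic_int_diff:
  fixes x y :: "'a::field_char_0"
  shows "algebraic_int x \<Longrightarrow> algebraic_int y \<Longrightarrow> algebraic_int (x - y)"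
  using algebraic_int_add[of x "- y"] by simp

text \<open>Transitivity of integrality in degree 2, the case that a tower of quadratic extensions
  requires. If \<open>B\<close> spans a module stable under \<open>t\<close> and \<open>n\<close>,
  then \<open>B\<close> together with its multiples by \<open>z\<close> spans one stable under
  \<open>z\<close>.\<close>

lemma algebraic_int_quadratic:
  fixes z :: "'a::field_char_0"
  assumes "algebraic_int t" "algebraic_int n" and z: "z * z = t * z - n"
  shows "algebraic_int z"
proof -
  obtain B where B: "finite B" "1 \<in> B" "\<And>b. b \<in> B \<Longrightarrow> t * b \<in> \<int> \<star> B" "\<And>b. b \<in> B \<Longrightarrow> n * b \<in> \<int> \<star> B"
    using algebraic_int_common_module[OF assms(1,2)] by blast
  define C where "C = B \<union> (*) z ` B"
  have sub: "\<int> \<star> B \<subseteq> \<int> \<star> C" by (rule prod_span_mono) (auto simp: C_def)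
  have zsub: "z * x \<in> \<int> \<star> C" if "x \<in> \<int> \<star> B" for x
    using that
  proof induction
    case (add x a b)
    have "a * (z * b) \<in> \<int> \<star> C" using add by (intro prod_span_incl) (auto simp: C_def)
    from prod_span_plus[OF add.IH this] show ?case by (simp add: algebra_simps)
  qed (simp add: prod_span.zero)
  show ?thesis
  proof (rule algebraic_int_if_stable[of C 1])
    fix b assume "b \<in> C"
    then consider "b \<in> B" | b' where "b' \<in> B" "b = z * b'" by (auto simp: C_def)
    then show "z * b \<in> \<int> \<star> C"
    proof cases
      case 1
      then show ?thesis by (intro zsub int_span_superset)
    next
      case 2
      have "z * b = (z * z) * b'" using 2 by simp
      also have "\<dots> = z * (t * b') + (- 1) * (n * b')"
        by (simp add: z left_diff_distrib mult.assoc mult.left_commute)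
      finally have "z * b = z * (t * b') + (- 1) * (n * b')" .
      moreover have "(- 1) * (n * b') \<in> \<int> \<star> C"
        by (rule int_span_scale) (use B(4)[of b'] 2 sub in auto)
      ultimately show ?thesis
        using prod_span_plus[OF zsub[OF B(3)[of b']]] 2 by metis
    qed
  qed (use B in \<open>auto simp: C_def\<close>)
qed

lemma algebraic_int_square_root:
  fixes x :: "'a::field_char_0"
  shows "algebraic_int (x * x) \<Longrightarrow> algebraic_int x"
  by (rule algebraic_int_quadratic[of 0 "- (x * x)"]) simp_all

subsection \<open>Fractional ideals\<close>

text \<open>No field of fractions is mentioned: the common denominator \<open>d\<close> makes every
  element a \<open>fraction\<close>. Negatives are covered by multiplication with -1 from the
  subring \<open>R\<close>, and the zero ideal is excluded so that all fractional ideals can be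
  invertible.\<close>

definition frac_ideal :: "'a::field set \<Rightarrow> 'a set \<Rightarrow> bool"
  where "frac_ideal R I \<longleftrightarrow>
    (\<forall>x\<in>I. \<forall>y\<in>I. x + y \<in> I) \<and> (\<forall>r\<in>R. \<forall>x\<in>I. r * x \<in> I) \<and> (\<exists>x\<in>I. x \<noteq> 0) \<and>
    (\<exists>d\<in>R. d \<noteq> 0 \<and> (\<forall>x\<in>I. d * x \<in> R))"

definition fraction :: "'a::field set \<Rightarrow> 'a \<Rightarrow> bool"
  where "fraction R a \<longleftrightarrow> (\<exists>d\<in>R. d \<noteq> 0 \<and> d * a \<in> R)"

locale subring_of_field =
  fixes R :: "'a::field set"
  assumes one_closed: "1 \<in> R"
    and diff_closed: "x \<in> R \<Longrightarrow> y \<in> R \<Longrightarrow> x - y \<in> R"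
    and mult_closed: "x \<in> R \<Longrightarrow> y \<in> R \<Longrightarrow> x * y \<in> R"
begin

lemma zero_closed: "0 \<in> R" using diff_closed[OF one_closed one_closed] by simp
lemma minus_closed: "x \<in> R \<Longrightarrow> - x \<in> R" using diff_closed[OF zero_closed] by force
lemma plus_closed: "x \<in> R \<Longrightarrow> y \<in> R \<Longrightarrow> x + y \<in> R" using diff_closed[OF _ minus_closed] by force

lemma of_nat_closed: "of_nat n \<in> R"
  by (induction n) (auto intro: zero_closed one_closed plus_closed)

lemma of_int_closed: "of_int n \<in> R"
  using of_nat_closed[of "nat n"] of_nat_closed[of "nat (- n)", THEN minus_closed]
  by (cases "n \<ge> 0") simp_all

lemma power_closed: "x \<in> R \<Longrightarrow> x ^ n \<in> R"
  by (induction n) (auto intro: one_closed mult_closed)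

lemma frac_plus: "frac_ideal R I \<Longrightarrow> x \<in> I \<Longrightarrow> y \<in> I \<Longrightarrow> x + y \<in> I"
  by (auto simp: frac_ideal_def)

lemma frac_mult: "frac_ideal R I \<Longrightarrow> r \<in> R \<Longrightarrow> x \<in> I \<Longrightarrow> r * x \<in> I"
  by (auto simp: frac_ideal_def)

lemma frac_minus: "frac_ideal R I \<Longrightarrow> x \<in> I \<Longrightarrow> - x \<in> I"
  using frac_mult[OF _ minus_closed[OF one_closed]] by force

lemma frac_diff: "frac_ideal R I \<Longrightarrow> x \<in> I \<Longrightarrow> y \<in> I \<Longrightarrow> x - y \<in> I"
  using frac_plus[OF _ _ frac_minus] by force

lemma frac_zero: "frac_ideal R I \<Longrightarrow> 0 \<in> I"
  using frac_diff frac_ideal_def by (metis diff_self)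

lemma frac_fraction: "frac_ideal R I \<Longrightarrow> x \<in> I \<Longrightarrow> fraction R x"
  by (auto simp: frac_ideal_def fraction_def)

lemma fraction_mult:
  assumes "fraction R a" "fraction R b"
  shows "fraction R (a * b)"
proof -
  obtain d e where de: "d \<in> R" "d \<noteq> 0" "d * a \<in> R" "e \<in> R" "e \<noteq> 0" "e * b \<in> R"
    using assms unfolding fraction_def by blast
  have "(d * a) * (e * b) \<in> R" using mult_closed[OF de(3,6)] .
  then have "(d * e) * (a * b) \<in> R" by (simp only: ac_simps)
  moreover have "d * e \<in> R" "d * e \<noteq> 0" using de by (auto intro: mult_closed)
  ultimately show ?thesis unfolding fraction_def by blast
qed

lemma fraction_inverse: "fraction R a \<Longrightarrow> a \<noteq> 0 \<Longrightarrow> fraction R (inverse a)"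
  unfolding fraction_def
proof (elim bexE conjE)
  fix d assume "d \<in> R" "d \<noteq> 0" "d * a \<in> R" "a \<noteq> 0"
  then show "\<exists>d\<in>R. d \<noteq> 0 \<and> d * inverse a \<in> R"
    by (intro bexI[of _ "d * a"]) (simp_all add: mult.assoc)
qed

lemma fraction_divide: "fraction R a \<Longrightarrow> fraction R b \<Longrightarrow> b \<noteq> 0 \<Longrightarrow> fraction R (a / b)"
  unfolding divide_inverse by (rule fraction_mult[OF _ fraction_inverse])

lemma fraction_closed: "x \<in> R \<Longrightarrow> fraction R x"
  unfolding fraction_def by (rule bexI[OF _ one_closed]) simp

lemma frac_ring: "frac_ideal R R"
  unfolding frac_ideal_def
  by (intro conjI ballI plus_closed mult_closed bexI[OF _ one_closed]) (simp_all add: one_closed)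

lemma frac_scale:
  assumes I: "frac_ideal R I" and a: "fraction R a" "a \<noteq> 0"
  shows "frac_ideal R (a \<cdot> I)"
proof -
  obtain d e where de: "d \<in> R" "d \<noteq> 0" "\<And>x. x \<in> I \<Longrightarrow> d * x \<in> R" "e \<in> R" "e \<noteq> 0" "e * a \<in> R"
    using I a unfolding frac_ideal_def fraction_def by blast
  have "(d * e) * x \<in> R" if x: "x \<in> a \<cdot> I" for x
  proof -
    obtain y where y: "y \<in> I" "x = a * y" using x by (auto simp: scale_def)
    have "(d * y) * (e * a) \<in> R" using mult_closed[OF de(3)[OF y(1)] de(6)] .
    then show ?thesis by (simp only: y ac_simps)
  qed
  moreover have "d * e \<in> R" "d * e \<noteq> 0" using de by (auto intro: mult_closed)
  ultimately have "\<exists>d\<in>R. d \<noteq> 0 \<and> (\<forall>x\<in>a \<cdot> I. d * x \<in> R)" by blast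
  moreover have "\<exists>x\<in>a \<cdot> I. x \<noteq> 0"
    using I a unfolding frac_ideal_def scale_def by auto
  ultimately show ?thesis
    using I a unfolding frac_ideal_def[of R "a \<cdot> I"]
    by (auto simp: scale_iff add_divide_distrib frac_plus frac_mult simp flip: times_divide_eq_right)
qed

lemma frac_principal: "fraction R a \<Longrightarrow> a \<noteq> 0 \<Longrightarrow> frac_ideal R (a \<cdot> R)"
  by (rule frac_scale[OF frac_ring])

lemma frac_prod: "frac_ideal R I \<Longrightarrow> frac_ideal R J \<Longrightarrow> frac_ideal R (I \<star> J)"
proof -
  assume I: "frac_ideal R I" and J: "frac_ideal R J"
  obtain d e where de: "d \<in> R" "d \<noteq> 0" "\<And>x. x \<in> I \<Longrightarrow> d * x \<in> R" "e \<in> R" "e \<noteq> 0" "\<And>x. x \<in> J \<Longrightarrow> e * x \<in> R"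
    using I J unfolding frac_ideal_def by blast
  have "(d * e) * x \<in> R" if "x \<in> I \<star> J" for x
    using that
  proof induction
    case (add x a b)
    then have "(d * a) * (e * b) \<in> R" using de(3,6) mult_closed by blast
    from plus_closed[OF add.IH this] show ?case by (simp only: distrib_left ac_simps)
  qed (simp add: zero_closed)
  then have "\<exists>d\<in>R. d \<noteq> 0 \<and> (\<forall>x\<in>I \<star> J. d * x \<in> R)"
    using mult_closed[OF de(1,4)] no_zero_divisors[OF de(2,5)] by blast
  moreover obtain a b where "a \<in> I" "b \<in> J" "a \<noteq> 0" "b \<noteq> 0"
    using I J unfolding frac_ideal_def by blast
  then have "\<exists>x\<in>I \<star> J. x \<noteq> 0" by (intro bexI[of _ "a * b"] prod_span_incl) auto
  ultimately show ?thesis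
    unfolding frac_ideal_def[of R "I \<star> J"]
    by (intro conjI ballI prod_span_plus prod_span_mult_left[OF frac_mult[OF I]])
qed

lemma frac_prod_ring: "frac_ideal R I \<Longrightarrow> I \<star> R = I"
proof
  assume I: "frac_ideal R I"
  show "I \<star> R \<subseteq> I"
  proof (rule prod_span_least)
    fix x r assume "x \<in> I" "r \<in> R"
    then show "x * r \<in> I" using frac_mult[OF I, of r x] by (simp add: mult.commute)
  qed (use frac_plus[OF I] frac_zero[OF I] in auto)
  show "I \<subseteq> I \<star> R"
    using prod_span_incl[OF _ one_closed] by fastforce
qed

lemma ring_prod_ring: "R \<star> R = R"
  by (rule frac_prod_ring[OF frac_ring])

lemma principal_prod: "(a \<cdot> R) \<star> (b \<cdot> R) = (a * b) \<cdot> R"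
  by (simp add: scale_prod_left scale_prod_right scale_scale ring_prod_ring mult.commute)

lemma prod_principal: "frac_ideal R I \<Longrightarrow> I \<star> (a \<cdot> R) = a \<cdot> I"
  by (simp add: scale_prod_right frac_prod_ring)

lemma principal_mem: "a \<in> a \<cdot> R"
  using scale_mem[OF one_closed, of a] by simp

lemma principal_le_iff: "b \<noteq> 0 \<Longrightarrow> a \<cdot> R \<subseteq> b \<cdot> R \<longleftrightarrow> a / b \<in> R"
proof
  assume "b \<noteq> 0" "a / b \<in> R"
  then show "a \<cdot> R \<subseteq> b \<cdot> R"
    using mult_closed[of "a / b"] by (auto simp: scale_iff) (auto simp: scale_def)
qed (use principal_mem[of a] in \<open>auto simp: scale_iff\<close>)

lemma principal_eq_iff: "a \<noteq> 0 \<Longrightarrow> b \<noteq> 0 \<Longrightarrow> a \<cdot> R = b \<cdot> R \<longleftrightarrow> a / b \<in> R \<and> b / a \<in> R"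
  using principal_le_iff[of b a] principal_le_iff[of a b] by blast

lemma unit_scale:
  assumes "frac_ideal R I" "u \<in> R" "inverse u \<in> R" "u \<noteq> 0"
  shows "u \<cdot> I = I"
proof -
  have "u \<cdot> R = R" using principal_eq_iff[of u 1] assms by (simp add: field_simps)
  then show ?thesis using prod_principal[OF assms(1), of u] frac_prod_ring[OF assms(1)] by simp
qed

end

text \<open>Invertibility of all fractional ideals characterizes Dedekind domains. It gives
  cancellation, and in this form it passes from a ring to a quadratic extension.\<close>

locale dedekind_ring = subring_of_field +
  assumes invertible: "frac_ideal R I \<Longrightarrow> \<exists>J. frac_ideal R J \<and> I \<star> J = R"
begin

lemma cancel_le:
  assumes I: "frac_ideal R I" and "frac_ideal R A" "frac_ideal R B" and sub: "I \<star> A \<subseteq> I \<star> B"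
  shows "A \<subseteq> B"
proof -
  obtain J where J: "frac_ideal R J" "I \<star> J = R" using invertible[OF I] by blast
  have *: "J \<star> (I \<star> C) = C" if "frac_ideal R C" for C
    using J frac_prod_ring[OF that] by (metis prod_span_assoc prod_span_commute)
  show ?thesis
    using prod_span_mono[OF order_refl sub, of J] * assms by simp
qed

lemma cancel:
  assumes "frac_ideal R I" and "frac_ideal R A" "frac_ideal R B" and "I \<star> A = I \<star> B"
  shows "A = B"
  using cancel_le[of I A B] cancel_le[of I B A] assms by auto

text \<open>Uniqueness of square roots without prime factors. For \<open>x\<close> in
  \<open>A\<close> the square of \<open>x / g\<close> lies in \<open>R\<close>, so integral
  closedness (\<open>closed\<close>) gives \<open>A \<subseteq> g \<cdot> R\<close>. Cancelling
  \<open>g \<cdot> R\<close> from \<open>(g \<cdot> R) \<star> (g \<cdot> R) \<subseteq> (g \<cdot>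
  R) \<star> A\<close> gives the other inclusion.\<close>

lemma square_principal:
  assumes A: "frac_ideal R A" and sq: "A \<star> A = (g * g) \<cdot> R" and g: "g \<noteq> 0" "fraction R g"
    and closed: "\<And>x. fraction R x \<Longrightarrow> x * x \<in> R \<Longrightarrow> x \<in> R"
  shows "A = g \<cdot> R"
proof
  show sub: "A \<subseteq> g \<cdot> R"
  proof
    fix x assume x: "x \<in> A"
    then have "x * x \<in> (g * g) \<cdot> R" using prod_span_incl[OF x x] sq by simp
    then have "(x / g) * (x / g) \<in> R" using g by (simp add: scale_iff)
    then have "x / g \<in> R" using closed fraction_divide frac_fraction[OF A x] g by blast
    then show "x \<in> g \<cdot> R" using g by (simp add: scale_iff)
  qed
  have fg: "frac_ideal R (g \<cdot> R)" using frac_principal g by blast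
  have "(g \<cdot> R) \<star> (g \<cdot> R) \<subseteq> (g \<cdot> R) \<star> A"
    using prod_span_mono[OF sub order_refl, of A] sq principal_prod by simp
  then show "g \<cdot> R \<subseteq> A" using cancel_le[OF fg fg A] by simp
qed

end

subsection \<open>Integers in quadratic extensions\<close>

locale subfield_set =
  fixes F :: "'a::field_char_0 set"
  assumes F_one: "1 \<in> F"
    and F_diff: "x \<in> F \<Longrightarrow> y \<in> F \<Longrightarrow> x - y \<in> F"
    and F_mult: "x \<in> F \<Longrightarrow> y \<in> F \<Longrightarrow> x * y \<in> F"
    and F_inverse: "x \<in> F \<Longrightarrow> inverse x \<in> F"
begin

sublocale F: subring_of_field F
  by unfold_locales (fact F_one F_diff F_mult)+

lemma F_divide: "x \<in> F \<Longrightarrow> y \<in> F \<Longrightarrow> x / y \<in> F"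
  unfolding divide_inverse by (intro F_mult F_inverse)

lemmas F_closed = F_one F.zero_closed F_diff F_mult F_divide F.minus_closed F.plus_closed F_inverse
  F.of_nat_closed F.of_int_closed F.power_closed

definition ints :: "'a set" where "ints = {x \<in> F. algebraic_int x}"

sublocale ints: subring_of_field ints
  by unfold_locales (auto simp: ints_def F_closed intro: algebraic_int_diff algebraic_int_mult)

lemma ints_sub: "x \<in> ints \<Longrightarrow> x \<in> F"
  by (simp add: ints_def)

lemma fraction_in_F: "fraction ints x \<Longrightarrow> x \<in> F"
proof -
  assume "fraction ints x"
  then obtain d where "d \<in> ints" "d \<noteq> 0" "d * x \<in> ints" by (auto simp: fraction_def)
  then have "(d * x) / d \<in> F" by (intro F_divide ints_sub)
  then show ?thesis using \<open>d \<noteq> 0\<close> by simp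
qed

lemma ints_square_closed: "fraction ints x \<Longrightarrow> x * x \<in> ints \<Longrightarrow> x \<in> ints"
  using fraction_in_F by (auto simp: ints_def intro: algebraic_int_square_root)

end

text \<open>Instantiated twice below: over \<open>\<rat>\<close> with the square root of
  \<open>p\<close>, then over \<open>k.fld\<close> with the square root of
  \<open>\<epsilon>\<close>. Conjugation, trace and norm are always relative to one quadratic
  step.\<close>

locale quadratic_extension = subfield_set +
  fixes \<delta> :: "'a::field_char_0"
  assumes delta_sq: "\<delta> * \<delta> \<in> F" and delta_notin: "\<delta> \<notin> F"
begin

definition fld :: "'a set" where "fld = {x + y * \<delta> | x y. x \<in> F \<and> y \<in> F}"

lemma fldE:
  assumes "z \<in> fld" obtains x y where "x \<in> F" "y \<in> F" "z = x + y * \<delta>"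
  using assms by (auto simp: fld_def)

lemma fldI: "x \<in> F \<Longrightarrow> y \<in> F \<Longrightarrow> x + y * \<delta> \<in> fld"
  by (auto simp: fld_def)

lemma repr_unique:
  assumes "x \<in> F" "y \<in> F" "x' \<in> F" "y' \<in> F" "x + y * \<delta> = x' + y' * \<delta>"
  shows "x = x' \<and> y = y'"
proof (cases "y = y'")
  case False
  then have "\<delta> = (x' - x) / (y - y')" using assms(5) by (simp add: field_simps)
  also have "\<dots> \<in> F" using assms by (intro F_closed)
  finally show ?thesis using delta_notin by simp
qed (use assms in simp)

lemma repr_zero: "x \<in> F \<Longrightarrow> y \<in> F \<Longrightarrow> x + y * \<delta> = 0 \<longleftrightarrow> x = 0 \<and> y = 0"
  using repr_unique[of x y 0 0] F_closed by auto

definition cj :: "'a \<Rightarrow> 'a"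
  where "cj z = (THE w. \<exists>x\<in>F. \<exists>y\<in>F. z = x + y * \<delta> \<and> w = x - y * \<delta>)"

lemma cj_repr: "x \<in> F \<Longrightarrow> y \<in> F \<Longrightarrow> cj (x + y * \<delta>) = x - y * \<delta>"
  unfolding cj_def by (rule the_equality) (use repr_unique in blast)+

lemma F_sub_fld: "x \<in> F \<Longrightarrow> x \<in> fld"
  using fldI[of x 0] F_closed by simp

lemma delta_in_fld: "\<delta> \<in> fld"
  using fldI[of 0 1] F_closed by simp

lemma cj_F: "x \<in> F \<Longrightarrow> cj x = x"
  using cj_repr[of x 0] F_closed by simp

lemma cj_delta: "cj \<delta> = - \<delta>"
  using cj_repr[of 0 1] F_closed by simp

lemma delta_nonzero: "\<delta> \<noteq> 0"
  using delta_notin F_closed by auto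

lemma cj_in_fld: "z \<in> fld \<Longrightarrow> cj z \<in> fld"
  using fldI[of _ "- _"] by (auto simp: cj_repr F_closed elim!: fldE)

lemma cj_cj [simp]: "z \<in> fld \<Longrightarrow> cj (cj z) = z"
proof (erule fldE)
  fix x y assume xy: "x \<in> F" "y \<in> F" and z: "z = x + y * \<delta>"
  show ?thesis using cj_repr[of x "- y"] xy by (simp add: z cj_repr F_closed)
qed

lemma plus_repr: "(x + y * \<delta>) + (x' + y' * \<delta>) = (x + x') + (y + y') * \<delta>"
  by (simp add: algebra_simps)

lemma mult_repr: "(x + y * \<delta>) * (x' + y' * \<delta>) = (x * x' + y * y' * (\<delta> * \<delta>)) + (x * y' + y * x') * \<delta>"
  by (simp add: algebra_simps)

lemma fld_plus: "z \<in> fld \<Longrightarrow> w \<in> fld \<Longrightarrow> z + w \<in> fld"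
  by (elim fldE) (simp add: plus_repr fldI F_closed)

lemma fld_mult: "z \<in> fld \<Longrightarrow> w \<in> fld \<Longrightarrow> z * w \<in> fld"
  by (elim fldE) (simp only: mult_repr, intro fldI F_closed delta_sq)

lemma fld_uminus: "z \<in> fld \<Longrightarrow> - z \<in> fld"
  using fld_mult[OF F_sub_fld[of "- 1"]] F_closed by simp

lemma fld_diff: "z \<in> fld \<Longrightarrow> w \<in> fld \<Longrightarrow> z - w \<in> fld"
  using fld_plus[of z "- w"] fld_uminus by simp

lemma cj_plus: "z \<in> fld \<Longrightarrow> w \<in> fld \<Longrightarrow> cj (z + w) = cj z + cj w"
  by (elim fldE) (simp add: plus_repr cj_repr F_closed, simp add: algebra_simps)

lemma cj_mult: "z \<in> fld \<Longrightarrow> w \<in> fld \<Longrightarrow> cj (z * w) = cj z * cj w"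
proof (elim fldE)
  fix x y x' y' assume xy: "x \<in> F" "y \<in> F" "x' \<in> F" "y' \<in> F" and zw: "z = x + y * \<delta>" "w = x' + y' * \<delta>"
  have "cj (z * w) = (x * x' + y * y' * (\<delta> * \<delta>)) - (x * y' + y * x') * \<delta>"
    unfolding zw mult_repr using xy by (intro cj_repr F_closed delta_sq)
  also have "\<dots> = cj z * cj w"
    using xy by (simp add: zw cj_repr) (simp add: algebra_simps)
  finally show ?thesis .
qed

lemma cj_uminus: "z \<in> fld \<Longrightarrow> cj (- z) = - cj z"
  using cj_mult[OF F_sub_fld[of "- 1"]] cj_F[of "- 1"] F_closed by simp

lemma cj_diff: "z \<in> fld \<Longrightarrow> w \<in> fld \<Longrightarrow> cj (z - w) = cj z - cj w"
  using cj_plus[of z "- w"] by (simp add: cj_uminus fld_uminus)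

lemma cj_fixed_iff: "z \<in> fld \<Longrightarrow> cj z = z \<longleftrightarrow> z \<in> F"
proof (elim fldE)
  fix x y assume xy: "x \<in> F" "y \<in> F" and z: "z = x + y * \<delta>"
  show ?thesis
  proof
    assume "cj z = z"
    then have "2 * (y * \<delta>) = 0" using xy cj_repr[of x y] by (simp add: z algebra_simps)
    then have "y = 0" using delta_nonzero by simp
    then show "z \<in> F" using xy by (simp add: z)
  qed (rule cj_F)
qed

lemma cj_zero_iff: "z \<in> fld \<Longrightarrow> cj z = 0 \<longleftrightarrow> z = 0"
  using cj_cj[of z] cj_F[of 0] F_closed by metis

lemma fld_inverse: "z \<in> fld \<Longrightarrow> inverse z \<in> fld"
proof (cases "z = 0")
  case False
  assume z: "z \<in> fld"
  have "z * cj z \<in> F"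
    using z cj_fixed_iff[of "z * cj z"] by (simp add: cj_mult cj_in_fld fld_mult mult.commute)
  then have "cj z * inverse (z * cj z) \<in> fld"
    using fld_mult[OF cj_in_fld[OF z] F_sub_fld[OF F_inverse]] by blast
  moreover have "cj z * inverse (z * cj z) = inverse z"
    using False cj_zero_iff[OF z] by simp
  ultimately show ?thesis by metis
qed simp

lemma cj_inverse: "z \<in> fld \<Longrightarrow> cj (inverse z) = inverse (cj z)"
proof (cases "z = 0")
  case False
  assume z: "z \<in> fld"
  have "cj (inverse z) * cj z = 1"
    using cj_mult[OF fld_inverse[OF z] z] False cj_F[OF F_one] by simp
  then show ?thesis by (metis inverse_unique mult.commute)
qed (simp add: cj_F F_closed)

lemma cj_divide: "z \<in> fld \<Longrightarrow> w \<in> fld \<Longrightarrow> cj (z / w) = cj z / cj w"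
  by (simp add: divide_inverse cj_mult cj_inverse fld_inverse)

sublocale fld: subfield_set fld
  by unfold_locales (auto intro: F_sub_fld F_one fld_diff fld_mult fld_inverse)

section \<open>Integers, relative trace and relative norm of a quadratic extension\<close>

abbreviation OF where "OF \<equiv> ints"
abbreviation OK where "OK \<equiv> fld.ints"

definition tr :: "'a \<Rightarrow> 'a" where "tr z = z + cj z"
definition nm :: "'a \<Rightarrow> 'a" where "nm z = z * cj z"

lemma tr_in_F: "z \<in> fld \<Longrightarrow> tr z \<in> F"
  using cj_fixed_iff[of "tr z"] by (simp add: tr_def cj_plus cj_in_fld fld_plus add.commute)

lemma nm_in_F: "z \<in> fld \<Longrightarrow> nm z \<in> F"
  using cj_fixed_iff[of "nm z"] by (simp add: nm_def cj_mult cj_in_fld fld_mult mult.commute)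

lemma nm_mult: "z \<in> fld \<Longrightarrow> w \<in> fld \<Longrightarrow> nm (z * w) = nm z * nm w"
  by (simp add: nm_def cj_mult)

lemma nm_divide: "z \<in> fld \<Longrightarrow> w \<in> fld \<Longrightarrow> nm (z / w) = nm z / nm w"
  by (simp add: nm_def cj_divide)

lemma nm_F: "x \<in> F \<Longrightarrow> nm x = x * x"
  by (simp add: nm_def cj_F)

lemma nm_zero_iff: "z \<in> fld \<Longrightarrow> nm z = 0 \<longleftrightarrow> z = 0"
  by (simp add: nm_def cj_zero_iff)

lemma nm_cj: "z \<in> fld \<Longrightarrow> nm (cj z) = nm z"
  by (simp add: nm_def mult.commute)

lemma nm_repr: "x \<in> F \<Longrightarrow> y \<in> F \<Longrightarrow> nm (x + y * \<delta>) = x * x - y * y * (\<delta> * \<delta>)"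
  using cj_repr[of x y] by (simp add: nm_def) (simp add: algebra_simps)

lemma tr_plus: "z \<in> fld \<Longrightarrow> w \<in> fld \<Longrightarrow> tr (z + w) = tr z + tr w"
  by (simp add: tr_def cj_plus algebra_simps)

lemma tr_F_mult: "x \<in> F \<Longrightarrow> z \<in> fld \<Longrightarrow> tr (x * z) = x * tr z"
  by (simp add: tr_def cj_mult cj_F F_sub_fld algebra_simps)

text \<open>Conjugation fixes integer coefficients, so it maps roots of an integral polynomial to
  roots.\<close>

lemma cj_algebraic_int:
  assumes z: "z \<in> fld" and "algebraic_int z"
  shows "algebraic_int (cj z)"
proof -
  obtain p where p: "lead_coeff p = 1" "\<forall>i. Polynomial.coeff p i \<in> \<int>" "poly p z = 0"
    using assms(2) by (auto elim: algebraic_int.cases)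
  have "poly q (cj z) = cj (poly q z) \<and> poly q z \<in> fld" if "\<forall>i. Polynomial.coeff q i \<in> \<int>" for q
    using that
  proof (induction q)
    case 0
    then show ?case using cj_F[of 0] F_closed F_sub_fld by simp
  next
    case (pCons a q)
    then have "Polynomial.coeff (pCons a q) 0 \<in> \<int>" "Polynomial.coeff (pCons a q) (Suc i) \<in> \<int>" for i
      by blast+
    then have a: "a \<in> F" and q: "\<forall>i. Polynomial.coeff q i \<in> \<int>"
      using F.of_int_closed by (auto elim!: Ints_cases)
    then show ?case using pCons.IH z
      by (simp add: cj_plus cj_mult cj_F F_sub_fld fld_plus fld_mult)
  qed
  from this[OF p(2)] have "poly p (cj z) = 0" using p(3) cj_F[of 0] F_closed by simp
  then show ?thesis using p by (intro algebraic_int.intros[of p]) auto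
qed

lemma cj_OK: "z \<in> OK \<Longrightarrow> cj z \<in> OK"
  by (auto simp: fld.ints_def cj_in_fld cj_algebraic_int)

lemma OF_sub_OK: "x \<in> OF \<Longrightarrow> x \<in> OK"
  by (auto simp: ints_def fld.ints_def F_sub_fld)

lemma OK_inter_F: "x \<in> OK \<Longrightarrow> x \<in> F \<Longrightarrow> x \<in> OF"
  by (auto simp: ints_def fld.ints_def)

lemma OK_sub_fld: "z \<in> OK \<Longrightarrow> z \<in> fld"
  by (simp add: fld.ints_def)

lemma tr_OK: "z \<in> OK \<Longrightarrow> tr z \<in> OF"
  by (rule OK_inter_F) (auto simp: tr_def[symmetric] intro: tr_in_F OK_sub_fld,
      auto simp: tr_def intro: fld.ints.plus_closed cj_OK)

lemma nm_OK: "z \<in> OK \<Longrightarrow> nm z \<in> OF"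
  by (rule OK_inter_F) (auto simp: nm_def[symmetric] intro: nm_in_F OK_sub_fld,
      auto simp: nm_def intro: fld.ints.mult_closed cj_OK)

text \<open>\<open>z\<close> is a root of the monic quadratic polynomial with coefficients
  \<open>- tr z\<close> and \<open>nm z\<close>.\<close>

lemma OK_iff:
  assumes "z \<in> fld"
  shows "z \<in> OK \<longleftrightarrow> tr z \<in> OF \<and> nm z \<in> OF"
proof
  assume *: "tr z \<in> OF \<and> nm z \<in> OF"
  have "algebraic_int z"
    by (rule algebraic_int_quadratic[of "tr z" "nm z"])
       (use * in \<open>auto simp: ints_def tr_def nm_def algebra_simps\<close>)
  then show "z \<in> OK" using assms by (simp add: fld.ints_def)
qed (auto intro: tr_OK nm_OK)

lemma cj_scale: "a \<in> fld \<Longrightarrow> I \<subseteq> fld \<Longrightarrow> cj ` (a \<cdot> I) = cj a \<cdot> cj ` I"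
  unfolding scale_def image_image by (rule image_cong) (auto simp: cj_mult)

lemma cj_image_cj: "I \<subseteq> fld \<Longrightarrow> cj ` (cj ` I) = I"
  unfolding image_image by force

lemma cj_OK_image: "cj ` OK = OK"
proof
  show "cj ` OK \<subseteq> OK" using cj_OK by auto
  show "OK \<subseteq> cj ` OK" by (metis OK_sub_fld cj_OK cj_cj imageI subsetI)
qed

lemma frac_sub_fld: "frac_ideal OK I \<Longrightarrow> I \<subseteq> fld"
  using fld.ints.frac_fraction fld.fraction_in_F by blast

lemma frac_sub_F: "frac_ideal OF I \<Longrightarrow> I \<subseteq> F"
  using ints.frac_fraction fraction_in_F by blast

lemma cj_prod:
  assumes "I \<subseteq> fld" "J \<subseteq> fld"
  shows "cj ` (I \<star> J) = cj ` I \<star> cj ` J"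
proof -
  have *: "cj ` (I \<star> J) \<subseteq> cj ` I \<star> cj ` J" "I \<star> J \<subseteq> fld" if "I \<subseteq> fld" "J \<subseteq> fld" for I J
  proof -
    have "x \<in> fld \<and> cj x \<in> cj ` I \<star> cj ` J" if "x \<in> I \<star> J" for x
      using that
    proof induction
      case zero
      then show ?case using cj_F[of 0] F_closed F_sub_fld by (simp add: prod_span.zero)
    next
      case (add x a b)
      then have "a \<in> fld" "b \<in> fld" using \<open>I \<subseteq> fld\<close> \<open>J \<subseteq> fld\<close> by auto
      then show ?case using add by (auto simp: cj_plus cj_mult fld_plus fld_mult intro: prod_span.add)
    qed
    then show "cj ` (I \<star> J) \<subseteq> cj ` I \<star> cj ` J" "I \<star> J \<subseteq> fld" by auto
  qed
  have "cj ` (cj ` I \<star> cj ` J) \<subseteq> I \<star> J"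
    using *(1)[of "cj ` I" "cj ` J"] assms cj_in_fld by (auto simp: cj_image_cj image_subset_iff)
  then have "cj ` cj ` (cj ` I \<star> cj ` J) \<subseteq> cj ` (I \<star> J)" by blast
  moreover have "cj ` cj ` (cj ` I \<star> cj ` J) = cj ` I \<star> cj ` J"
    using *(2)[of "cj ` I" "cj ` J"] assms cj_in_fld by (intro cj_image_cj) blast
  ultimately show ?thesis using *(1)[OF assms] by blast
qed

lemma frac_cj:
  assumes I: "frac_ideal OK I"
  shows "frac_ideal OK (cj ` I)"
proof -
  note sub = frac_sub_fld[OF I]
  obtain d where d: "d \<in> OK" "d \<noteq> 0" "\<And>x. x \<in> I \<Longrightarrow> d * x \<in> OK"
    using I unfolding frac_ideal_def by blast
  have "cj d * x \<in> OK" if "x \<in> cj ` I" for x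
    using that d(1,3) sub cj_OK by (auto simp: cj_mult[symmetric] OK_sub_fld subset_iff)
  moreover have "cj d \<in> OK" "cj d \<noteq> 0" using d by (auto simp: cj_OK cj_zero_iff OK_sub_fld)
  ultimately have "\<exists>d\<in>OK. d \<noteq> 0 \<and> (\<forall>x\<in>cj ` I. d * x \<in> OK)" by blast
  moreover have "r * cj x \<in> cj ` I" if "r \<in> OK" "x \<in> I" for r x
  proof -
    have "cj (cj r * x) \<in> cj ` I" using that by (intro imageI fld.ints.frac_mult[OF I] cj_OK)
    then show ?thesis using that sub by (simp add: cj_mult cj_in_fld OK_sub_fld subset_iff)
  qed
  moreover have "cj x + cj y \<in> cj ` I" if "x \<in> I" "y \<in> I" for x y
    using that sub fld.ints.frac_plus[OF I] by (auto simp: cj_plus[symmetric] subset_iff)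
  moreover have "\<exists>x\<in>cj ` I. x \<noteq> 0"
    using I sub unfolding frac_ideal_def by (auto simp: cj_zero_iff subset_iff)
  ultimately show ?thesis unfolding frac_ideal_def by auto
qed

lemma frac_extend: "frac_ideal OF A \<Longrightarrow> frac_ideal OK (A \<star> OK)"
proof -
  assume A: "frac_ideal OF A"
  obtain d where d: "d \<in> OF" "d \<noteq> 0" "\<And>x. x \<in> A \<Longrightarrow> d * x \<in> OF"
    using A unfolding frac_ideal_def by blast
  have "d * x \<in> OK" if "x \<in> A \<star> OK" for x
    using prod_span_mult_left[OF d(3) that] prod_span_mono[of OF OK OK OK] OF_sub_OK fld.ints.ring_prod_ring
    by auto
  moreover have "r * x \<in> A \<star> OK" if "r \<in> OK" "x \<in> A \<star> OK" for r x
    using prod_span_mult_left[of OK r OK x A] that fld.ints.mult_closed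
    by (auto simp: prod_span_commute)
  moreover have "\<exists>x\<in>A \<star> OK. x \<noteq> 0"
    using A prod_span_incl[OF _ fld.ints.one_closed] unfolding frac_ideal_def by fastforce
  ultimately show ?thesis
    unfolding frac_ideal_def[of OK] using d OF_sub_OK prod_span_plus by blast
qed

lemma extend_principal: "(a \<cdot> OF) \<star> OK = a \<cdot> OK"
proof -
  have "OF \<star> OK \<subseteq> OK"
    using prod_span_mono[of OF OK OK OK] OF_sub_OK fld.ints.ring_prod_ring by auto
  moreover have "OK \<subseteq> OF \<star> OK"
    using prod_span_incl[OF ints.one_closed, of _ OK] by fastforce
  ultimately show ?thesis by (simp add: scale_prod_left subset_antisym)
qed

lemma extend_prod: "(A \<star> OK) \<star> (B \<star> OK) = (A \<star> B) \<star> OK"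
  by (metis prod_span_assoc prod_span_commute fld.ints.ring_prod_ring)

text \<open>The classical witness \<open>1 + a\<close>: its conjugate times \<open>a\<close> is
  \<open>a + nm a\<close>, which is \<open>1 + a\<close> again. It vanishes only for
  \<open>a = -1\<close>, and there \<open>\<delta>\<close> differs from its conjugate by exactly
  that sign.\<close>

lemma hilbert90:
  assumes "a \<in> fld" "nm a = 1"
  obtains g where "g \<in> fld" "g \<noteq> 0" "a = g / cj g"
proof (cases "a = -1")
  case True
  then show ?thesis using that[of \<delta>] delta_in_fld delta_nonzero by (simp add: cj_delta)
next
  case False
  then have g: "1 + a \<noteq> 0" by (metis add.commute add_eq_0_iff)
  moreover have "a * cj (1 + a) = 1 + a"
    using assms by (simp add: cj_plus F_sub_fld F_one cj_F nm_def algebra_simps)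
  moreover have "cj (1 + a) \<noteq> 0" using g assms by (simp add: cj_zero_iff fld_plus F_sub_fld F_one)
  ultimately have "a = (1 + a) / cj (1 + a)" by (simp add: field_simps)
  then show ?thesis using that[of "1 + a"] g assms by (simp add: fld_plus F_sub_fld F_one)
qed

end

text \<open>Invertibility of ideals lifts to the extension because the product of an ideal with its
  conjugate is extended from below.\<close>

locale quadratic_extension_dedekind = quadratic_extension +
  assumes dedekind_OF: "frac_ideal ints I \<Longrightarrow> \<exists>J. frac_ideal ints J \<and> I \<star> J = ints"
    and fraction_F: "x \<in> F \<Longrightarrow> fraction ints x"
begin

sublocale OF: dedekind_ring OF
  by unfold_locales (rule dedekind_OF)

text \<open>By \<open>OK_iff\<close> it is enough to clear the denominators of the trace and of the
  norm.\<close>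

lemma fraction_fld:
  assumes "z \<in> fld" shows "fraction OK z"
proof -
  obtain d e where d: "d \<in> OF" "d \<noteq> 0" "d * tr z \<in> OF" and e: "e \<in> OF" "e \<noteq> 0" "e * nm z \<in> OF"
    using fraction_F[OF tr_in_F[OF assms]] fraction_F[OF nm_in_F[OF assms]] by (auto simp: fraction_def)
  define c where "c = d * e"
  have c: "c \<in> OF" "c \<noteq> 0" using d e by (auto simp: c_def ints.mult_closed)
  have "tr (c * z) = e * (d * tr z)" "nm (c * z) = (d * c) * (e * nm z)"
    using c assms by (auto simp: tr_F_mult nm_mult nm_F ints_sub F_sub_fld c_def)
  then have "tr (c * z) \<in> OF" "nm (c * z) \<in> OF"
    using c d e by (auto intro: ints.mult_closed)
  then have "c * z \<in> OK" using OK_iff[of "c * z"] assms c by (simp add: fld_mult F_sub_fld ints_sub)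
  then show ?thesis using c OF_sub_OK unfolding fraction_def by blast
qed

text \<open>The relative norm of an ideal, described by generators instead of primes or indices.
  That it behaves as expected is \<open>prod_cj\<close>.\<close>

definition nm_ideal :: "'a set \<Rightarrow> 'a set" where "nm_ideal I = OF \<star> (nm ` I)"

lemma nm_mem: "x \<in> I \<Longrightarrow> nm x \<in> nm_ideal I"
  unfolding nm_ideal_def using prod_span_incl[OF ints.one_closed, of "nm x" "nm ` I"] by simp

lemma frac_nm_ideal:
  assumes I: "frac_ideal OK I"
  shows "frac_ideal OF (nm_ideal I)"
proof -
  note sub = frac_sub_fld[OF I]
  obtain d where d: "d \<in> OK" "d \<noteq> 0" "\<And>x. x \<in> I \<Longrightarrow> d * x \<in> OK"
    using I unfolding frac_ideal_def by blast
  have "nm d * x \<in> OF" if "x \<in> nm ` I" for x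
    using that d sub nm_OK[of "d * _"] by (auto simp: nm_mult[symmetric] OK_sub_fld subset_iff)
  then have "nm d * x \<in> OF" if "x \<in> nm_ideal I" for x
    using prod_span_mult_left[of "nm ` I" "nm d" OF x OF] that ints.ring_prod_ring
    by (auto simp: nm_ideal_def prod_span_commute)
  moreover have "nm d \<in> OF" "nm d \<noteq> 0" using d by (auto simp: nm_OK nm_zero_iff OK_sub_fld)
  ultimately have "\<exists>d\<in>OF. d \<noteq> 0 \<and> (\<forall>x\<in>nm_ideal I. d * x \<in> OF)" by blast
  moreover obtain x where "x \<in> I" "x \<noteq> 0" using I by (auto simp: frac_ideal_def)
  then have "nm x \<in> nm_ideal I" "nm x \<noteq> 0" using sub by (auto simp: nm_mem nm_zero_iff)
  moreover have "r * x \<in> nm_ideal I" if "r \<in> OF" "x \<in> nm_ideal I" for r x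
    using that unfolding nm_ideal_def by (auto intro: prod_span_mult_left ints.mult_closed)
  ultimately show ?thesis
    unfolding frac_ideal_def by (auto simp: nm_ideal_def intro: prod_span_plus)
qed

text \<open>The inclusion from left to right carries the content. For \<open>z = a * cj b\<close>
  the trace lies in the norm ideal by polarization, and \<open>nm z = nm a * nm b\<close> lies in
  its square. Hence multiples of \<open>z\<close> by elements of the inverse \<open>N'\<close> have
  integral trace and norm and lie in \<open>OK\<close>. Writing 1 as a sum of products from the norm
  ideal and \<open>N'\<close> puts \<open>z\<close> into the extension.\<close>

lemma prod_cj:
  assumes I: "frac_ideal OK I"
  shows "I \<star> cj ` I = nm_ideal I \<star> OK"
proof
  note sub = frac_sub_fld[OF I]
  note fr = frac_nm_ideal[OF I]
  obtain N' where N': "frac_ideal OF N'" "nm_ideal I \<star> N' = OF"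
    using OF.invertible[OF fr] by blast
  show "I \<star> cj ` I \<subseteq> nm_ideal I \<star> OK"
  proof (rule prod_span_least)
    fix a b' assume "a \<in> I" "b' \<in> cj ` I"
    then obtain b where ab: "a \<in> I" "b \<in> I" "b' = cj b" by auto
    define z where "z = a * b'"
    have abf: "a \<in> fld" "b \<in> fld" "z \<in> fld" using ab sub by (auto simp: z_def intro: fld_mult cj_in_fld)
    have "tr z = nm (a + b) - nm a - nm b"
      using abf by (simp add: tr_def nm_def z_def ab cj_mult cj_plus cj_in_fld algebra_simps)
    moreover have "nm (a + b) \<in> nm_ideal I" "nm a \<in> nm_ideal I" "nm b \<in> nm_ideal I"
      using ab by (auto intro!: nm_mem fld.ints.frac_plus[OF I])
    ultimately have trz: "tr z \<in> nm_ideal I" using ints.frac_diff[OF fr] by metis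
    have nmz: "nm z = nm a * nm b" using abf by (simp add: z_def ab nm_mult cj_in_fld nm_cj)
    have cz: "c * z \<in> OK" if c: "c \<in> N'" for c
    proof -
      have in_OF: "c * w \<in> OF" if "w \<in> nm_ideal I" for w
        using prod_span_incl[OF that c] N'(2) by (simp add: mult.commute)
      have cF: "c \<in> F" using c frac_sub_F[OF N'(1)] by auto
      have "tr (c * z) = c * tr z" using cF abf by (simp add: tr_F_mult)
      moreover have "nm (c * z) = (c * nm a) * (c * nm b)"
        using cF abf by (simp add: nm_mult nmz nm_F F_sub_fld)
      ultimately have "tr (c * z) \<in> OF" "nm (c * z) \<in> OF"
        using in_OF trz ab by (auto intro!: ints.mult_closed in_OF nm_mem)
      then show ?thesis using OK_iff[of "c * z"] cF abf by (simp add: fld_mult F_sub_fld)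
    qed
    have "z * w \<in> nm_ideal I \<star> OK" if "w \<in> nm_ideal I \<star> N'" for w
      using that
    proof induction
      case (add w u c)
      have "u * (c * z) \<in> nm_ideal I \<star> OK" using add cz by (intro prod_span_incl)
      from prod_span_plus[OF add.IH this] show ?case by (simp add: algebra_simps)
    qed (simp add: prod_span.zero)
    from this[of 1] show "a * b' \<in> nm_ideal I \<star> OK" using N'(2) ints.one_closed by (simp add: z_def)
  qed (auto intro: prod_span.zero prod_span_plus)
  have frI: "frac_ideal OK (I \<star> cj ` I)" using I frac_cj fld.ints.frac_prod by blast
  have "nm ` I \<subseteq> I \<star> cj ` I" by (auto simp: nm_def intro: prod_span_incl)
  then have "nm_ideal I \<star> OK \<subseteq> (OK \<star> (I \<star> cj ` I)) \<star> OK"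
    unfolding nm_ideal_def using OF_sub_OK by (intro prod_span_mono) auto
  also have "\<dots> = I \<star> cj ` I"
    using fld.ints.frac_prod_ring[OF frI] by (metis prod_span_commute)
  finally show "nm_ideal I \<star> OK \<subseteq> I \<star> cj ` I" .
qed

sublocale OK: dedekind_ring OK
proof
  fix I assume I: "frac_ideal OK I"
  obtain N' where N': "frac_ideal OF N'" "nm_ideal I \<star> N' = OF"
    using OF.invertible[OF frac_nm_ideal[OF I]] by blast
  have "I \<star> (cj ` I \<star> (N' \<star> OK)) = nm_ideal I \<star> OK \<star> (N' \<star> OK)"
    by (metis prod_cj[OF I] prod_span_assoc)
  also have "\<dots> = OK" using N'(2) extend_principal[of 1] by (simp add: extend_prod)
  finally show "\<exists>J. frac_ideal OK J \<and> I \<star> J = OK"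
    using fld.ints.frac_prod[OF frac_cj[OF I] frac_extend[OF N'(1)]] by blast
qed

text \<open>Multiplying by the inverse of \<open>B\<close> leads to a fractional ideal of the base
  contained in \<open>OK\<close>, and \<open>OK\<close> meets \<open>F\<close> in
  \<open>OF\<close>.\<close>

lemma extend_le:
  assumes A: "frac_ideal OF A" and B: "frac_ideal OF B" and le: "A \<star> OK \<subseteq> B \<star> OK"
  shows "A \<subseteq> B"
proof -
  obtain B' where B': "frac_ideal OF B'" "B \<star> B' = OF" using OF.invertible[OF B] by blast
  have "B' \<star> A \<star> OK \<subseteq> B' \<star> B \<star> OK"
    using prod_span_mono[OF order_refl le, of B'] by (simp add: prod_span_assoc)
  also have "\<dots> = OK" using B'(2) extend_principal[of 1] by (simp add: prod_span_commute)
  finally have "B' \<star> A \<subseteq> OK"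
    using prod_span_incl[OF _ fld.ints.one_closed, of _ "B' \<star> A"] by fastforce
  moreover have "B' \<star> A \<subseteq> F" using frac_sub_F[OF ints.frac_prod[OF B'(1) A]] .
  ultimately have "B' \<star> A \<subseteq> B' \<star> B" using OK_inter_F B'(2) by (auto simp: prod_span_commute)
  then show ?thesis using OF.cancel_le[OF B'(1) A B] by simp
qed

lemma extend_eq:
  assumes "frac_ideal OF A" "frac_ideal OF B" "A \<star> OK = B \<star> OK"
  shows "A = B"
  using extend_le[of A B] extend_le[of B A] assms by auto

text \<open>Here \<open>I = (b/c) I'\<close> for the conjugate \<open>I'\<close>, and \<open>b/c\<close> has a unit as norm. After multiplying it
  by a unit of \<open>OK\<close>, Hilbert 90 applies.\<close>

lemma ambiguous_in_class:
  assumes I: "frac_ideal OK I"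
    and sq: "I \<star> I = b \<cdot> OK" "b \<in> fld" "b \<noteq> 0"
    and norm: "I \<star> cj ` I = c \<cdot> OK" "c \<in> F" "c \<noteq> 0"
    and units: "\<And>a. a \<in> fld \<Longrightarrow> a \<noteq> 0 \<Longrightarrow> nm a \<in> OF \<Longrightarrow> inverse (nm a) \<in> OF \<Longrightarrow>
      \<exists>v\<in>OK. inverse v \<in> OK \<and> v \<noteq> 0 \<and> nm v = nm a"
  shows "\<exists>g\<in>fld. g \<noteq> 0 \<and> cj ` (g \<cdot> I) = g \<cdot> I"
proof -
  note sub = frac_sub_fld[OF I]
  define a where "a = b / c"
  have a: "a \<in> fld" "a \<noteq> 0" using sq norm by (auto simp: a_def intro: fld.F_divide F_sub_fld)
  have frc: "frac_ideal OK (cj ` I)" by (rule frac_cj[OF I])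
  \<comment> \<open>Two copies of \<open>I\<close> times its conjugate, bracketed in two ways, give
    \<open>c \<cdot> I\<close> and \<open>b\<close> times the conjugate ideal; hence the multiplier
    \<open>a = b / c\<close>.\<close>
  have "c \<cdot> I = I \<star> (I \<star> cj ` I)"
    by (simp add: norm fld.ints.prod_principal[OF I])
  also have "\<dots> = (I \<star> I) \<star> cj ` I" by (simp add: prod_span_assoc)
  also have "\<dots> = b \<cdot> cj ` I"
    using fld.ints.prod_principal[OF frc, of b] by (simp add: sq prod_span_commute)
  finally have "inverse c \<cdot> c \<cdot> I = inverse c \<cdot> b \<cdot> cj ` I" by simp
  then have Ia: "I = a \<cdot> cj ` I" using norm by (simp add: scale_scale a_def field_simps)
  have "cj ` I = cj a \<cdot> cj ` cj ` I"
    using cj_scale[of a "cj ` I"] a sub Ia cj_in_fld by (metis image_subset_iff subset_iff)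
  then have cI: "cj ` I = cj a \<cdot> I" using cj_image_cj[OF sub] by simp
  have "c \<cdot> OK = I \<star> cj ` I" by (simp add: norm)
  also have "\<dots> = (a \<cdot> cj ` I) \<star> (cj a \<cdot> I)" using Ia cI by metis
  also have "\<dots> = nm a \<cdot> (I \<star> cj ` I)"
    by (simp add: scale_prod_left scale_prod_right scale_scale nm_def prod_span_commute)
  finally have "c \<cdot> OK = (nm a * c) \<cdot> OK" by (simp add: norm scale_scale)
  moreover have nz: "nm a \<noteq> 0" using a by (simp add: nm_zero_iff)
  ultimately have "nm a \<in> OK" "inverse (nm a) \<in> OK"
    using fld.ints.principal_eq_iff[of c "nm a * c"] norm by (auto simp: field_simps)
  then have "nm a \<in> OF" "inverse (nm a) \<in> OF" using a nm_in_F by (auto intro!: OK_inter_F F_closed)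
  from units[OF a this] obtain v where v: "v \<in> OK" "inverse v \<in> OK" "v \<noteq> 0" "nm v = nm a" by blast
  have vf: "v \<in> fld" "inverse v \<in> fld" using v OK_sub_fld by auto
  \<comment> \<open>Dividing by the unit \<open>v\<close> keeps the relation between
    \<open>I\<close> and its conjugate, since units preserve ideals, and makes Hilbert 90
    applicable. Scaling by \<open>inverse g\<close> then gives an ambiguous ideal.\<close>
  have "nm (a / v) = 1" using a v vf nz by (simp add: nm_divide)
  then obtain g where g: "g \<in> fld" "g \<noteq> 0" "a / v = g / cj g"
    using hilbert90[of "a / v"] a vf by (metis fld.F_divide)
  have cg: "cj g \<noteq> 0" using g by (simp add: cj_zero_iff)
  have "inverse v \<cdot> I = I" using v by (intro fld.ints.unit_scale[OF I]) auto
  then have "I = inverse v \<cdot> a \<cdot> cj ` I" using Ia by simp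
  also have "\<dots> = (a / v) \<cdot> cj ` I" by (simp add: scale_scale divide_inverse mult.commute)
  finally have "inverse g \<cdot> I = inverse g \<cdot> (g / cj g) \<cdot> cj ` I" using g by simp
  also have "\<dots> = inverse (cj g) \<cdot> cj ` I" using g by (simp add: scale_scale field_simps)
  also have "\<dots> = cj ` (inverse g \<cdot> I)"
    using cj_scale[of "inverse g" I] g sub by (simp add: cj_inverse fld_inverse)
  finally show ?thesis using g by (intro bexI[of _ "inverse g"]) (auto simp: fld_inverse)
qed

end

subsection \<open>Ambiguous ideals\<close>

context quadratic_extension_dedekind
begin

lemma square_principal_fld:
  assumes "frac_ideal OK A" "A \<star> A = (g * g) \<cdot> OK" "g \<in> fld" "g \<noteq> 0"
  shows "A = g \<cdot> OK"
  using OK.square_principal[OF assms(1,2,4) fraction_fld[OF assms(3)]] fld.ints_square_closed by blast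

lemma tr_image_sub: "frac_ideal OK J \<Longrightarrow> cj ` J = J \<Longrightarrow> tr ` J \<subseteq> J"
  unfolding tr_def by (auto intro: fld.ints.frac_plus)

text \<open>The element \<open>w - cj w\<close> generates the different of \<open>F(\<delta>)\<close> over \<open>F\<close> locally, up to
  the index of the order generated by \<open>w\<close>.\<close>

lemma different_mult:
  assumes J: "frac_ideal OK J" and w: "w \<in> OK" and x: "x \<in> J"
  shows "(w - cj w) * x \<in> tr ` J \<star> OK"
proof -
  have xf: "x \<in> fld" "w \<in> fld" using frac_sub_fld[OF J] x w OK_sub_fld by auto
  have "(w - cj w) * x = tr (w * x) * 1 + tr x * (- cj w)"
    using xf by (simp add: tr_def cj_mult algebra_simps)
  also have "\<dots> \<in> tr ` J \<star> OK"
    using J w x by (intro prod_span_plus prod_span_incl imageI fld.ints.frac_mult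
        fld.ints.one_closed fld.ints.minus_closed cj_OK)
  finally show ?thesis .
qed

text \<open>Ambiguity puts the traces into \<open>J\<close>, which bounds their denominators. They
  do not all vanish: \<open>different_mult\<close>, applied to an integral multiple of
  \<open>\<delta>\<close>, would make \<open>J\<close> zero.\<close>

lemma frac_tr:
  assumes J: "frac_ideal OK J" "cj ` J = J"
  shows "frac_ideal OF (tr ` J)"
proof -
  note sub = frac_sub_fld[OF J(1)] and trJ = tr_image_sub[OF J]
  obtain d where d: "d \<in> OK" "d \<noteq> 0" "\<And>x. x \<in> J \<Longrightarrow> d * x \<in> OK"
    using J unfolding frac_ideal_def by blast
  have "nm d * x \<in> OF" if "x \<in> tr ` J" for x
  proof (rule OK_inter_F)
    have "cj d * (d * x) \<in> OK" 
      by (rule fld.ints.mult_closed[OF cj_OK[OF d(1)] d(3)]) (use trJ that in blast)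
    then show "nm d * x \<in> OK" by (simp add: nm_def ac_simps)
    show "nm d * x \<in> F" 
      by (rule F_mult[OF nm_in_F[OF OK_sub_fld[OF d(1)]]]) (use that sub tr_in_F in blast)
  qed
  moreover have "nm d \<in> OF" "nm d \<noteq> 0" using d by (auto simp: nm_OK nm_zero_iff OK_sub_fld)
  ultimately have "\<exists>d\<in>OF. d \<noteq> 0 \<and> (\<forall>x\<in>tr ` J. d * x \<in> OF)" by blast
  moreover have "r * tr x \<in> tr ` J" if "r \<in> OF" "x \<in> J" for r x
  proof -
    have "tr (r * x) \<in> tr ` J" using that by (intro imageI fld.ints.frac_mult[OF J(1)] OF_sub_OK)
    then show ?thesis using that sub by (simp add: tr_F_mult ints_sub subset_iff)
  qed
  moreover have "tr x + tr y \<in> tr ` J" if "x \<in> J" "y \<in> J" for x y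
    using that sub fld.ints.frac_plus[OF J(1)] by (auto simp: tr_plus[symmetric] subset_iff)
  moreover have "\<exists>x\<in>tr ` J. x \<noteq> 0"
  proof (rule ccontr)
    assume "\<not> (\<exists>x\<in>tr ` J. x \<noteq> 0)"
    then have "tr ` J \<subseteq> {0}" by blast
    then have "tr ` J \<star> OK \<subseteq> {0}" by (intro prod_span_least) auto
    obtain e where e: "e \<in> OK" "e \<noteq> 0" "e * \<delta> \<in> OK"
      using fraction_fld[OF delta_in_fld] unfolding fraction_def by blast
    \<comment> \<open>Multiplying by \<open>nm e\<close> instead of \<open>e\<close> keeps the
      factor in \<open>F\<close>, so that \<open>cj\<close> changes the sign of \<open>w\<close> and
      \<open>w - cj w = w + w\<close> is nonzero.\<close>
    define w where "w = nm e * \<delta>"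
    have "w \<in> OK"
      unfolding w_def using e fld.ints.mult_closed[OF e(3) cj_OK[OF e(1)]] by (simp add: nm_def ac_simps)
    moreover have "cj w = - w"
      unfolding w_def using e by (simp add: cj_mult cj_F nm_in_F F_sub_fld OK_sub_fld delta_in_fld cj_delta)
    moreover have "w \<noteq> 0" using e delta_nonzero by (simp add: w_def nm_zero_iff OK_sub_fld)
    moreover obtain x where x: "x \<in> J" "x \<noteq> 0" using J by (auto simp: frac_ideal_def)
    ultimately have "(w + w) * x \<in> tr ` J \<star> OK"
      using different_mult[OF J(1), of w x] by simp
    then show False using \<open>tr ` J \<star> OK \<subseteq> {0}\<close> \<open>w \<noteq> 0\<close> x by auto
  qed
  ultimately show ?thesis unfolding frac_ideal_def by auto
qed

end

subsection \<open>The field \<open>\<rat>(\<surd>p)\<close>\<close>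

lemma subfield_Rats: "subfield_set (\<rat> :: real set)"
  by unfold_locales auto

lemma ints_Rats: "subfield_set.ints (\<rat> :: real set) = \<int>"
  unfolding subfield_set.ints_def[OF subfield_Rats]
  using rational_algebraic_int_is_int int_imp_algebraic_int Ints_subset_Rats by blast

lemma subring_Ints: "subring_of_field (\<int> :: real set)"
  by unfold_locales auto

lemma fraction_Ints:
  assumes "x \<in> \<rat>" shows "fraction (\<int> :: real set) x"
proof -
  obtain a b where "b > 0" "x = of_int a / of_int b" using Rats_cases'[OF assms] by metis
  then have "of_int b * x \<in> \<int>" "of_int b \<noteq> (0::real)" by auto
  then show ?thesis unfolding fraction_def using Ints_of_int by blast
qed

text \<open>Division with remainder by the least positive element; the common denominator
  \<open>d\<close> turns positive elements into natural numbers, so that there is a least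
  one.\<close>

lemma frac_ideal_Ints:
  fixes I :: "real set"
  assumes I: "frac_ideal \<int> I"
  obtains g where "g \<in> \<rat>" "g > 0" "I = g \<cdot> \<int>"
proof -
  interpret Z: subring_of_field "\<int> :: real set" by (rule subring_Ints)
  obtain d0 where d0: "d0 \<in> \<int>" "d0 \<noteq> 0" "\<And>x. x \<in> I \<Longrightarrow> d0 * x \<in> \<int>"
    using I unfolding frac_ideal_def by blast
  define d where "d = \<bar>d0\<bar>"
  have d: "d \<in> \<int>" "d > 0" "\<And>x. x \<in> I \<Longrightarrow> d * x \<in> \<int>"
    using d0 by (auto simp: d_def abs_if)
  have abs: "\<bar>x\<bar> \<in> I" if "x \<in> I" for x
    using that Z.frac_minus[OF I] by (simp add: abs_if)
  define P where "P n \<longleftrightarrow> n > 0 \<and> real n / d \<in> I" for n :: nat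
  have ex: "\<exists>n. P n \<and> of_nat n = d * x" if x: "x \<in> I" "x > 0" for x
  proof -
    obtain m where m: "d * x = of_int m" using d(3)[OF x(1)] by (auto elim: Ints_cases)
    then have "m > 0" using d x by (metis mult_pos_pos of_int_0_less_iff)
    then have "P (nat m) \<and> of_nat (nat m) = d * x" using m x d by (simp add: P_def flip: m)
    then show ?thesis by blast
  qed
  obtain x0 where "x0 \<in> I" "x0 \<noteq> 0" using I by (auto simp: frac_ideal_def)
  then have "\<exists>n. P n" using ex[of "\<bar>x0\<bar>"] abs by auto
  then obtain n where n: "P n" "\<And>m. m < n \<Longrightarrow> \<not> P m" by (metis LeastI_ex not_less_Least)
  define g where "g = real n / d"
  have g: "g > 0" "g \<in> I" using n d by (auto simp: P_def g_def)
  have "I \<subseteq> g \<cdot> \<int>"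
  proof
    fix x assume x: "x \<in> I"
    define r where "r = x - of_int \<lfloor>x / g\<rfloor> * g"
    have rI: "r \<in> I" unfolding r_def using x g by (intro Z.frac_diff[OF I] Z.frac_mult[OF I]) auto
    have r: "0 \<le> r" "r < g"
      using floor_divide_lower[OF g(1), of x] floor_divide_upper[OF g(1), of x]
      by (auto simp: r_def algebra_simps)
    have "r = 0"
    proof (rule ccontr)
      assume "r \<noteq> 0"
      then obtain m where m: "P m" "of_nat m = d * r" using ex[OF rI] r by force
      then have "real m < real n" using r d by (simp add: g_def field_simps)
      then show False using n m by simp
    qed
    then have "x / g = of_int \<lfloor>x / g\<rfloor>" using g by (simp add: r_def field_simps)
    then show "x \<in> g \<cdot> \<int>" using g by (simp add: scale_iff) (metis Ints_of_int)
  qed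
  moreover have "g \<cdot> \<int> \<subseteq> I"
    using Z.frac_mult[OF I _ g(2)] by (auto simp: scale_def mult.commute)
  moreover have "g \<in> \<rat>" using d Ints_subset_Rats by (auto simp: g_def)
  ultimately show ?thesis using that g by blast
qed

locale quadratic_prime =
  fixes p :: nat
  assumes p_prime: "Factorial_Ring.prime p" and p_mod: "p mod 8 = 1"
begin

abbreviation sp :: real where "sp \<equiv> sqrt (real p)"

lemma sp_sq [simp]: "sp * sp = real p" by simp

lemma sp_irrational: "sp \<notin> \<rat>"
proof
  assume "sp \<in> \<rat>"
  moreover have "algebraic_int sp" by (intro algebraic_int_sqrt int_imp_algebraic_int) auto
  ultimately obtain n where n: "sp = of_int n"
    using rational_algebraic_int_is_int by (metis Ints_cases)
  then have "real p = of_int (n * n)" using sp_sq by (metis of_int_mult)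
  then have "int p = n * n" by linarith
  then have "int p = int (nat \<bar>n\<bar> * nat \<bar>n\<bar>)" by simp
  then have "p = nat \<bar>n\<bar> * nat \<bar>n\<bar>" by (simp only: of_nat_eq_iff)
  then have "Factorial_Ring.prime (nat \<bar>n\<bar> * nat \<bar>n\<bar>)" using p_prime by simp
  then have "nat \<bar>n\<bar> = 1" using prime_product by blast
  then show False using p_prime \<open>p = nat \<bar>n\<bar> * nat \<bar>n\<bar>\<close> by simp
qed

text \<open>The bottom of the tower: fractional ideals of \<open>\<int>\<close> are principal, hence
  invertible.\<close>

sublocale k: quadratic_extension_dedekind "\<rat> :: real set" sp
  rewrites "subfield_set.ints (\<rat> :: real set) = \<int>"
proof -
  interpret Q: subfield_set "\<rat> :: real set" by (rule subfield_Rats)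
  interpret Z: subring_of_field "\<int> :: real set" by (rule subring_Ints)
  show "quadratic_extension_dedekind (\<rat> :: real set) sp"
  proof unfold_locales
    show "sp * sp \<in> \<rat>" by simp
    show "sp \<notin> \<rat>" by (rule sp_irrational)
    show "fraction Q.ints x" if "x \<in> \<rat>" for x using fraction_Ints[OF that] by (simp add: ints_Rats)
    show "\<exists>J. frac_ideal Q.ints J \<and> I \<star> J = Q.ints" if "frac_ideal Q.ints I" for I
    proof -
      obtain g where g: "g \<in> \<rat>" "g > 0" "I = g \<cdot> \<int>"
        using \<open>frac_ideal Q.ints I\<close> frac_ideal_Ints unfolding ints_Rats by blast
      have "frac_ideal \<int> (inverse g \<cdot> \<int>)"
        using g by (intro Z.frac_principal fraction_Ints) auto
      moreover have "I \<star> (inverse g \<cdot> \<int>) = \<int>" using g by (simp add: Z.principal_prod)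
      ultimately show ?thesis unfolding ints_Rats by blast
    qed
  qed
qed (rule ints_Rats)

lemma OK_rational: "x \<in> k.OK \<Longrightarrow> x \<in> \<rat> \<Longrightarrow> x \<in> \<int>"
  by (rule k.OK_inter_F)

text \<open>The usual generator of the integers for \<open>p\<close> congruent to 1 modulo 4. Only
  membership in \<open>k.OK\<close> is proved; \<open>p_mult_repr\<close> supplies coordinates up to
  the factor \<open>p\<close>.\<close>

definition om :: real where "om = (1 + sp) / 2"

lemma om_repr: "om = 1 / 2 + 1 / 2 * sp"
  by (simp add: om_def field_simps)

lemma om_fld: "om \<in> k.fld"
  unfolding om_repr by (rule k.fldI) auto

lemma cj_om: "k.cj om = 1 - om"
  using k.cj_repr[of "1 / 2" "1 / 2"] by (simp flip: om_repr) (simp add: om_repr)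

lemma om_diff: "om - k.cj om = sp"
  unfolding cj_om by (simp add: om_def)

definition m8 :: int where "m8 = (int p - 1) div 8"

lemma p_eq: "real p = 8 * of_int m8 + 1"
proof -
  have "int p mod 8 = 1" using p_mod by presburger
  then have "int p = 8 * m8 + 1" unfolding m8_def by presburger
  then show ?thesis by linarith
qed

lemma om_sq: "om * om = om + 2 * of_int m8"
proof -
  have *: "(1 + x) / 2 * ((1 + x) / 2) = (1 + x) / 2 + 2 * m" if "x * x = 8 * m + 1" for x m :: real
    using that by (simp add: field_simps)
  show ?thesis unfolding om_def by (rule *) (rule trans[OF sp_sq p_eq])
qed

lemma om_OK: "om \<in> k.OK"
proof -
  have "k.tr om = 1" by (simp add: k.tr_def cj_om)
  moreover have "k.nm om = - (2 * of_int m8)" using om_sq by (simp add: k.nm_def cj_om algebra_simps)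
  ultimately show ?thesis using k.OK_iff[OF om_fld] by simp
qed

lemma p_gt1: "p > 1" using p_prime prime_gt_1_nat by blast

text \<open>Let \<open>n\<close> generate the norm of \<open>J\<close> and \<open>g\<close> its
  traces. As \<open>g\<close> lies in \<open>J\<close>, \<open>n\<close> divides
  \<open>g * g\<close>; as \<open>om - k.cj om = sp\<close> maps \<open>J\<close> into
  \<open>g \<cdot> k.OK\<close>, \<open>g * g\<close> divides \<open>real p * n\<close>. The two
  quotients multiply to \<open>p\<close>, so \<open>g * g\<close> is \<open>n\<close> or
  \<open>real p * n\<close>, and square roots of ideals are unique.\<close>

lemma k_ambiguous:
  assumes J: "frac_ideal k.OK J" "k.cj ` J = J"
  shows "\<exists>r\<in>\<rat>. r \<noteq> 0 \<and> (J = r \<cdot> k.OK \<or> J = (r * sp) \<cdot> k.OK)"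
proof -
  obtain n where n: "n \<in> \<rat>" "n > 0" "k.nm_ideal J = n \<cdot> \<int>"
    using frac_ideal_Ints[OF k.frac_nm_ideal[OF J(1)]] by blast
  have JJ: "J \<star> J = n \<cdot> k.OK"
    using k.prod_cj[OF J(1)] J(2) n(3) k.extend_principal[of n] by simp
  obtain g where g: "g \<in> \<rat>" "g > 0" "k.tr ` J = g \<cdot> \<int>"
    using frac_ideal_Ints[OF k.frac_tr[OF J]] by blast
  have "g \<in> J" using k.tr_image_sub[OF J] g(3) scale_mem[of 1 \<int> g] by auto
  then have "g * g \<in> n \<cdot> k.OK" using JJ prod_span_incl by metis
  then have "g * g / n \<in> k.OK" using n by (simp add: scale_iff)
  then have m1: "g * g / n \<in> \<int>" using n g by (intro OK_rational) auto
  have sub: "sp \<cdot> J \<subseteq> g \<cdot> k.OK"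
    using k.different_mult[OF J(1) om_OK] om_diff k.extend_principal[of g] g(3)
    by (auto simp: scale_def)
  have sJ2: "(sp \<cdot> J) \<star> (sp \<cdot> J) = (real p * n) \<cdot> k.OK"
    unfolding scale_prod_left scale_prod_right scale_scale JJ mult.assoc[symmetric] sp_sq ..
  then have "(real p * n) \<cdot> k.OK = (sp \<cdot> J) \<star> (sp \<cdot> J)" by simp
  also have "\<dots> \<subseteq> (g * g) \<cdot> k.OK"
    using prod_span_mono[OF sub sub] by (simp add: k.fld.ints.principal_prod)
  finally have "real p * n / (g * g) \<in> k.OK"
    using g k.fld.ints.principal_le_iff by auto
  then have m2: "real p * n / (g * g) \<in> \<int>" using n g by (intro OK_rational) auto
  obtain a b where ab: "g * g / n = of_int a" "real p * n / (g * g) = of_int b"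
    using m1 m2 by (metis Ints_cases)
  have "of_int (a * b) = (g * g / n) * (real p * n / (g * g))" using ab by simp
  then have "of_int (a * b) = real p" using g n by simp
  then have "a * b = int p" by linarith
  moreover have "a > 0" using ab(1) g n by (metis divide_pos_pos mult_pos_pos of_int_0_less_iff)
  ultimately consider "a = 1" | "a = int p" "b = 1"
  proof -
    assume *: "a * b = int p" "a > 0" and thes: "a = 1 \<Longrightarrow> thesis" "a = int p \<Longrightarrow> b = 1 \<Longrightarrow> thesis"
    have "int (nat a) dvd int p" using * by (metis dvd_triv_left less_imp_le nat_0_le)
    then have "nat a dvd p" by (simp only: int_dvd_int_iff)
    then have "nat a = 1 \<or> nat a = p" using p_prime prime_nat_iff by blast
    then show thesis using * thes p_gt1 by auto
  qed
  then show ?thesis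
  proof cases
    case 1
    then have "n = g * g" using ab(1) n by (simp add: field_simps)
    then have "J = g \<cdot> k.OK"
      using g JJ k.F_sub_fld by (intro k.square_principal_fld[OF J(1)]) simp_all
    then show ?thesis using g by (intro bexI[of _ g]) auto
  next
    case 2
    have sJ: "frac_ideal k.OK (sp \<cdot> J)"
      using p_gt1 by (intro k.fld.ints.frac_scale[OF J(1)] k.fraction_fld k.delta_in_fld) auto
    have "g * g = real p * n" using 2 ab(1) n by (simp add: field_simps)
    then have "(sp \<cdot> J) \<star> (sp \<cdot> J) = (g * g) \<cdot> k.OK"
      by (simp only: sJ2)
    then have "sp \<cdot> J = g \<cdot> k.OK"
      using g k.F_sub_fld by (intro k.square_principal_fld[OF sJ]) simp_all
    then have "inverse sp \<cdot> sp \<cdot> J = inverse sp \<cdot> g \<cdot> k.OK" by simp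
    moreover have "inverse sp * g = (g / real p) * sp"
      using p_gt1 sp_sq by (simp add: field_simps del: sp_sq real_sqrt_mult_self)
    ultimately have "J = ((g / real p) * sp) \<cdot> k.OK" using p_gt1 by (simp add: scale_scale)
    then show ?thesis using g p_gt1 by (intro bexI[of _ "g / real p"]) auto
  qed
qed

text \<open>Hilbert 90 gives \<open>h = b / k.cj b\<close> with \<open>b = 1 + h\<close>, and since
  \<open>h\<close> is a unit, \<open>b\<close> generates an ambiguous ideal. By
  \<open>k_ambiguous\<close> this ideal has a generator \<open>c\<close> with conjugate
  \<open>c\<close> or \<open>- c\<close>; then \<open>v = b / c\<close> has square \<open>h\<close>
  up to sign, and positivity decides.\<close>

lemma k_unit_square:
  assumes h: "h \<in> k.OK" "inverse h \<in> k.OK" "h > 0" "k.nm h = 1"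
  shows "\<exists>v\<in>k.OK. inverse v \<in> k.OK \<and> v \<noteq> 0 \<and> h = v * v"
proof -
  define b where "b = 1 + h"
  have hf: "h \<in> k.fld" using h k.OK_sub_fld by blast
  have b: "b \<in> k.OK" "b > 0" "b \<in> k.fld"
    using h k.fld.ints.one_closed by (auto simp: b_def intro!: k.fld.ints.plus_closed k.OK_sub_fld)
  have bh: "b = h * k.cj b"
    using h(4) hf by (simp add: b_def k.cj_plus k.F_sub_fld k.cj_F k.nm_def algebra_simps)
  have J: "frac_ideal k.OK (b \<cdot> k.OK)"
    using b by (intro k.fld.ints.frac_principal k.fraction_fld) auto
  have "k.cj ` (b \<cdot> k.OK) = k.cj b \<cdot> k.OK"
    using k.cj_scale[of b k.OK] b k.OK_sub_fld by (auto simp: k.cj_OK_image)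
  also have "\<dots> = b \<cdot> k.OK"
  proof -
    have "k.cj b \<noteq> 0" using b by (simp add: k.cj_zero_iff)
    moreover from this have "b / k.cj b = h" using bh by (simp add: field_simps)
    moreover from this have "k.cj b / b = inverse h" by (metis inverse_divide)
    ultimately show ?thesis
      using k.fld.ints.principal_eq_iff[of "k.cj b" b] h b by simp
  qed
  finally obtain r where r: "r \<in> \<rat>" "r \<noteq> 0" "b \<cdot> k.OK = r \<cdot> k.OK \<or> b \<cdot> k.OK = (r * sp) \<cdot> k.OK"
    using k_ambiguous[OF J] by blast
  have fin: "\<exists>v\<in>k.OK. inverse v \<in> k.OK \<and> v \<noteq> 0 \<and> h = v * v"
    if c: "c \<in> k.fld" "c \<noteq> 0" "k.cj c = c \<or> k.cj c = - c" and eq: "b \<cdot> k.OK = c \<cdot> k.OK" for c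
  proof -
    define v where "v = b / c"
    have v: "v \<in> k.OK" "inverse v \<in> k.OK" "v \<noteq> 0"
      using k.fld.ints.principal_eq_iff[of b c] eq b c by (auto simp: v_def)
    have vf: "v \<in> k.fld" using v k.OK_sub_fld by blast
    have "v = h * k.cj v \<or> v = - (h * k.cj v)"
      using bh c b by (auto simp: v_def k.cj_divide)
    then have vv: "v * v = h * k.nm v \<or> v * v = - (h * k.nm v)"
    proof
      assume "v = h * k.cj v"
      then have "v * v = (h * k.cj v) * v" by simp
      then show ?thesis by (simp add: k.nm_def ac_simps)
    next
      assume "v = - (h * k.cj v)"
      then have "v * v = - (h * k.cj v) * v" by simp
      then show ?thesis by (simp add: k.nm_def ac_simps)
    qed
    have "k.nm v \<in> \<int>" "inverse (k.nm v) \<in> \<int>"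
      using k.nm_OK[OF v(1)] k.nm_OK[OF v(2)] vf by (auto simp: k.nm_def k.cj_inverse)
    then obtain i j where "k.nm v = of_int i" "inverse (k.nm v) = of_int j" by (metis Ints_cases)
    moreover have "k.nm v \<noteq> 0" using v vf by (simp add: k.nm_zero_iff)
    ultimately have "of_int (i * j) = (1::real)" by (metis of_int_mult right_inverse)
    then have "i * j = 1" by linarith
    then have "k.nm v = 1 \<or> k.nm v = -1" using \<open>k.nm v = of_int i\<close> by (auto simp: zmult_eq_1_iff)
    then have "v * v = h \<or> v * v = - h" using vv by auto
    moreover have "v * v > 0" using v by (metis not_real_square_gt_zero)
    ultimately have "h = v * v" using h by auto
    then show ?thesis using v by blast
  qed
  show ?thesis using r(3)
  proof
    assume "b \<cdot> k.OK = r \<cdot> k.OK"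
    then show ?thesis using r by (intro fin[of r]) (auto simp: k.cj_F k.F_sub_fld)
  next
    assume "b \<cdot> k.OK = (r * sp) \<cdot> k.OK"
    then show ?thesis using r p_gt1
      by (intro fin[of "r * sp"]) (auto simp: k.cj_F k.F_sub_fld k.cj_mult k.cj_delta k.delta_in_fld k.fld_mult)
  qed
qed

end

locale quadratic_prime_unit = quadratic_prime +
  fixes \<epsilon> :: real
  assumes eps_OK: "\<epsilon> \<in> k.OK" and eps_norm: "k.nm \<epsilon> = -1" and eps_pos: "\<epsilon> > 0"
begin

lemma eps_fld: "\<epsilon> \<in> k.fld" using eps_OK k.OK_sub_fld by blast

lemma cj_eps: "k.cj \<epsilon> = - inverse \<epsilon>"
  using eps_norm eps_pos by (simp add: k.nm_def field_simps)

lemma inverse_eps_OK: "inverse \<epsilon> \<in> k.OK"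
  using k.fld.ints.minus_closed[OF k.cj_OK[OF eps_OK]] by (simp add: cj_eps)

lemma unit_norm_pm1:
  assumes "x \<in> \<int>" "inverse x \<in> (\<int> :: real set)" "x \<noteq> 0"
  shows "x = 1 \<or> x = -1"
proof -
  obtain i j where ij: "x = of_int i" "inverse x = of_int j" using assms by (metis Ints_cases)
  then have "of_int (i * j) = (1::real)" using assms(3) by (metis of_int_mult right_inverse)
  then have "i * j = 1" by linarith
  then show ?thesis using ij by (auto simp: zmult_eq_1_iff)
qed

text \<open>Here norm -1 enters: the units 1 and \<open>\<epsilon>\<close> realize both possible
  unit norms, as \<open>k.ambiguous_in_class\<close> demands, and the ambiguous ideals of
  \<open>k\<close> are principal by \<open>k_ambiguous\<close>.\<close>

lemma k_square_principal:
  assumes I: "frac_ideal k.OK I" and sq: "I \<star> I = b \<cdot> k.OK" "b \<in> k.fld" "b \<noteq> 0"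
  shows "\<exists>c\<in>k.fld. c \<noteq> 0 \<and> I = c \<cdot> k.OK"
proof -
  obtain n where n: "n \<in> \<rat>" "n > 0" "k.nm_ideal I = n \<cdot> \<int>"
    using frac_ideal_Ints[OF k.frac_nm_ideal[OF I]] by blast
  have nm: "I \<star> k.cj ` I = n \<cdot> k.OK"
    using k.prod_cj[OF I] n(3) k.extend_principal[of n] by simp
  have units: "\<exists>v\<in>k.OK. inverse v \<in> k.OK \<and> v \<noteq> 0 \<and> k.nm v = k.nm a"
    if "a \<in> k.fld" "a \<noteq> 0" "k.nm a \<in> \<int>" "inverse (k.nm a) \<in> \<int>" for a
  proof -
    have "k.nm a = 1 \<or> k.nm a = -1"
      using unit_norm_pm1 that by (simp add: k.nm_zero_iff)
    then show ?thesis
    proof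
      assume "k.nm a = 1"
      then show ?thesis using k.fld.ints.one_closed by (intro bexI[of _ 1]) (auto simp: k.nm_F)
    next
      assume "k.nm a = -1"
      then show ?thesis using eps_OK inverse_eps_OK eps_norm eps_pos by (intro bexI[of _ \<epsilon>]) auto
    qed
  qed
  obtain g where g: "g \<in> k.fld" "g \<noteq> 0" "k.cj ` (g \<cdot> I) = g \<cdot> I"
    using k.ambiguous_in_class[OF I sq nm _ _ units] n by auto
  have "frac_ideal k.OK (g \<cdot> I)" using g k.fraction_fld by (intro k.fld.ints.frac_scale[OF I])
  from k_ambiguous[OF this g(3)] obtain r where r: "r \<in> \<rat>" "r \<noteq> 0"
    "g \<cdot> I = r \<cdot> k.OK \<or> g \<cdot> I = (r * sp) \<cdot> k.OK" by blast
  have fin: ?thesis if "c \<in> k.fld" "c \<noteq> 0" "g \<cdot> I = c \<cdot> k.OK" for c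
  proof -
    have "inverse g \<cdot> g \<cdot> I = inverse g \<cdot> c \<cdot> k.OK" using that by simp
    then have "I = (inverse g * c) \<cdot> k.OK" using g by (simp add: scale_scale)
    then show ?thesis using g that by (intro bexI[of _ "inverse g * c"]) (auto simp: k.fld_mult k.fld_inverse)
  qed
  show ?thesis using r fin[of r] fin[of "r * sp"] p_gt1
    by (auto simp: k.F_sub_fld k.fld_mult k.delta_in_fld)
qed

end

subsection \<open>The field \<open>\<rat>(\<surd>p, \<surd>\<epsilon>)\<close>\<close>

context quadratic_prime_unit
begin

abbreviation se :: real where "se \<equiv> sqrt \<epsilon>"

lemma se_sq: "se * se = \<epsilon>" using eps_pos by simp

text \<open>Conjugation in \<open>k\<close> maps squares to squares of real numbers, whereas
  \<open>k.cj \<epsilon>\<close> is negative.\<close>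

lemma se_notin: "se \<notin> k.fld"
proof
  assume *: "se \<in> k.fld"
  then have "k.cj se * k.cj se = k.cj \<epsilon>" by (simp only: k.cj_mult[symmetric] se_sq)
  then have "k.cj se * k.cj se = - inverse \<epsilon>" by (simp only: cj_eps)
  moreover have "k.cj se * k.cj se \<ge> 0" by simp
  moreover have "inverse \<epsilon> > 0" using eps_pos by simp
  ultimately show False by linarith
qed

sublocale L: quadratic_extension_dedekind k.fld se
  by unfold_locales (use eps_fld eps_pos se_notin k.OK.invertible k.fraction_fld in auto)

lemma se_OK: "se \<in> L.OK"
  using algebraic_int_square_root[of se] eps_OK eps_pos L.delta_in_fld
  by (auto simp: L.fld.ints_def k.fld.ints_def)

lemma inverse_se: "inverse se = se * inverse \<epsilon>"
  using eps_pos by (simp add: field_simps)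

lemma inverse_se_OK: "inverse se \<in> L.OK"
  unfolding inverse_se by (rule L.fld.ints.mult_closed[OF se_OK L.OF_sub_OK[OF inverse_eps_OK]])

lemma nm_se: "L.nm se = - \<epsilon>"
  unfolding L.nm_def L.cj_delta mult_minus_right se_sq ..

text \<open>Conjugating \<open>x * x - y * y * \<epsilon>\<close> over \<open>\<rat>\<close> gives a
  sum of nonnegative terms, because \<open>k.cj \<epsilon> = - inverse \<epsilon>\<close>. So
  \<open>h\<close> has the sign of its norm, and \<open>k_unit_square\<close> applies to
  \<open>h\<close> or to \<open>- (\<epsilon> * h)\<close>. The last conjunct is for
  \<open>ambiguous_element\<close>, where such a unit must cancel up to sign.\<close>

lemma unit_norms:
  assumes a: "a \<in> L.fld" "a \<noteq> 0" "L.nm a \<in> k.OK" "inverse (L.nm a) \<in> k.OK"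
  shows "\<exists>v\<in>L.OK. inverse v \<in> L.OK \<and> v \<noteq> 0 \<and> L.nm v = L.nm a \<and> (L.cj v = v \<or> L.cj v = - v)"
proof -
  define h where "h = L.nm a"
  have hf: "h \<in> k.fld" "h \<noteq> 0" using a by (auto simp: h_def L.nm_in_F L.nm_zero_iff)
  obtain x y where xy: "x \<in> k.fld" "y \<in> k.fld" "a = x + y * se" using a L.fldE by metis
  have "h = x * x - y * y * \<epsilon>" using xy by (simp add: h_def L.nm_repr se_sq del: real_sqrt_mult_self)
  then have "k.cj h = k.cj x * k.cj x + k.cj y * k.cj y * inverse \<epsilon>"
    using xy eps_fld by (simp add: k.cj_diff k.cj_mult k.fld_mult cj_eps)
  moreover have "k.cj x * k.cj x + k.cj y * k.cj y * inverse \<epsilon> \<ge> 0"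
    using eps_pos by simp
  moreover have "k.cj h \<noteq> 0" using hf by (simp add: k.cj_zero_iff)
  ultimately have pos: "k.cj h > 0" by linarith
  have "inverse (k.nm h) = k.nm (inverse h)" using hf by (simp add: k.nm_def k.cj_inverse)
  then have "k.nm h \<in> \<int>" "inverse (k.nm h) \<in> \<int>"
    using k.nm_OK[OF a(3)] k.nm_OK[OF a(4)] by (simp_all add: h_def)
  then have "k.nm h = 1 \<or> k.nm h = -1" using unit_norm_pm1 hf by (simp add: k.nm_zero_iff)
  then show ?thesis
  proof
    assume n1: "k.nm h = 1"
    then have "h * k.cj h > 0" by (simp add: k.nm_def)
    then have "h > 0" using pos by (simp add: zero_less_mult_iff)
    then obtain v where v: "v \<in> k.OK" "inverse v \<in> k.OK" "v \<noteq> 0" "h = v * v"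
      using k_unit_square[of h] a n1 by (auto simp: h_def)
    then show ?thesis
      by (intro bexI[of _ v]) (auto simp: h_def L.nm_F L.cj_F k.OK_sub_fld L.OF_sub_OK)
  next
    assume n1: "k.nm h = -1"
    then have "h * k.cj h < 0" by (simp add: k.nm_def)
    then have "h < 0" using pos by (simp add: mult_less_0_iff)
    then have "0 < - (\<epsilon> * h)" using eps_pos by (simp add: mult_pos_neg)
    moreover have "k.nm (- (\<epsilon> * h)) = 1"
    proof -
      have "k.nm (- (\<epsilon> * h)) = k.nm (\<epsilon> * h)"
        using hf eps_fld by (simp add: k.nm_def k.cj_uminus k.fld_mult)
      then show ?thesis using hf eps_fld n1 eps_norm by (simp add: k.nm_mult)
    qed
    moreover have "- (\<epsilon> * h) \<in> k.OK"
      using a eps_OK by (auto simp: h_def intro!: k.fld.ints.minus_closed k.fld.ints.mult_closed)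
    moreover have "inverse (- (\<epsilon> * h)) \<in> k.OK"
      using a inverse_eps_OK by (auto simp: h_def intro!: k.fld.ints.minus_closed k.fld.ints.mult_closed)
    ultimately obtain v where v: "v \<in> k.OK" "inverse v \<in> k.OK" "v \<noteq> 0" "- (\<epsilon> * h) = v * v"
      using k_unit_square[of "- (\<epsilon> * h)"] by blast
    \<comment> \<open>Since \<open>h = - (v * v) / \<epsilon>\<close> and
      \<open>L.nm se = - \<epsilon>\<close>, the factor before \<open>se\<close> must have the
      square \<open>v * v / (\<epsilon> * \<epsilon>)\<close>.\<close>
    define w where "w = (v * inverse \<epsilon>) * se"
    have vF: "v * inverse \<epsilon> \<in> k.fld" using v inverse_eps_OK by (intro k.OK_sub_fld k.fld.ints.mult_closed)
    have "w \<in> L.OK" unfolding w_def using v inverse_eps_OK se_OK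
      by (intro L.fld.ints.mult_closed[OF L.OF_sub_OK] k.fld.ints.mult_closed)
    moreover have "inverse w = (inverse v * \<epsilon>) * inverse se" by (simp add: w_def)
    then have "inverse w \<in> L.OK" using v eps_OK inverse_se_OK
      by (auto intro!: L.fld.ints.mult_closed[OF L.OF_sub_OK] k.fld.ints.mult_closed)
    moreover have "w \<noteq> 0" using v eps_pos by (simp add: w_def)
    moreover have "L.nm w = h"
    proof -
      have "L.nm w = (v * inverse \<epsilon>) * (v * inverse \<epsilon>) * (- \<epsilon>)"
      using vF by (simp add: w_def L.nm_mult L.F_sub_fld L.delta_in_fld L.nm_F nm_se)
      then have "L.nm w = - (v * v) / \<epsilon>" using eps_pos by (simp add: field_simps)
      moreover have "- (v * v) / \<epsilon> = h" unfolding v(4)[symmetric] using eps_pos by simp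
      ultimately show ?thesis by simp
    qed
    moreover have "L.cj w = - w"
      using vF by (simp add: w_def L.cj_mult L.F_sub_fld L.delta_in_fld L.cj_F L.cj_delta)
    ultimately show ?thesis by (auto simp: h_def)
  qed
qed

text \<open>The square of the norm ideal extends to the ideal of \<open>L.nm b\<close>. Extension of
  ideals is injective, so the equality already holds in \<open>k\<close>, where an ideal with
  principal square is principal.\<close>

lemma norm_principal:
  assumes I: "frac_ideal L.OK I" and sq: "I \<star> I = b \<cdot> L.OK" "b \<in> L.fld" "b \<noteq> 0"
  shows "\<exists>c\<in>k.fld. c \<noteq> 0 \<and> I \<star> L.cj ` I = c \<cdot> L.OK"
proof -
  define A where "A = L.nm_ideal I"
  have A: "frac_ideal k.OK A" unfolding A_def by (rule L.frac_nm_ideal[OF I])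
  have cA: "I \<star> L.cj ` I = A \<star> L.OK" unfolding A_def by (rule L.prod_cj[OF I])
  have sub: "I \<subseteq> L.fld" by (rule L.frac_sub_fld[OF I])
  have "L.OK \<subseteq> L.fld" using L.OK_sub_fld by blast
  have "(A \<star> A) \<star> L.OK = (I \<star> L.cj ` I) \<star> (I \<star> L.cj ` I)"
    unfolding cA by (rule L.extend_prod[symmetric])
  also have "\<dots> = (I \<star> I) \<star> L.cj ` (I \<star> I)"
    unfolding L.cj_prod[OF sub sub] by (simp only: prod_span_ac)
  also have "\<dots> = L.nm b \<cdot> L.OK"
    using L.cj_scale[OF sq(2) \<open>L.OK \<subseteq> L.fld\<close>]
    by (simp add: sq L.cj_OK_image k.fld.ints.principal_prod L.fld.ints.principal_prod L.nm_def)
  also have "\<dots> = (L.nm b \<cdot> k.OK) \<star> L.OK" by (rule L.extend_principal[symmetric])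
  finally have eq: "(A \<star> A) \<star> L.OK = (L.nm b \<cdot> k.OK) \<star> L.OK" .
  have "L.nm b \<noteq> 0" using sq by (simp add: L.nm_zero_iff)
  then have "frac_ideal k.OK (L.nm b \<cdot> k.OK)"
    by (rule k.fld.ints.frac_principal[OF k.fraction_fld[OF L.nm_in_F[OF sq(2)]]])
  from L.extend_eq[OF k.fld.ints.frac_prod[OF A A] this eq]
  have "A \<star> A = L.nm b \<cdot> k.OK" .
  then obtain c where "c \<in> k.fld" "c \<noteq> 0" "A = c \<cdot> k.OK"
    using k_square_principal[OF A _ L.nm_in_F[OF sq(2)]] sq by (auto simp: L.nm_zero_iff)
  then show ?thesis using cA L.extend_principal by auto
qed

text \<open>A substitute for an integral basis. Writing \<open>sp = om - k.cj om\<close> expresses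
  \<open>sp * z\<close> by two traces, which are integers; a second factor
  \<open>sp = 2 * om - 1\<close> stays in the span of 1 and \<open>om\<close>. At 2 the factor
  \<open>p\<close> does no harm, being 1 modulo 8.\<close>

lemma p_mult_repr:
  assumes z: "z \<in> k.OK"
  shows "\<exists>a b :: int. real p * z = of_int a + of_int b * om"
proof -
  have zf: "z \<in> k.fld" using z k.OK_sub_fld by blast
  obtain a b where ab: "k.tr z = of_int b" "k.tr (om * z) = of_int a"
    using k.tr_OK[OF z] k.tr_OK[OF k.fld.ints.mult_closed[OF om_OK z]] by (metis Ints_cases)
  have "(om - k.cj om) * z = k.tr (om * z) - k.cj om * k.tr z"
    unfolding k.tr_def k.cj_mult[OF om_fld zf] by (simp add: algebra_simps)
  then have "sp * z = k.tr (om * z) - k.cj om * k.tr z" by (simp only: om_diff)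
  also have "\<dots> = of_int (a - b) + of_int b * om" unfolding ab cj_om by (simp add: algebra_simps)
  finally have "sp * (sp * z) = sp * (of_int (a - b) + of_int b * om)" by simp
  also have "sp * (sp * z) = real p * z" by (simp only: mult.assoc[symmetric] sp_sq)
  also have "sp = 2 * om - 1" by (simp add: om_def)
  also have "(2 * om - 1) * (of_int (a - b) + of_int b * om) =
    2 * of_int (a - b) * om + 2 * of_int b * (om * om) - of_int (a - b) - of_int b * om"
    by (simp add: algebra_simps)
  also have "\<dots> = of_int (4 * b * m8 - (a - b)) + of_int (2 * (a - b) + b) * om"
    unfolding om_sq by (simp add: algebra_simps)
  finally show ?thesis by blast
qed

text \<open>\<open>\<epsilon>\<close> times its conjugate is \<open>-1\<close>, so at exactly one of the two places above 2 it is
  congruent to 1 modulo 4; the other one is \<open>(2, s)\<close>.\<close>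

lemma local_generator:
  obtains s where "s \<in> k.OK" "s \<noteq> 0" "s * s * (1 - \<epsilon>) / 4 \<in> k.OK"
    "\<And>z. z \<in> k.OK \<Longrightarrow> \<exists>a b :: int. real p * z = of_int a + of_int b * s"
proof -
  note found = that
  note int_closed = k.fld.ints.of_int_closed k.fld.ints.mult_closed k.fld.ints.plus_closed
    k.fld.ints.diff_closed k.fld.ints.one_closed om_OK eps_OK
  obtain a b where ab: "real p * \<epsilon> = of_int a + of_int b * om" using p_mult_repr[OF eps_OK] by blast
  have "k.nm (real p * \<epsilon>) = - (real p * real p)"
    using eps_fld eps_norm by (simp add: k.nm_mult k.F_sub_fld k.nm_F)
  moreover have "k.nm (of_int a + of_int b * om) = of_int (a * a + a * b - 2 * m8 * (b * b))"
  proof -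
    have "k.cj (of_int a + of_int b * om) = of_int a + of_int b * (1 - om)"
      using om_fld by (simp add: k.cj_plus k.cj_mult k.F_sub_fld k.fld_mult k.cj_F cj_om)
    then have "k.nm (of_int a + of_int b * om) =
        of_int a * of_int a + of_int a * of_int b + of_int b * of_int b * om
        - of_int b * of_int b * (om * om)"
      unfolding k.nm_def by (simp only:) (simp add: algebra_simps)
    then show ?thesis unfolding om_sq by (simp add: algebra_simps)
  qed
  ultimately have "real_of_int (a * a + a * b - 2 * m8 * (b * b)) = real_of_int (- (int p * int p))"
    using ab by simp
  \<comment> \<open>Read modulo 2 and then modulo 8, this norm equation shows that \<open>a\<close>
    is odd, \<open>b = 2 * c\<close>, and \<open>a * c\<close> is -1 modulo 4.\<close>
  then have eq: "a * a + a * b - 2 * m8 * (b * b) = - (int p * int p)" by linarith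
  have pm: "int p = 8 * m8 + 1" using p_eq by linarith
  have odd: "odd (a * (a + b))"
  proof -
    have "a * (a + b) = 2 * m8 * (b * b) - int p * int p" using eq by (simp add: algebra_simps)
    then show ?thesis using pm by simp
  qed
  then have "odd a" "even b" by auto
  then obtain c where c: "b = 2 * c" by auto
  obtain a' where a': "a = 2 * a' + 1" using \<open>odd a\<close> by (auto elim: oddE)
  have "even (a' * (a' + 1))" by simp
  then obtain e where e: "a' * (a' + 1) = 2 * e" by (rule evenE)
  have "a * a = 8 * e + 1" using e by (simp add: a' algebra_simps)
  then have "8 * e + 1 + 2 * (a * c) - 8 * (m8 * (c * c)) = - ((8 * m8 + 1) * (8 * m8 + 1))"
    using eq by (simp add: c pm algebra_simps)
  then have "a * c = 4 * (m8 * (c * c) - e - 8 * m8 * m8 - 2 * m8) - 1" by (simp add: algebra_simps)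
  then obtain f where ac: "a * c = 4 * f - 1" by blast
  \<comment> \<open>\<open>s\<close> will be \<open>om\<close> or \<open>1 - om\<close>, and
    \<open>s * (1 - s)\<close> is an even integer. At the place above 2 where \<open>s\<close> is a
    unit, \<open>1 - s\<close> is therefore even, so \<open>a1\<close> makes
    \<open>real p * \<epsilon>\<close>, and hence \<open>\<epsilon>\<close>, 1 modulo 4. The factor
    \<open>s * s\<close> gives up the other place.\<close>
  have key: "thesis" if s: "s \<in> k.OK" "s \<noteq> 0" "s * (s * (1 - s)) = - (2 * of_int m8) * s"
    and a1: "real p * \<epsilon> = of_int (4 * i + 1) + of_int (2 * c') * (1 - s)"
    and repr: "\<And>z. z \<in> k.OK \<Longrightarrow> \<exists>a b :: int. real p * z = of_int a + of_int b * s" for s i c'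
  proof -
    have "s * s * (1 - real p * \<epsilon>) = - (4 * of_int i * (s * s)) - 2 * of_int c' * (s * (s * (1 - s)))"
      unfolding a1 by (simp add: algebra_simps)
    also have "\<dots> = 4 * (of_int (c' * m8) * s - of_int i * (s * s))"
      unfolding s(3) by (simp add: algebra_simps)
    finally have 1: "s * s * (1 - real p * \<epsilon>) = 4 * (of_int (c' * m8) * s - of_int i * (s * s))" .
    have "s * s * (1 - \<epsilon>) = s * s * (1 - real p * \<epsilon>) + 4 * (2 * of_int m8 * (s * s * \<epsilon>))"
      by (simp add: p_eq algebra_simps)
    then have "s * s * (1 - \<epsilon>) / 4 = (of_int (c' * m8) * s - of_int i * (s * s)) + of_int (2 * m8) * (s * s * \<epsilon>)"
      unfolding 1 by simp
    moreover have "\<dots> \<in> k.OK" using s(1) by (intro int_closed)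
    ultimately have "s * s * (1 - \<epsilon>) / 4 \<in> k.OK" by (simp only:)
    then show thesis using repr by (rule found[OF s(1,2)])
  qed
  have om_nz: "om \<noteq> 0" "1 - om \<noteq> 0"
  proof -
    have "sp > 1" using p_gt1 by simp
    then have "om > 1" by (simp add: om_def)
    then show "om \<noteq> 0" "1 - om \<noteq> 0" by auto
  qed
  have "odd a" by fact
  then consider i where "a = 4 * i + 1" | i where "a = 4 * i + 3"
  proof -
    assume "\<And>i. a = 4 * i + 1 \<Longrightarrow> thesis" "\<And>i. a = 4 * i + 3 \<Longrightarrow> thesis"
    moreover have "a = 4 * (a div 4) + 1 \<or> a = 4 * (a div 4) + 3" using \<open>odd a\<close> by presburger
    ultimately show thesis by blast
  qed
  then show thesis
  proof cases
    case (1 i)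
    show thesis
    proof (rule key[of "1 - om" i c])
      show "1 - om \<in> k.OK" by (intro int_closed)
      have "(1 - om) * om = - (2 * of_int m8)" using om_sq by (simp add: algebra_simps)
      then show "(1 - om) * ((1 - om) * (1 - (1 - om))) = - (2 * of_int m8) * (1 - om)" by simp
      show "real p * \<epsilon> = of_int (4 * i + 1) + of_int (2 * c) * (1 - (1 - om))"
        by (simp add: ab 1 c)
      fix z assume "z \<in> k.OK"
      then obtain a b where "real p * z = of_int a + of_int b * om" using p_mult_repr by blast
      then have "real p * z = of_int (a + b) + of_int (- b) * (1 - om)" by (simp add: algebra_simps)
      then show "\<exists>a b :: int. real p * z = of_int a + of_int b * (1 - om)" by blast
    qed (rule om_nz)
  next
    case (2 i)
    have "4 * (i * c) + 3 * c = 4 * f - 1" using ac 2 by (simp add: algebra_simps)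
    then have "\<exists>j. c = 4 * j + 1" by presburger
    then obtain j where j: "c = 4 * j + 1" by blast
    show thesis
    proof (rule key[of om "i + 2 * j + 1" "- c"])
      have "om * (1 - om) = - (2 * of_int m8)" using om_sq by (simp add: algebra_simps)
      then show "om * (om * (1 - om)) = - (2 * of_int m8) * om" by simp
      \<comment> \<open>Expressed by \<open>1 - om\<close>, the constant coordinate becomes
        \<open>a + 2 * c\<close>, which is 1 modulo 4 because \<open>a\<close> is 3 and
        \<open>c\<close> is 1 modulo 4.\<close>
      have "a + 2 * c = 4 * (i + 2 * j + 1) + 1" by (simp add: 2 j)
      then have "of_int (4 * (i + 2 * j + 1) + 1) = (of_int (a + 2 * c) :: real)" by simp
      then show "real p * \<epsilon> = of_int (4 * (i + 2 * j + 1) + 1) + of_int (2 * (- c)) * (1 - om)"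
        by (simp only: ab c) (simp add: algebra_simps)
    qed (use om_OK om_nz p_mult_repr in auto)
  qed
qed

text \<open>For an ideal of \<open>L\<close> with square \<open>c \<cdot> L.OK\<close> this implies
  that the ideal is generated by an element of \<open>k\<close>, see
  \<open>class_square_extend\<close>. Asking for the square of an arbitrary ideal of
  \<open>k\<close> would amount to the same, by \<open>class_squareI\<close>.\<close>

definition class_square :: "real \<Rightarrow> bool"
  where "class_square c \<longleftrightarrow> (\<exists>e\<in>k.fld. e \<noteq> 0 \<and> c \<cdot> k.OK = (e * e) \<cdot> k.OK)"

lemma class_squareI:
  assumes "frac_ideal k.OK T" "T \<star> T = c \<cdot> k.OK" "c \<in> k.fld" "c \<noteq> 0"
  shows "class_square c"
proof -
  obtain e where "e \<in> k.fld" "e \<noteq> 0" "T = e \<cdot> k.OK" using k_square_principal[OF assms] by blast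
  then show ?thesis unfolding class_square_def using assms(2) k.fld.ints.principal_prod by metis
qed

text \<open>At most one prime \<open>Q\<close> ramifies, so an ambiguous ideal with principal square \<open>c\<close> is, up to
  ideals from below, trivial or the prime above \<open>Q\<close>.\<close>

lemma ambiguous_dichotomy:
  obtains Q where "frac_ideal k.OK Q"
    "\<And>J c. frac_ideal L.OK J \<Longrightarrow> L.cj ` J = J \<Longrightarrow> J \<star> J = c \<cdot> L.OK \<Longrightarrow> c \<in> k.fld \<Longrightarrow> c \<noteq> 0 \<Longrightarrow>
      class_square c \<or> (\<exists>T. frac_ideal k.OK T \<and> T \<star> T = c \<cdot> Q)"
proof -
  obtain s where s: "s \<in> k.OK" "s \<noteq> 0" "s * s * (1 - \<epsilon>) / 4 \<in> k.OK"
    "\<And>z. z \<in> k.OK \<Longrightarrow> \<exists>a b :: int. real p * z = of_int a + of_int b * s"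
    using local_generator by metis
  have sf: "s \<in> k.fld" using s k.OK_sub_fld by blast
  note int_closed = k.fld.ints.of_int_closed k.fld.ints.mult_closed k.fld.ints.plus_closed
    k.fld.ints.diff_closed k.fld.ints.one_closed
  \<comment> \<open>The ideal generated by 2 and \<open>s\<close>. Of its primality only
    \<open>mod_Q\<close> is used: there are at most two residues.\<close>
  define Q where "Q = {2 * x + s * y | x y. x \<in> k.OK \<and> y \<in> k.OK}"
  have QI: "2 * x + s * y \<in> Q" if "x \<in> k.OK" "y \<in> k.OK" for x y using that by (auto simp: Q_def)
  have Q_sub: "Q \<subseteq> k.OK" using s k.fld.ints.of_int_closed[of 2] by (auto simp: Q_def intro!: int_closed)
  have fQ: "frac_ideal k.OK Q"
  proof -
    have "u + v \<in> Q" if uv: "u \<in> Q" "v \<in> Q" for u v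
    proof -
      obtain x y x' y' where "u = 2 * x + s * y" "v = 2 * x' + s * y'" "x \<in> k.OK" "y \<in> k.OK" "x' \<in> k.OK" "y' \<in> k.OK"
        using uv by (auto simp: Q_def)
      then show ?thesis using QI[of "x + x'" "y + y'"] by (simp add: k.fld.ints.plus_closed algebra_simps)
    qed
    moreover have "r * u \<in> Q" if ru: "r \<in> k.OK" "u \<in> Q" for r u
    proof -
      obtain x y where "u = 2 * x + s * y" "x \<in> k.OK" "y \<in> k.OK" using ru by (auto simp: Q_def)
      then show ?thesis using QI[of "r * x" "r * y"] ru by (simp add: k.fld.ints.mult_closed algebra_simps)
    qed
    moreover have "2 \<in> Q" using QI[of 1 0] k.fld.ints.one_closed k.fld.ints.zero_closed by simp
    moreover have "\<forall>x\<in>Q. 1 * x \<in> k.OK" using Q_sub by auto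
    ultimately show ?thesis unfolding frac_ideal_def
      using k.fld.ints.one_closed by (metis zero_neq_numeral zero_neq_one)
  qed
  have mod_Q: "z \<in> Q \<or> z - 1 \<in> Q" if z: "z \<in> k.OK" for z
  proof -
    obtain a b where ab: "real p * z = of_int a + of_int b * s" using s(4)[OF z] by blast
    have zq: "z = of_int a + of_int b * s - 8 * of_int m8 * z"
      using ab by (simp add: p_eq algebra_simps)
    show ?thesis
    proof (cases "even a")
      case True
      then obtain c where "a = 2 * c" by auto
      then have "z = 2 * (of_int c - of_int (4 * m8) * z) + s * of_int b" using zq by (simp add: algebra_simps)
      also have "\<dots> \<in> Q" using z by (intro QI int_closed)
      finally show ?thesis by simp
    next
      case False
      then obtain c where "a = 2 * c + 1" by (auto elim: oddE)
      then have "z - 1 = 2 * (of_int c - of_int (4 * m8) * z) + s * of_int b" using zq by (simp add: algebra_simps)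
      also have "\<dots> \<in> Q" using z by (intro QI int_closed)
      finally show ?thesis by simp
    qed
  qed
  \<comment> \<open>Integral because its norm is the quantity from \<open>local_generator\<close>.
    Subtracting conjugates gives \<open>2 * se\<close> from \<open>se\<close> and
    \<open>s * se\<close> from \<open>th\<close>; as \<open>se\<close> is a unit, these generate the
    extension of \<open>Q\<close>.\<close>
  define th where "th = s / 2 + s / 2 * se"
  have s2: "s / 2 \<in> k.fld" using sf k.fld.F_divide k.fld.F.of_int_closed[of 2] by simp
  have th_f: "th \<in> L.fld" unfolding th_def using s2 by (intro L.fldI)
  have th_cj: "L.cj th = s / 2 - s / 2 * se" unfolding th_def using s2 s2 by (rule L.cj_repr)
  have "L.tr th = s" by (simp add: L.tr_def th_cj) (simp add: th_def)
  moreover have "L.nm th = s * s * (1 - \<epsilon>) / 4"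
    using s2 L.nm_repr[of "s / 2" "s / 2"] unfolding th_def se_sq by (simp add: field_simps)
  ultimately have th: "th \<in> L.OK" using s(1,3) L.OK_iff[OF th_f] by metis
  have th_diff: "th - L.cj th = s * se" by (simp add: th_cj) (simp add: th_def)
  show thesis
  proof (rule that[OF fQ])
    fix J c assume J: "frac_ideal L.OK J" "L.cj ` J = J" and JJ: "J \<star> J = c \<cdot> L.OK"
      and c: "c \<in> k.fld" "c \<noteq> 0"
    define T where "T = L.tr ` J"
    have fT: "frac_ideal k.OK T" unfolding T_def by (rule L.frac_tr[OF J])
    have fTT: "frac_ideal k.OK (T \<star> T)" using fT fT by (rule k.fld.ints.frac_prod)
    have fTL: "frac_ideal L.OK (T \<star> L.OK)" by (rule L.frac_extend[OF fT])
    have mem: "2 * x \<in> T \<star> L.OK" "s * x \<in> T \<star> L.OK" if x: "x \<in> J" for x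
    proof -
      have "(se - L.cj se) * x \<in> T \<star> L.OK" unfolding T_def by (rule L.different_mult[OF J(1) se_OK x])
      then have "inverse se * ((se - L.cj se) * x) \<in> T \<star> L.OK"
        by (rule L.fld.ints.frac_mult[OF fTL inverse_se_OK])
      then show "2 * x \<in> T \<star> L.OK" using L.delta_nonzero by (simp add: L.cj_delta field_simps)
      have "(th - L.cj th) * x \<in> T \<star> L.OK" unfolding T_def by (rule L.different_mult[OF J(1) th x])
      then have "inverse se * ((th - L.cj th) * x) \<in> T \<star> L.OK"
        by (rule L.fld.ints.frac_mult[OF fTL inverse_se_OK])
      then show "s * x \<in> T \<star> L.OK" using L.delta_nonzero by (simp add: th_diff field_simps)
    qed
    have QJ: "Q \<star> J \<subseteq> T \<star> L.OK"
    proof (rule prod_span_least)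
      fix u x assume "u \<in> Q" "x \<in> J"
      then obtain a b where ab: "u = 2 * a + s * b" "a \<in> k.OK" "b \<in> k.OK" by (auto simp: Q_def)
      have "a * (2 * x) + b * (s * x) \<in> T \<star> L.OK"
        using mem[OF \<open>x \<in> J\<close>] L.fld.ints.frac_mult[OF fTL L.OF_sub_OK[OF ab(2)]]
          L.fld.ints.frac_mult[OF fTL L.OF_sub_OK[OF ab(3)]]
        by (intro prod_span_plus)
      then show "u * x \<in> T \<star> L.OK" by (simp add: ab algebra_simps)
    qed (auto intro: prod_span.zero prod_span_plus)
    \<comment> \<open>After extension, \<open>T\<close> lies between \<open>Q \<star> J\<close> and
      \<open>J\<close>. Squaring and dividing by \<open>c\<close> gives
      \<open>Q \<star> Q \<subseteq> q \<subseteq> k.OK\<close>, so \<open>q\<close> is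
      \<open>k.OK\<close>, \<open>Q\<close> or \<open>Q \<star> Q\<close>; the first and the last
      case make \<open>c\<close> a class square.\<close>
    define q where "q = inverse c \<cdot> (T \<star> T)"
    have fc: "fraction k.OK (inverse c)" "inverse c \<noteq> 0" using c by (auto intro: k.fraction_fld k.fld_inverse)
    have fq: "frac_ideal k.OK q" unfolding q_def by (rule k.fld.ints.frac_scale[OF fTT fc])
    have TT: "T \<star> T = c \<cdot> q" using c by (simp add: q_def scale_scale)
    have "T \<star> T \<subseteq> c \<cdot> L.OK"
      using prod_span_mono[OF L.tr_image_sub[OF J] L.tr_image_sub[OF J]] JJ by (simp add: T_def)
    then have "q \<subseteq> L.OK" unfolding q_def using scale_mono[of "T \<star> T" "c \<cdot> L.OK" "inverse c"] c by (simp add: scale_scale)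
    then have q_sub: "q \<subseteq> k.OK" using k.frac_sub_fld[OF fq] L.OK_inter_F by blast
    have "(Q \<star> J) \<star> (Q \<star> J) \<subseteq> (T \<star> L.OK) \<star> (T \<star> L.OK)" by (rule prod_span_mono[OF QJ QJ])
    moreover have "(Q \<star> J) \<star> (Q \<star> J) = c \<cdot> (Q \<star> Q) \<star> L.OK"
    proof -
      have "(Q \<star> J) \<star> (Q \<star> J) = (Q \<star> Q) \<star> (J \<star> J)" by (simp only: prod_span_ac)
      then show ?thesis by (simp add: JJ scale_prod_left scale_prod_right)
    qed
    ultimately have "(c \<cdot> (Q \<star> Q)) \<star> L.OK \<subseteq> (c \<cdot> q) \<star> L.OK" by (simp add: L.extend_prod TT scale_prod_left)
    then have "c \<cdot> (Q \<star> Q) \<subseteq> c \<cdot> q"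
      by (rule L.extend_le[OF k.fld.ints.frac_scale[OF k.fld.ints.frac_prod[OF fQ fQ]]
            k.fld.ints.frac_scale[OF fq], OF k.fraction_fld[OF c(1)] c(2) k.fraction_fld[OF c(1)] c(2)])
    then have "inverse c \<cdot> c \<cdot> (Q \<star> Q) \<subseteq> inverse c \<cdot> c \<cdot> q" by (rule scale_mono)
    then have QQ: "Q \<star> Q \<subseteq> q" using c by (simp add: scale_scale)
    obtain Q' where Q': "frac_ideal k.OK Q'" "Q \<star> Q' = k.OK" using k.OK.invertible[OF fQ] by blast
    show "class_square c \<or> (\<exists>T. frac_ideal k.OK T \<and> T \<star> T = c \<cdot> Q)"
    proof (cases "q \<subseteq> Q")
      case False
      then obtain x where x: "x \<in> q" "x \<notin> Q" by blast
      then have y: "x - 1 \<in> Q" using mod_Q q_sub by blast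
      \<comment> \<open>Prepares \<open>(x - 1) * (x - 1) - (x - 2) * x = 1\<close>, which makes
        \<open>q\<close> the whole ring.\<close>
      have "(x - 1) * (x - 1) \<in> q" using prod_span_incl[OF y y] QQ by blast
      moreover have "x - 2 \<in> k.OK"
        using x q_sub k.fld.ints.diff_closed[of x 2] k.fld.ints.of_int_closed[of 2] by auto
      then have "(x - 2) * x \<in> q" by (rule k.fld.ints.frac_mult[OF fq _ x(1)])
      ultimately have "(x - 1) * (x - 1) - (x - 2) * x \<in> q" by (rule k.fld.ints.frac_diff[OF fq])
      then have "1 \<in> q" by (simp add: algebra_simps)
      then have "k.OK \<subseteq> q" using k.fld.ints.frac_mult[OF fq, of _ 1] by auto
      then have "q = k.OK" using q_sub by blast
      then show ?thesis using class_squareI[OF fT _ c] TT by simp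
    next
      case True
      \<comment> \<open>Dividing by \<open>Q\<close> leaves
        \<open>Q \<subseteq> r \<subseteq> k.OK\<close>, and with two residues modulo
        \<open>Q\<close> only the extremes are possible.\<close>
      define r where "r = Q' \<star> q"
      have fr: "frac_ideal k.OK r" unfolding r_def using Q'(1) fq by (rule k.fld.ints.frac_prod)
      have qr: "q = Q \<star> r" unfolding r_def
        using Q' k.fld.ints.frac_prod_ring[OF fq] by (metis prod_span_assoc prod_span_commute)
      have r_sub: "r \<subseteq> k.OK" unfolding r_def
        using prod_span_mono[OF order_refl True, of Q'] Q' by (simp add: prod_span_commute)
      have "Q' \<star> (Q \<star> Q) \<subseteq> r" unfolding r_def by (rule prod_span_mono[OF order_refl QQ])
      then have Qr: "Q \<subseteq> r"
        using Q' k.fld.ints.frac_prod_ring[OF fQ] by (metis prod_span_assoc prod_span_commute)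
      show ?thesis
      proof (cases "r \<subseteq> Q")
        case True
        then have "T \<star> T = c \<cdot> (Q \<star> Q)" using Qr TT qr by auto
        then have "(T \<star> T) \<star> (Q' \<star> Q') = c \<cdot> ((Q \<star> Q') \<star> (Q \<star> Q'))"
          by (simp add: scale_prod_left) (simp only: prod_span_ac)
        moreover have "(T \<star> T) \<star> (Q' \<star> Q') = (T \<star> Q') \<star> (T \<star> Q')" by (simp only: prod_span_ac)
        ultimately have "(T \<star> Q') \<star> (T \<star> Q') = c \<cdot> k.OK"
          by (simp only: Q'(2) k.fld.ints.ring_prod_ring)
        then show ?thesis using class_squareI[OF k.fld.ints.frac_prod[OF fT Q'(1)] _ c] by blast
      next
        case False
        then obtain x where x: "x \<in> r" "x \<notin> Q" by blast
        then have "x - 1 \<in> r" using mod_Q r_sub Qr by blast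
        then have "1 \<in> r" using k.fld.ints.frac_diff[OF fr x(1), of "x - 1"] by simp
        then have "k.OK \<subseteq> r" using k.fld.ints.frac_mult[OF fr, of _ 1] by auto
        then have "r = k.OK" using r_sub by blast
        then have "q = Q" using qr k.fld.ints.frac_prod_ring[OF fQ] by simp
        then show ?thesis using fT TT by blast
      qed
    qed
  qed
qed

text \<open>The two factors \<open>Q\<close> cancel against the square of the inverse
  \<open>Q'\<close>, so \<open>T \<star> U \<star> Q'\<close> is an ideal of \<open>k\<close> with
  square \<open>c * d\<close>.\<close>

lemma class_square_prod:
  assumes Q: "frac_ideal k.OK Q" and T: "frac_ideal k.OK T" "T \<star> T = c \<cdot> Q" "c \<in> k.fld" "c \<noteq> 0"
    and U: "frac_ideal k.OK U" "U \<star> U = d \<cdot> Q" "d \<in> k.fld" "d \<noteq> 0"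
  shows "class_square (c * d)"
proof -
  obtain Q' where Q': "frac_ideal k.OK Q'" "Q \<star> Q' = k.OK" using k.OK.invertible[OF Q] by blast
  have "(T \<star> U \<star> Q') \<star> (T \<star> U \<star> Q') = ((T \<star> T) \<star> (U \<star> U)) \<star> (Q' \<star> Q')" by (simp only: prod_span_ac)
  also have "\<dots> = (c * d) \<cdot> ((Q \<star> Q') \<star> (Q \<star> Q'))"
    by (simp add: T U scale_prod_left scale_prod_right scale_scale mult.commute) (simp only: prod_span_ac)
  also have "\<dots> = (c * d) \<cdot> k.OK" by (simp only: Q'(2) k.fld.ints.ring_prod_ring)
  finally show ?thesis
    using T U Q' by (intro class_squareI[of "T \<star> U \<star> Q'"] k.fld.ints.frac_prod k.fld_mult) auto
qed

lemma class_square_extend: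
  assumes J: "frac_ideal L.OK J" "J \<star> J = c \<cdot> L.OK" and c: "class_square c"
  shows "\<exists>e\<in>k.fld. e \<noteq> 0 \<and> J = e \<cdot> L.OK"
proof -
  obtain e where e: "e \<in> k.fld" "e \<noteq> 0" "c \<cdot> k.OK = (e * e) \<cdot> k.OK"
    using c by (auto simp: class_square_def)
  then have "J \<star> J = (e * e) \<cdot> L.OK" using J(2) L.extend_principal by metis
  then have "J = e \<cdot> L.OK" using e by (intro L.square_principal_fld[OF J(1)] L.F_sub_fld)
  then show ?thesis using e by blast
qed

text \<open>With \<open>u = x / L.cj x\<close>, the ideal of \<open>x\<close> is ambiguous since
  \<open>u\<close> is a unit. If it came from \<open>k\<close>, one could replace \<open>x\<close>
  by a unit \<open>v\<close> with \<open>u = v / L.cj v\<close>. Dividing \<open>v\<close> by the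
  unit \<open>w\<close> from \<open>unit_norms\<close>, which has the same norm and
  \<open>w / L.cj w\<close> equal to 1 or -1, would leave \<open>y\<close> of norm 1 with
  \<open>u = y * y\<close> up to sign.\<close>

lemma ambiguous_element:
  assumes u: "u \<in> L.OK" "L.nm u = 1" "\<And>v. v \<in> L.OK \<Longrightarrow> L.nm v = 1 \<Longrightarrow> u \<noteq> v * v \<and> u \<noteq> - (v * v)"
  obtains G g where "frac_ideal L.OK G" "L.cj ` G = G" "G \<star> G = g \<cdot> L.OK" "g \<in> k.fld" "g \<noteq> 0"
    "\<not> class_square g" "\<exists>x\<in>L.fld. x \<noteq> 0 \<and> G = x \<cdot> L.OK"
proof -
  have uf: "u \<in> L.fld" "u \<noteq> 0" using u L.OK_sub_fld by (auto simp: L.nm_def)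
  obtain x where x: "x \<in> L.fld" "x \<noteq> 0" "u = x / L.cj x" using L.hilbert90[OF uf(1) u(2)] by blast
  have cx: "L.cj x \<noteq> 0" "L.cj x \<in> L.fld" using x by (auto simp: L.cj_zero_iff L.cj_in_fld)
  define G where "G = x \<cdot> L.OK"
  define g where "g = L.nm x"
  have g: "g \<in> k.fld" "g \<noteq> 0" using x by (auto simp: g_def L.nm_in_F L.nm_zero_iff)
  have G: "frac_ideal L.OK G" unfolding G_def using x by (intro L.fld.ints.frac_principal L.fraction_fld)
  have inv_u: "inverse u \<in> L.OK"
    using L.cj_OK[OF u(1)] u(2) inverse_unique[of u "L.cj u"] by (simp add: L.nm_def)
  have "L.OK \<subseteq> L.fld" using L.OK_sub_fld by blast
  then have "L.cj ` G = L.cj x \<cdot> L.OK" unfolding G_def using L.cj_scale[OF x(1)] L.cj_OK_image by simp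
  also have eqx: "\<dots> = x \<cdot> L.OK"
    using L.fld.ints.principal_eq_iff[OF cx(1) x(2)] u(1) inv_u x(3) by (simp add: inverse_eq_divide)
  finally have cG: "L.cj ` G = G" by (simp add: G_def)
  have GG: "G \<star> G = g \<cdot> L.OK"
    unfolding G_def g_def L.nm_def using eqx L.fld.ints.principal_prod by metis
  have "\<not> class_square g"
  proof
    assume "class_square g"
    then obtain e where e: "e \<in> k.fld" "e \<noteq> 0" "G = e \<cdot> L.OK" using class_square_extend[OF G GG] by blast
    define v where "v = x / e"
    have v: "v \<in> L.OK" "inverse v \<in> L.OK" "v \<noteq> 0"
      using L.fld.ints.principal_eq_iff[OF x(2) e(2)] e x by (auto simp: G_def v_def)
    have vf: "v \<in> L.fld" using v L.OK_sub_fld by blast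
    have uv: "u = v / L.cj v" using e x cx by (simp add: v_def L.cj_divide L.F_sub_fld L.cj_F)
    have "inverse (L.nm v) \<in> k.OK" using L.nm_OK[OF v(2)] vf by (simp add: L.nm_def L.cj_inverse)
    then obtain w where w: "w \<in> L.OK" "inverse w \<in> L.OK" "w \<noteq> 0" "L.nm w = L.nm v" "L.cj w = w \<or> L.cj w = - w"
      using unit_norms[OF vf v(3) L.nm_OK[OF v(1)]] by blast
    have wf: "w \<in> L.fld" using w L.OK_sub_fld by blast
    define y where "y = v / w"
    have y: "y \<in> L.OK" unfolding y_def divide_inverse using v w by (intro L.fld.ints.mult_closed)
    have ny: "L.nm y = 1" using vf wf v w by (simp add: y_def L.nm_divide L.nm_zero_iff)
    then have "y * L.cj y = 1" by (simp add: L.nm_def)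
    then have cy: "L.cj y = inverse y" by (metis inverse_unique)
    have ynz: "y \<noteq> 0" using v w by (simp add: y_def)
    have "v = y * w" using w by (simp add: y_def)
    then have "L.cj v = inverse y * L.cj w" using y wf L.OK_sub_fld cy by (simp add: L.cj_mult)
    then have "u = (y * w) / (inverse y * L.cj w)" using uv \<open>v = y * w\<close> by metis
    then have "u = y * y * (w / L.cj w)" using ynz by (simp add: field_simps)
    then have "u = y * y \<or> u = - (y * y)" using w by auto
    then show False using u(3)[OF y ny] by blast
  qed
  then show thesis using that[OF G cG GG g] x by (auto simp: G_def)
qed

text \<open>\<open>I\<close> is equivalent to an ambiguous \<open>J\<close>. If the square of
  \<open>J\<close> is not a class square, then \<open>J\<close> and the principal ideal
  \<open>G\<close> of \<open>ambiguous_element\<close> carry the same factor \<open>Q\<close>. Thus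
  \<open>J \<star> G\<close> is generated by an element of \<open>k\<close>, and dividing by the
  generator of \<open>G\<close> settles \<open>J\<close>.\<close>

proposition square_principal_imp_principal:
  assumes u: "u \<in> L.OK" "L.nm u = 1" "\<And>v. v \<in> L.OK \<Longrightarrow> L.nm v = 1 \<Longrightarrow> u \<noteq> v * v \<and> u \<noteq> - (v * v)"
    and I: "frac_ideal L.OK I" and sq: "I \<star> I = b \<cdot> L.OK" "b \<in> L.fld" "b \<noteq> 0"
  shows "\<exists>c\<in>L.fld. c \<noteq> 0 \<and> I = c \<cdot> L.OK"
proof -
  obtain Q where Q: "frac_ideal k.OK Q"
    "\<And>J c. frac_ideal L.OK J \<Longrightarrow> L.cj ` J = J \<Longrightarrow> J \<star> J = c \<cdot> L.OK \<Longrightarrow> c \<in> k.fld \<Longrightarrow> c \<noteq> 0 \<Longrightarrow>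
      class_square c \<or> (\<exists>T. frac_ideal k.OK T \<and> T \<star> T = c \<cdot> Q)"
    using ambiguous_dichotomy by blast
  obtain G g where G: "frac_ideal L.OK G" "L.cj ` G = G" "G \<star> G = g \<cdot> L.OK" "g \<in> k.fld" "g \<noteq> 0"
    "\<not> class_square g" "\<exists>x\<in>L.fld. x \<noteq> 0 \<and> G = x \<cdot> L.OK"
    using ambiguous_element[OF u] by blast
  obtain y where y: "y \<in> L.fld" "y \<noteq> 0" "G = y \<cdot> L.OK" using G(7) by blast
  obtain n where n: "n \<in> k.fld" "n \<noteq> 0" "I \<star> L.cj ` I = n \<cdot> L.OK"
    using norm_principal[OF I sq] by blast
  obtain x where x: "x \<in> L.fld" "x \<noteq> 0" "L.cj ` (x \<cdot> I) = x \<cdot> I"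
    using L.ambiguous_in_class[OF I sq n(3,1,2)] unit_norms by blast
  define J where "J = x \<cdot> I"
  have J: "frac_ideal L.OK J" unfolding J_def using x by (intro L.fld.ints.frac_scale[OF I] L.fraction_fld)
  have "J \<star> J = (x \<cdot> I) \<star> L.cj ` (x \<cdot> I)" using x by (simp add: J_def)
  also have "\<dots> = (x * L.cj x) \<cdot> (I \<star> L.cj ` I)"
    using L.cj_scale[OF x(1) L.frac_sub_fld[OF I]] by (simp add: scale_prod_left scale_prod_right scale_scale mult.commute)
  also have "\<dots> = (L.nm x * n) \<cdot> L.OK" by (simp add: n scale_scale L.nm_def)
  finally have JJ: "J \<star> J = (L.nm x * n) \<cdot> L.OK" .
  have c: "L.nm x * n \<in> k.fld" "L.nm x * n \<noteq> 0" using x n by (auto simp: L.nm_in_F k.fld_mult L.nm_zero_iff)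
  have "\<exists>e\<in>L.fld. e \<noteq> 0 \<and> J = e \<cdot> L.OK"
  proof (cases "class_square (L.nm x * n)")
    case True
    then show ?thesis using class_square_extend[OF J JJ] L.F_sub_fld by blast
  next
    case False
    then obtain T where T: "frac_ideal k.OK T" "T \<star> T = (L.nm x * n) \<cdot> Q"
      using Q(2)[OF J _ JJ c] x(3) by (auto simp: J_def)
    obtain U where U: "frac_ideal k.OK U" "U \<star> U = g \<cdot> Q" using Q(2)[OF G(1-5)] G(6) by blast
    have sq: "class_square ((L.nm x * n) * g)" by (rule class_square_prod[OF Q(1) T c U G(4,5)])
    have "(J \<star> G) \<star> (J \<star> G) = (J \<star> J) \<star> (G \<star> G)" by (simp only: prod_span_ac)
    also have "\<dots> = (L.nm x * n * g) \<cdot> L.OK" unfolding JJ G(3) by (rule L.fld.ints.principal_prod)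
    finally obtain e where e: "e \<in> k.fld" "e \<noteq> 0" "J \<star> G = e \<cdot> L.OK"
      using class_square_extend[OF L.fld.ints.frac_prod[OF J G(1)] _ sq] by blast
    have "y \<cdot> J = e \<cdot> L.OK" using e(3) L.fld.ints.prod_principal[OF J] by (simp add: y)
    then have "inverse y \<cdot> y \<cdot> J = inverse y \<cdot> e \<cdot> L.OK" by simp
    then have "J = (inverse y * e) \<cdot> L.OK" using y by (simp add: scale_scale)
    then show ?thesis using y e
      by (intro bexI[of _ "inverse y * e"]) (auto intro: L.fld_mult L.fld_inverse L.F_sub_fld)
  qed
  then obtain e where e: "e \<in> L.fld" "e \<noteq> 0" "x \<cdot> I = e \<cdot> L.OK" by (auto simp: J_def)
  then have "inverse x \<cdot> x \<cdot> I = inverse x \<cdot> e \<cdot> L.OK" by simp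
  then have "I = (inverse x * e) \<cdot> L.OK" using x by (simp add: scale_scale)
  then show ?thesis using x e
    by (intro bexI[of _ "inverse x * e"]) (auto intro: L.fld_mult L.fld_inverse)
qed

end

subsection \<open>Norms and lattices\<close>

context quadratic_prime_unit
begin

text \<open>The absolute norm from \<open>L\<close> to \<open>\<rat>\<close>, by
  transitivity.\<close>

definition norm4 :: "real \<Rightarrow> real" where "norm4 z = k.nm (L.nm z)"

lemma norm4_OK: "z \<in> L.OK \<Longrightarrow> norm4 z \<in> \<int>"
  unfolding norm4_def by (intro k.nm_OK L.nm_OK)

lemma norm4_mult: "z \<in> L.fld \<Longrightarrow> w \<in> L.fld \<Longrightarrow> norm4 (z * w) = norm4 z * norm4 w"
  by (simp add: norm4_def L.nm_mult k.nm_mult L.nm_in_F)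

lemma norm4_zero_iff: "z \<in> L.fld \<Longrightarrow> norm4 z = 0 \<longleftrightarrow> z = 0"
  by (simp add: norm4_def L.nm_zero_iff k.nm_zero_iff L.nm_in_F)

lemma norm4_ge_1: "z \<in> L.OK \<Longrightarrow> z \<noteq> 0 \<Longrightarrow> \<bar>norm4 z\<bar> \<ge> 1"
  using norm4_OK[of z] norm4_zero_iff[of z] L.OK_sub_fld[of z] by (auto elim!: Ints_cases)

text \<open>The right side is the squared absolute value at the complex place of \<open>L\<close>,
  where \<open>\<epsilon>\<close> becomes \<open>- inverse \<epsilon>\<close> and its root
  imaginary.\<close>

lemma cj_nm_repr:
  assumes "x \<in> k.fld" "y \<in> k.fld"
  shows "k.cj (L.nm (x + y * se)) = k.cj x * k.cj x + k.cj y * k.cj y * inverse \<epsilon>"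
proof -
  have "L.nm (x + y * se) = x * x - y * y * \<epsilon>" unfolding L.nm_repr[OF assms] se_sq ..
  then show ?thesis using assms eps_fld by (simp add: k.cj_diff k.cj_mult k.fld_mult cj_eps)
qed

lemma norm4_repr:
  assumes "x \<in> k.fld" "y \<in> k.fld"
  shows "\<bar>norm4 (x + y * se)\<bar> =
    \<bar>x + y * se\<bar> * \<bar>x - y * se\<bar> * (k.cj x * k.cj x + k.cj y * k.cj y * inverse \<epsilon>)"
proof -
  have "norm4 (x + y * se) = L.nm (x + y * se) * k.cj (L.nm (x + y * se))"
    by (simp add: norm4_def k.nm_def)
  also have "L.nm (x + y * se) = (x + y * se) * (x - y * se)"
    unfolding L.nm_def L.cj_repr[OF assms] ..
  finally have "\<bar>norm4 (x + y * se)\<bar> =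
      \<bar>x + y * se\<bar> * \<bar>x - y * se\<bar> * \<bar>k.cj (L.nm (x + y * se))\<bar>"
    by (simp only: abs_mult L.cj_repr[OF assms] L.nm_def)
  moreover have "k.cj x * k.cj x + k.cj y * k.cj y * inverse \<epsilon> \<ge> 0" using eps_pos by simp
  ultimately show ?thesis by (simp only: cj_nm_repr[OF assms] abs_of_nonneg)
qed

lemma om_gt1: "om > 1"
proof -
  have "sp > 1" using p_gt1 by simp
  then show ?thesis by (simp add: om_def)
qed

lemma cj_om_repr:
  assumes "a \<in> \<rat>" "b \<in> \<rat>"
  shows "a + b * om \<in> k.fld" "k.cj (a + b * om) = a + b * (1 - om)"
  using assms om_fld by (auto simp: k.cj_plus k.cj_mult k.F_sub_fld k.fld_mult k.cj_F cj_om intro: k.fld_plus)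

text \<open>Coordinates with respect to 1, \<open>om\<close>, \<open>se\<close> and
  \<open>om * se\<close>. Integral ones form a lattice in \<open>L.OK\<close> which by
  \<open>lat_multiple\<close> contains all multiples of \<open>2 * p\<close>.\<close>

definition lat :: "real \<Rightarrow> real \<Rightarrow> real \<Rightarrow> real \<Rightarrow> real"
  where "lat a b c d = (a + b * om) + (c + d * om) * se"

lemma lat_OK: "lat (of_int a) (of_int b) (of_int c) (of_int d) \<in> L.OK"
  unfolding lat_def using om_OK
  by (intro L.fld.ints.plus_closed L.fld.ints.mult_closed[OF L.OF_sub_OK se_OK] L.OF_sub_OK
      k.fld.ints.plus_closed k.fld.ints.mult_closed[OF _ om_OK] k.fld.ints.of_int_closed)

lemma lat_fld: "z \<in> L.fld \<Longrightarrow> \<exists>a\<in>\<rat>. \<exists>b\<in>\<rat>. \<exists>c\<in>\<rat>. \<exists>d\<in>\<rat>. z = lat a b c d"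
proof -
  have *: "\<exists>a\<in>\<rat>. \<exists>b\<in>\<rat>. x = a + b * om" if "x \<in> k.fld" for x
  proof -
    obtain u v where "u \<in> \<rat>" "v \<in> \<rat>" "x = u + v * sp" using \<open>x \<in> k.fld\<close> k.fldE by metis
    then show ?thesis by (intro bexI[of _ "u - v"] bexI[of _ "2 * v"]) (auto simp: om_def field_simps)
  qed
  assume "z \<in> L.fld"
  then obtain x y where xy: "x \<in> k.fld" "y \<in> k.fld" "z = x + y * se" using L.fldE by metis
  show ?thesis using *[OF xy(1)] *[OF xy(2)] unfolding xy(3) lat_def by blast
qed

text \<open>Coordinates over \<open>k\<close> are traces: \<open>2 * x\<close> of \<open>z\<close>,
  and \<open>2 * y\<close> of \<open>z * inverse se\<close>, which is integral because
  \<open>se\<close> is a unit.\<close>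

lemma lat_multiple:
  assumes z: "z \<in> L.OK"
  shows "\<exists>a b c d :: int. 2 * real p * z = lat (of_int a) (of_int b) (of_int c) (of_int d)"
proof -
  have zf: "z \<in> L.fld" using z L.OK_sub_fld by blast
  then obtain x y where xy: "x \<in> k.fld" "y \<in> k.fld" "z = x + y * se" using L.fldE by metis
  have "z * inverse se = y + (x * inverse \<epsilon>) * se"
    using xy(3) L.delta_nonzero unfolding inverse_se by (simp add: algebra_simps eps_pos) (use eps_pos in simp)
  moreover have xe: "x * inverse \<epsilon> \<in> k.fld" using xy eps_fld by (intro k.fld_mult k.fld_inverse)
  ultimately have 2: "L.tr (z * inverse se) = 2 * y"
    using L.cj_repr[OF xy(2) xe] by (simp add: L.tr_def)
  have 1: "L.tr z = 2 * x" using L.cj_repr[OF xy(1,2)] by (simp add: L.tr_def xy(3))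
  obtain a b where ab: "real p * (2 * x) = of_int a + of_int b * om"
    using p_mult_repr[OF L.tr_OK[OF z]] 1 by auto
  obtain c d where cd: "real p * (2 * y) = of_int c + of_int d * om"
    using p_mult_repr[OF L.tr_OK[OF L.fld.ints.mult_closed[OF z inverse_se_OK]]] 2 by auto
  have "2 * real p * z = real p * (2 * x) + real p * (2 * y) * se" by (simp add: xy(3) algebra_simps)
  then show ?thesis unfolding ab cd lat_def by blast
qed

lemma lat_diff: "lat a b c d - lat a' b' c' d' = lat (a - a') (b - b') (c - c') (d - d')"
  by (simp add: lat_def algebra_simps)

lemma lat_scale: "t * lat a b c d = lat (t * a) (t * b) (t * c) (t * d)"
  by (simp add: lat_def algebra_simps)

text \<open>\<open>f\<close> records the lattice coordinates of \<open>2 * real p * z\<close> modulo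
  \<open>M = 2 * p * m\<close>. Equal values make the difference \<open>M\<close> times a lattice
  element, and \<open>2 * p\<close> cancels.\<close>

lemma finite_residues:
  assumes m: "m > 0"
  obtains f :: "real \<Rightarrow> int \<times> int \<times> int \<times> int" where "finite (f ` L.OK)"
    "\<And>x y. x \<in> L.OK \<Longrightarrow> y \<in> L.OK \<Longrightarrow> f x = f y \<Longrightarrow> (x - y) / real m \<in> L.OK"
proof -
  have "\<forall>z\<in>L.OK. \<exists>q :: int \<times> int \<times> int \<times> int. case q of (a, b, c, d) \<Rightarrow>
      2 * real p * z = lat (of_int a) (of_int b) (of_int c) (of_int d)"
    using lat_multiple by (auto simp: split_paired_Ex)
  then obtain g :: "real \<Rightarrow> int \<times> int \<times> int \<times> int" where
    g: "\<And>z. z \<in> L.OK \<Longrightarrow> case g z of (a, b, c, d) \<Rightarrow>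
      2 * real p * z = lat (of_int a) (of_int b) (of_int c) (of_int d)"
    by metis
  define M where "M = 2 * int p * int m"
  have M: "M > 0" using m p_gt1 by (simp add: M_def)
  define f where "f z = (case g z of (a, b, c, d) \<Rightarrow> (a mod M, b mod M, c mod M, d mod M))" for z
  have "f ` L.OK \<subseteq> {0..<M} \<times> {0..<M} \<times> {0..<M} \<times> {0..<M}"
    using M by (auto simp: f_def split: prod.splits)
  then have "finite (f ` L.OK)" by (rule finite_subset) auto
  moreover have "(x - y) / real m \<in> L.OK" if xy: "x \<in> L.OK" "y \<in> L.OK" "f x = f y" for x y
  proof -
    obtain a b c d where gx: "g x = (a, b, c, d)" by (metis prod_cases4)
    obtain a' b' c' d' where gy: "g y = (a', b', c', d')" by (metis prod_cases4)
    have "M dvd a - a'" "M dvd b - b'" "M dvd c - c'" "M dvd d - d'"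
      using xy(3) by (auto simp: f_def gx gy mod_eq_dvd_iff)
    then obtain i j l n where ij: "a - a' = M * i" "b - b' = M * j" "c - c' = M * l" "d - d' = M * n"
      by (auto elim!: dvdE)
    have "2 * real p * x - 2 * real p * y =
        lat (of_int (a - a')) (of_int (b - b')) (of_int (c - c')) (of_int (d - d'))"
      using g[OF xy(1)] g[OF xy(2)] by (simp add: gx gy lat_diff)
    also have "\<dots> = real_of_int M * lat (of_int i) (of_int j) (of_int l) (of_int n)"
      unfolding ij lat_scale by simp
    finally have "2 * real p * (x - y) = 2 * real p * (real m * lat (of_int i) (of_int j) (of_int l) (of_int n))"
      by (simp add: M_def algebra_simps)
    moreover have "2 * real p \<noteq> 0" using p_gt1 by simp
    ultimately have "x - y = real m * lat (of_int i) (of_int j) (of_int l) (of_int n)"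
      using mult_left_cancel by blast
    then have "(x - y) / real m = lat (of_int i) (of_int j) (of_int l) (of_int n)"
      using m by simp
    then show ?thesis using lat_OK by simp
  qed
  ultimately show ?thesis using that by blast
qed

subsection \<open>Finiteness of the class group\<close>

text \<open>In \<open>norm4_repr\<close> two factors are linear and one is quadratic in the
  coordinates, hence degree 4 in \<open>h\<close>. Rational coordinates keep \<open>x\<close> and
  \<open>y\<close> in \<open>k\<close>, where \<open>k.cj\<close> is meaningful.\<close>

lemma norm4_small:
  obtains C where "C > 0"
    "\<And>a b c d h. a \<in> \<rat> \<Longrightarrow> b \<in> \<rat> \<Longrightarrow> c \<in> \<rat> \<Longrightarrow> d \<in> \<rat> \<Longrightarrow> \<bar>a\<bar> \<le> h \<Longrightarrow> \<bar>b\<bar> \<le> h \<Longrightarrow> \<bar>c\<bar> \<le> h \<Longrightarrow> \<bar>d\<bar> \<le> h \<Longrightarrow>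
      \<bar>norm4 (lat a b c d)\<bar> \<le> h * h * (h * h) * C"
proof -
  define K where "K = (1 + om) + (1 + om) * se"
  define C where "C = K * K * (om * om + om * om * inverse \<epsilon>)"
  have K: "K > 0" using om_gt1 eps_pos by (simp add: K_def add_pos_nonneg)
  have C: "C > 0" using K om_gt1 eps_pos by (simp add: C_def add_pos_pos)
  show thesis
  proof (rule that[OF C])
    fix a b c d h :: real
    assume rat: "a \<in> \<rat>" "b \<in> \<rat>" "c \<in> \<rat>" "d \<in> \<rat>"
      and le: "\<bar>a\<bar> \<le> h" "\<bar>b\<bar> \<le> h" "\<bar>c\<bar> \<le> h" "\<bar>d\<bar> \<le> h"
    have h: "h \<ge> 0" using le by linarith
    have lin: "\<bar>u + v * om\<bar> \<le> h * (1 + om)" "\<bar>u + v * (1 - om)\<bar> \<le> h * om" if "\<bar>u\<bar> \<le> h" "\<bar>v\<bar> \<le> h" for u v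
    proof -
      have "\<bar>v * om\<bar> \<le> h * om" using that om_gt1 by (simp add: abs_mult mult_right_mono)
      then show "\<bar>u + v * om\<bar> \<le> h * (1 + om)" using that by (simp add: algebra_simps)
      have "\<bar>v * (1 - om)\<bar> \<le> h * (om - 1)" using that om_gt1 by (simp add: abs_mult mult_right_mono)
      then show "\<bar>u + v * (1 - om)\<bar> \<le> h * om" using that by (simp add: algebra_simps)
    qed
    define x where "x = a + b * om"
    define y where "y = c + d * om"
    have xf: "x \<in> k.fld" "k.cj x = a + b * (1 - om)" and yf: "y \<in> k.fld" "k.cj y = c + d * (1 - om)"
      unfolding x_def y_def using cj_om_repr rat by blast+
    have x: "\<bar>x\<bar> \<le> h * (1 + om)" "\<bar>k.cj x\<bar> \<le> h * om" unfolding xf unfolding x_def using lin le by blast+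
    have y: "\<bar>y\<bar> \<le> h * (1 + om)" "\<bar>k.cj y\<bar> \<le> h * om" unfolding yf unfolding y_def using lin le by blast+
    have "\<bar>y * se\<bar> \<le> h * ((1 + om) * se)"
      using mult_right_mono[OF y(1), of se] eps_pos by (simp add: abs_mult mult.assoc)
    then have 12: "\<bar>x + y * se\<bar> \<le> h * K" "\<bar>x - y * se\<bar> \<le> h * K" using x(1) by (auto simp: K_def distrib_left)
    have sq: "k.cj z * k.cj z \<le> h * om * (h * om)" if "\<bar>k.cj z\<bar> \<le> h * om" for z
      using mult_mono'[OF that that] by simp
    have "k.cj y * k.cj y * inverse \<epsilon> \<le> h * om * (h * om) * inverse \<epsilon>"
      using sq[OF y(2)] eps_pos by (intro mult_right_mono) auto
    then have 3: "k.cj x * k.cj x + k.cj y * k.cj y * inverse \<epsilon> \<le> h * h * (om * om + om * om * inverse \<epsilon>)"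
      using sq[OF x(2)] by (simp add: algebra_simps)
    have "\<bar>norm4 (lat a b c d)\<bar> \<le> (h * K) * (h * K) * (h * h * (om * om + om * om * inverse \<epsilon>))"
      unfolding lat_def x_def[symmetric] y_def[symmetric] norm4_repr[OF xf(1) yf(1)]
      using 12 3 eps_pos h K by (intro mult_mono) auto
    then show "\<bar>norm4 (lat a b c d)\<bar> \<le> h * h * (h * h) * C" by (simp add: C_def algebra_simps)
  qed
qed

text \<open>A weak Euclidean division: the four coordinates of \<open>z\<close> are approximated
  simultaneously with error below \<open>1 / N\<close> and denominator at most \<open>N ^ 4\<close>,
  which suffices once \<open>N\<close> exceeds \<open>C\<close>.\<close>

lemma hurwitz:
  obtains M :: nat where "M > 0"
    "\<And>z. z \<in> L.fld \<Longrightarrow> \<exists>t>0. t \<le> M \<and> (\<exists>w\<in>L.OK. \<bar>norm4 (real t * z - w)\<bar> < 1)"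
proof -
  obtain C where C: "C > 0"
    "\<And>a b c d h. a \<in> \<rat> \<Longrightarrow> b \<in> \<rat> \<Longrightarrow> c \<in> \<rat> \<Longrightarrow> d \<in> \<rat> \<Longrightarrow> \<bar>a\<bar> \<le> h \<Longrightarrow> \<bar>b\<bar> \<le> h \<Longrightarrow> \<bar>c\<bar> \<le> h \<Longrightarrow> \<bar>d\<bar> \<le> h \<Longrightarrow>
      \<bar>norm4 (lat a b c d)\<bar> \<le> h * h * (h * h) * C"
    using norm4_small by blast
  obtain N where N: "N > 0" "C < real N" using C(1) reals_Archimedean2[of C] by (metis of_nat_0_less_iff less_trans)
  define h where "h = 1 / real N"
  have h: "h > 0" "h \<le> 1" using N by (auto simp: h_def)
  have "h * h * (h * h) * C \<le> h * 1 * (1 * 1) * C"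
    using h C by (intro mult_mono mult_nonneg_nonneg) auto
  also have "\<dots> < 1" using N by (simp add: h_def field_simps)
  finally have small: "h * h * (h * h) * C < 1" .
  show thesis
  proof (rule that[of "N ^ 4"])
    show "N ^ 4 > 0" using N by simp
    fix z assume "z \<in> L.fld"
    from lat_fld[OF this]
    obtain a b c d where z: "a \<in> \<rat>" "b \<in> \<rat>" "c \<in> \<rat>" "d \<in> \<rat>" "z = lat a b c d"
      by (elim bexE)
    obtain q r where q: "0 < q" "q \<le> int (N ^ 4)"
      and r: "\<And>i. i < 4 \<Longrightarrow> \<bar>of_int q * (nth [a, b, c, d] i) - of_int (r i)\<bar> < 1 / real N"
      using Dirichlet_approx_simult[OF N(1), where n = 4 and \<theta> = "nth [a, b, c, d]"] by blast
    define w where "w = lat (of_int (r 0)) (of_int (r 1)) (of_int (r 2)) (of_int (r 3))"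
    have "real (nat q) * z - w = lat (of_int q * a - of_int (r 0)) (of_int q * b - of_int (r 1))
        (of_int q * c - of_int (r 2)) (of_int q * d - of_int (r 3))"
      using q by (simp add: z w_def lat_scale lat_diff)
    moreover have "\<bar>of_int q * a - of_int (r 0)\<bar> \<le> h" "\<bar>of_int q * b - of_int (r 1)\<bar> \<le> h"
        "\<bar>of_int q * c - of_int (r 2)\<bar> \<le> h" "\<bar>of_int q * d - of_int (r 3)\<bar> \<le> h"
      using r[of 0] r[of 1] r[of 2] r[of 3] by (auto simp: h_def numeral_eq_Suc)
    ultimately have "\<bar>norm4 (real (nat q) * z - w)\<bar> \<le> h * h * (h * h) * C"
      using z by (simp add: C(2))
    then have "\<bar>norm4 (real (nat q) * z - w)\<bar> < 1" using small by linarith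
    moreover have "w \<in> L.OK" unfolding w_def by (rule lat_OK)
    moreover have "nat q > 0" "nat q \<le> N ^ 4" using q by (auto simp: nat_le_iff)
    ultimately show "\<exists>t>0. t \<le> N ^ 4 \<and> (\<exists>w\<in>L.OK. \<bar>norm4 (real t * z - w)\<bar> < 1)" by blast
  qed
qed

text \<open>Take \<open>b\<close> in \<open>I\<close> of least nonzero norm. For \<open>x\<close> in
  \<open>I\<close>, \<open>hurwitz\<close> gives an element \<open>real t * x - w * b\<close> of
  \<open>I\<close> of smaller norm than \<open>b\<close>, hence 0. So \<open>b\<close> divides
  \<open>real t * x\<close>, and \<open>fact M\<close> absorbs every \<open>t\<close>. Scaling
  \<open>I\<close> by \<open>fact M / b\<close> also sends \<open>b\<close> to
  \<open>fact M\<close>.\<close>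

lemma class_representative:
  obtains m :: nat where "m > 0"
    "\<And>I. frac_ideal L.OK I \<Longrightarrow> I \<subseteq> L.OK \<Longrightarrow>
      \<exists>a\<in>L.fld. a \<noteq> 0 \<and> a \<cdot> I \<subseteq> L.OK \<and> real m \<in> a \<cdot> I"
proof -
  obtain M where M: "M > 0"
    "\<And>z. z \<in> L.fld \<Longrightarrow> \<exists>t>0. t \<le> M \<and> (\<exists>w\<in>L.OK. \<bar>norm4 (real t * z - w)\<bar> < 1)"
    using hurwitz by blast
  show thesis
  proof (rule that[of "fact M"])
    fix I assume I: "frac_ideal L.OK I" "I \<subseteq> L.OK"
    define P where "P n \<longleftrightarrow> (\<exists>b\<in>I. b \<noteq> 0 \<and> real n = \<bar>norm4 b\<bar>)" for n
    have exP: "\<exists>n. real n = \<bar>norm4 b\<bar>" if "b \<in> I" for b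
    proof -
      have "norm4 b \<in> \<int>" using that I(2) by (intro norm4_OK) auto
      then obtain i where "norm4 b = of_int i" by (elim Ints_cases)
      then show ?thesis by (intro exI[of _ "nat \<bar>i\<bar>"]) simp
    qed
    obtain b0 where "b0 \<in> I" "b0 \<noteq> 0" using I by (auto simp: frac_ideal_def)
    then have "\<exists>n. P n" using exP[of b0] by (auto simp: P_def)
    then obtain n where n: "P n" "\<And>i. i < n \<Longrightarrow> \<not> P i" by (metis LeastI_ex not_less_Least)
    then obtain b where b: "b \<in> I" "b \<noteq> 0" "real n = \<bar>norm4 b\<bar>" by (auto simp: P_def)
    have bf: "b \<in> L.fld" using b I L.OK_sub_fld by blast
    have key: "fact M * (x / b) \<in> L.OK" if x: "x \<in> I" for x
    proof -
      have xf: "x \<in> L.fld" using x I L.OK_sub_fld by blast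
      obtain t w where t: "t > 0" "t \<le> M" "w \<in> L.OK" "\<bar>norm4 (real t * (x / b) - w)\<bar> < 1"
        using M(2)[of "x / b"] L.fld.F_divide[OF xf bf] by blast
      define y where "y = real t * x - w * b"
      have "y \<in> I" unfolding y_def using t x b
        by (intro L.fld.ints.frac_diff[OF I(1)] L.fld.ints.frac_mult[OF I(1)] L.fld.ints.of_nat_closed)
      have wf: "real t * (x / b) - w \<in> L.fld"
        by (rule L.fld.F_diff[OF L.fld.F_mult[OF L.fld.F.of_nat_closed L.fld.F_divide[OF xf bf]]
              L.OK_sub_fld[OF t(3)]])
      have "y = b * (real t * (x / b) - w)" using b by (simp add: y_def field_simps)
      then have "\<bar>norm4 y\<bar> = \<bar>norm4 b\<bar> * \<bar>norm4 (real t * (x / b) - w)\<bar>"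
        using norm4_mult[OF bf wf] by (simp add: abs_mult)
      also have "\<dots> < \<bar>norm4 b\<bar>" using t(4) b bf by (simp add: norm4_zero_iff)
      finally have lt: "\<bar>norm4 y\<bar> < real n" using b by simp
      have "y = 0"
      proof (rule ccontr)
        assume "y \<noteq> 0"
        obtain i where "real i = \<bar>norm4 y\<bar>" using exP[OF \<open>y \<in> I\<close>] by blast
        then have "P i" "i < n" using \<open>y \<noteq> 0\<close> \<open>y \<in> I\<close> lt by (auto simp: P_def)
        then show False using n by blast
      qed
      then have "real t * (x / b) = w" using b by (simp add: y_def field_simps)
      moreover obtain s where "fact M = t * s" using t dvd_fact[of t M] by (metis Suc_leI One_nat_def dvdE)
      then have "fact M = real s * real t" by (metis mult.commute of_nat_fact of_nat_mult)
      ultimately have "fact M * (x / b) = real s * w" by (simp only: mult.assoc)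
      then show ?thesis using t by (simp add: L.fld.ints.mult_closed L.fld.ints.of_nat_closed)
    qed
    have "(fact M / b) \<cdot> I \<subseteq> L.OK" using key by (auto simp: scale_def)
    moreover have "real (fact M) \<in> (fact M / b) \<cdot> I" using b scale_mem[OF b(1), of "fact M / b"] by simp
    moreover have "fact M / b \<in> L.fld" using bf L.fld.F_divide[OF L.fld.F.of_nat_closed[of "fact M"]] by simp
    ultimately show "\<exists>a\<in>L.fld. a \<noteq> 0 \<and> a \<cdot> I \<subseteq> L.OK \<and> real (fact M) \<in> a \<cdot> I"
      using b by (intro bexI[of _ "fact M / b"]) auto
  qed simp
qed

text \<open>An ideal containing \<open>m\<close> is a union of residue classes modulo
  \<open>m\<close>, so its image under \<open>f\<close> determines it.\<close>

lemma finite_ideals_containing: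
  assumes "m > 0"
  shows "finite {A. frac_ideal L.OK A \<and> A \<subseteq> L.OK \<and> real m \<in> A}" (is "finite ?S")
proof -
  obtain f :: "real \<Rightarrow> int \<times> int \<times> int \<times> int" where f: "finite (f ` L.OK)"
    "\<And>x y. x \<in> L.OK \<Longrightarrow> y \<in> L.OK \<Longrightarrow> f x = f y \<Longrightarrow> (x - y) / real m \<in> L.OK"
    using finite_residues[OF assms] by blast
  have sub: "A \<subseteq> B" if A: "A \<in> ?S" and B: "B \<in> ?S" and eq: "f ` A = f ` B" for A B
  proof
    fix x assume "x \<in> A"
    then obtain y where y: "y \<in> B" "f x = f y" using eq by (metis imageE imageI)
    then have "(x - y) / real m \<in> L.OK" using f(2) A B \<open>x \<in> A\<close> by blast
    then have "(x - y) / real m * real m \<in> B" using B L.fld.ints.frac_mult by blast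
    then have "x - y \<in> B" using assms by simp
    then have "(x - y) + y \<in> B" using B y L.fld.ints.frac_plus by blast
    then show "x \<in> B" by simp
  qed
  have "inj_on ((`) f) ?S"
    using sub by (intro inj_onI) (metis (no_types, lifting) subset_antisym)
  moreover have "(`) f ` ?S \<subseteq> Pow (f ` L.OK)" by auto
  ultimately show ?thesis using f(1) by (meson finite_Pow_iff finite_imageD finite_subset)
qed

end

subsection \<open>A fundamental relative unit\<close>

context quadratic_prime_unit
begin

text \<open>This does the work of Minkowski's theorem for a box: \<open>z\<close> is small at one
  real place and at the complex place, large at the other real place. \<open>C\<close> must not
  depend on \<open>r\<close>, since pigeonhole is applied to elements for ever smaller
  \<open>r\<close>.\<close>

lemma small_elements:
  obtains C where "\<And>r. r > 0 \<Longrightarrow> \<exists>z\<in>L.OK. z \<noteq> 0 \<and> \<bar>norm4 z\<bar> \<le> C \<and> \<bar>z\<bar> < r * \<bar>L.cj z\<bar>"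
proof -
  define K where "K = om + se + sp"
  define K2 where "K2 = K + 2 * (1 + sp) * se"
  define K3 where "K3 = om * om + om * om * inverse \<epsilon>"
  have sp0: "sp > 0" and se0: "se > 0" using p_gt1 eps_pos by auto
  have K1: "K > 0" unfolding K_def using sp0 se0 om_gt1 by linarith
  have "0 < 2 * (1 + sp) * se" using sp0 se0 by (intro mult_pos_pos add_pos_pos) auto
  with K1 have K: "K > 0" "K2 > 0" "K3 > 0"
    using om_gt1 eps_pos by (auto simp: K2_def K3_def add_pos_pos)
  show thesis
  proof (rule that[of "K * K2 * K3"])
    fix r :: real assume r: "r > 0"
    obtain N0 :: nat where N0: "K * K * K3 / r < real N0" using reals_Archimedean2 by blast
    define N where "N = Suc N0"
    have N: "N > 0" "real N \<ge> 1" "K * K * K3 / r < real N" using N0 by (auto simp: N_def)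
    define h where "h = 1 / real N"
    have h: "h > 0" "h * real N = 1" using N by (auto simp: h_def)
    \<comment> \<open>These numbers make \<open>z\<close>, \<open>k.cj x\<close> and
      \<open>k.cj y\<close> small for \<open>x = e 1 - e 0 * om\<close> and
      \<open>y = - e 2 + d * om\<close>: \<open>k.cj y\<close> is the third error,
      \<open>k.cj x\<close> a combination of the first two, and \<open>z\<close> a combination of
      \<open>k.cj x\<close>, \<open>k.cj y\<close> and the first error.\<close>
    obtain d e where d: "0 < d" "d \<le> int (N ^ 3)"
      and e: "\<And>i. i < 3 \<Longrightarrow> \<bar>of_int d * (nth [se, se * (1 - om), 1 - om] i) - of_int (e i)\<bar> < 1 / real N"
      using Dirichlet_approx_simult[OF N(1), where n = 3 and \<theta> = "nth [se, se * (1 - om), 1 - om]"] by blast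
    have e0: "\<bar>of_int d * se - of_int (e 0)\<bar> < h" and e1: "\<bar>of_int d * (se * (1 - om)) - of_int (e 1)\<bar> < h"
      and e2: "\<bar>of_int d * (1 - om) - of_int (e 2)\<bar> < h"
      using e[of 0] e[of 1] e[of 2] by (auto simp: h_def numeral_eq_Suc)
    define x where "x = of_int (e 1) + of_int (- e 0) * om"
    define y where "y = of_int (- e 2) + of_int d * om"
    have x: "x \<in> k.fld" "k.cj x = of_int (e 1) + of_int (- e 0) * (1 - om)"
      and y: "y \<in> k.fld" "k.cj y = of_int (- e 2) + of_int d * (1 - om)"
      unfolding x_def y_def by (rule cj_om_repr; simp)+
    define z where "z = x + y * se"
    have zOK: "z \<in> L.OK" using lat_OK[of "e 1" "- e 0" "- e 2" d] by (simp add: z_def x_def y_def lat_def)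
    have z_nz: "z \<noteq> 0"
    proof
      assume "z = 0"
      then have "y = 0" using L.repr_zero[OF x(1) y(1)] by (simp add: z_def)
      moreover from this have "k.cj y = 0" using k.cj_F[of 0] by simp
      moreover have "of_int d * (om - (1 - om)) = y - k.cj y"
        unfolding y(2) unfolding y_def by (simp add: algebra_simps)
      ultimately have "of_int d * (om - (1 - om)) = 0" by simp
      then show False using d om_gt1 by simp
    qed
    have cjx: "\<bar>k.cj x\<bar> \<le> h * om"
    proof -
      have "k.cj x = (1 - om) * (of_int d * se - of_int (e 0)) - (of_int d * (se * (1 - om)) - of_int (e 1))"
        unfolding x by (simp add: algebra_simps)
      moreover have "\<bar>(1 - om) * (of_int d * se - of_int (e 0))\<bar> \<le> (om - 1) * h"
        unfolding abs_mult using om_gt1 e0 by (intro mult_mono) auto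
      ultimately have "\<bar>k.cj x\<bar> \<le> (om - 1) * h + h" using e1 by linarith
      then show ?thesis by (simp add: algebra_simps)
    qed
    have cjy: "\<bar>k.cj y\<bar> \<le> h" unfolding y using e2 by simp
    have "h \<le> h * om" using h om_gt1 by simp
    then have cjy': "\<bar>k.cj y\<bar> \<le> h * om" using cjy by linarith
    have sq: "k.cj w * k.cj w \<le> h * om * (h * om)" if "\<bar>k.cj w\<bar> \<le> h * om" for w
      using mult_mono'[OF that that] by simp
    have "k.cj y * k.cj y * inverse \<epsilon> \<le> h * om * (h * om) * inverse \<epsilon>"
      using sq[OF cjy'] eps_pos by (intro mult_right_mono) auto
    then have B: "k.cj x * k.cj x + k.cj y * k.cj y * inverse \<epsilon> \<le> h * h * K3"
      using sq[OF cjx] by (simp add: K3_def algebra_simps)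
    have spo: "sp = om - (1 - om)" by (simp add: om_def)
    have zx: "z = k.cj x + k.cj y * se + sp * (of_int d * se - of_int (e 0))"
      unfolding z_def x(2) y(2) unfolding x_def y_def spo by (simp add: algebra_simps)
    have yx: "y = k.cj y + of_int d * sp" unfolding y(2) unfolding y_def spo by (simp add: algebra_simps)
    have z1: "\<bar>z\<bar> \<le> h * K"
    proof -
      have "\<bar>k.cj y * se\<bar> \<le> h * se" using cjy se0 by (simp add: abs_mult mult_right_mono)
      moreover have "\<bar>sp * (of_int d * se - of_int (e 0))\<bar> \<le> sp * h"
        unfolding abs_mult using e0 sp0 by (intro mult_mono) auto
      ultimately have "\<bar>z\<bar> \<le> h * om + h * se + sp * h" unfolding zx using cjx by linarith
      then show ?thesis by (simp add: K_def algebra_simps)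
    qed
    have N3: "1 \<le> real N ^ 3" using N(2) by (rule one_le_power)
    have z2: "\<bar>L.cj z\<bar> \<le> real N ^ 3 * K2"
    proof -
      have "L.cj z = z - 2 * (y * se)" unfolding z_def L.cj_repr[OF x(1) y(1)] by simp
      moreover have "h \<le> 1" using h N by (simp add: h_def)
      then have "h * K \<le> real N ^ 3 * K" "h \<le> real N ^ 3" using N3 K by (auto intro: mult_right_mono)
      moreover have "\<bar>of_int d * sp\<bar> \<le> real N ^ 3 * sp"
      proof -
        have "real_of_int d \<le> real_of_int (int (N ^ 3))" using d(2) by (simp only: of_int_le_iff)
        then show ?thesis using d(1) sp0 by (simp add: abs_mult mult_right_mono)
      qed
      ultimately have "\<bar>y\<bar> \<le> real N ^ 3 * (1 + sp)" using cjy yx by (simp add: distrib_left)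
      then have "\<bar>y * se\<bar> \<le> real N ^ 3 * (1 + sp) * se" using se0 by (simp add: abs_mult mult_right_mono)
      then have "\<bar>L.cj z\<bar> \<le> real N ^ 3 * K + 2 * (real N ^ 3 * (1 + sp) * se)"
        using \<open>L.cj z = z - 2 * (y * se)\<close> z1 \<open>h * K \<le> real N ^ 3 * K\<close> by linarith
      then show ?thesis by (simp add: K2_def algebra_simps)
    qed
    have B0: "0 \<le> k.cj x * k.cj x + k.cj y * k.cj y * inverse \<epsilon>" using eps_pos by simp
    have nz: "\<bar>norm4 z\<bar> = \<bar>z\<bar> * \<bar>L.cj z\<bar> * (k.cj x * k.cj x + k.cj y * k.cj y * inverse \<epsilon>)"
      unfolding z_def norm4_repr[OF x(1) y(1)] L.cj_repr[OF x(1) y(1)] ..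
    have "\<bar>norm4 z\<bar> \<le> (h * K) * (real N ^ 3 * K2) * (h * h * K3)"
      unfolding nz using z1 z2 B B0 h K by (intro mult_mono mult_nonneg_nonneg) auto
    also have "\<dots> = (h * real N) ^ 3 * (K * K2 * K3)" by (simp add: power3_eq_cube algebra_simps)
    finally have bound: "\<bar>norm4 z\<bar> \<le> K * K2 * K3" using h by simp
    \<comment> \<open>A nonzero integer has norm at least 1, so
      \<open>\<bar>z\<bar> * \<bar>L.cj z\<bar>\<close> is bounded below. As
      \<open>\<bar>z\<bar>\<close> is at most \<open>h * K\<close>, the ratio drops below
      \<open>r\<close> by the choice of \<open>N\<close>.\<close>
    have ge1: "1 \<le> \<bar>z\<bar> * \<bar>L.cj z\<bar> * (h * h * K3)"
      using norm4_ge_1[OF zOK z_nz] mult_left_mono[OF B, of "\<bar>z\<bar> * \<bar>L.cj z\<bar>"] unfolding nz by simp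
    have "\<bar>z\<bar> * \<bar>z\<bar> \<le> h * K * (h * K)" using mult_mono'[OF z1 z1] by simp
    then have "\<bar>z\<bar> * \<bar>z\<bar> \<le> h * K * (h * K) * 1" by simp
    also have "h * K * (h * K) * 1 \<le> h * K * (h * K) * (\<bar>z\<bar> * \<bar>L.cj z\<bar> * (h * h * K3))"
      using ge1 h K by (intro mult_left_mono) auto
    also have "\<dots> = \<bar>z\<bar> * \<bar>L.cj z\<bar> * (K * K * K3 * (h * h * (h * h)))" by (simp add: algebra_simps)
    also have "\<dots> < \<bar>z\<bar> * \<bar>L.cj z\<bar> * r"
    proof (rule mult_strict_left_mono)
      have "h * h * (h * h) \<le> 1 * 1 * (1 * h)" using h N by (intro mult_mono) (auto simp: h_def)
      then have "K * K * K3 * (h * h * (h * h)) \<le> K * K * K3 * h" using K by (intro mult_left_mono) auto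
      also have "\<dots> < r" using N r by (simp add: h_def field_simps)
      finally show "K * K * K3 * (h * h * (h * h)) < r" .
      show "0 < \<bar>z\<bar> * \<bar>L.cj z\<bar>" using z_nz L.cj_zero_iff[OF L.OK_sub_fld[OF zOK]] by simp
    qed
    finally have "\<bar>z\<bar> * \<bar>z\<bar> < \<bar>z\<bar> * (r * \<bar>L.cj z\<bar>)" by (simp add: algebra_simps)
    then have "\<bar>z\<bar> < r * \<bar>L.cj z\<bar>" by (rule mult_left_less_imp_less) simp
    then show "\<exists>z\<in>L.OK. z \<noteq> 0 \<and> \<bar>norm4 z\<bar> \<le> K * K2 * K3 \<and> \<bar>z\<bar> < r * \<bar>L.cj z\<bar>"
      using zOK z_nz bound by blast
  qed
qed

lemma norm4_dvd:
  assumes "z \<in> L.OK" "z \<noteq> 0"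
  shows "norm4 z / z \<in> L.OK"
proof -
  have "norm4 z = z * (L.cj z * k.cj (L.nm z))" by (simp add: norm4_def k.nm_def L.nm_def)
  then have "norm4 z / z = L.cj z * k.cj (L.nm z)" using assms by simp
  moreover have "L.cj z * k.cj (L.nm z) \<in> L.OK"
    by (rule L.fld.ints.mult_closed[OF L.cj_OK[OF assms(1)] L.OF_sub_OK[OF k.cj_OK[OF L.nm_OK[OF assms(1)]]]])
  ultimately show ?thesis by simp
qed

text \<open>Pigeonhole: \<open>rho\<close> takes arbitrarily small positive values on
  \<open>G\<close>, hence infinitely many, but there are finitely many residues modulo
  \<open>m\<close>. Two elements with equal residue and different \<open>rho\<close> divide each
  other, and their quotient is the unit.\<close>

lemma unit_exists:
  obtains u where "u \<in> L.OK" "inverse u \<in> L.OK" "u \<noteq> 0" "\<bar>u\<bar> \<noteq> \<bar>L.cj u\<bar>"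
proof -
  obtain C where C: "\<And>r. r > 0 \<Longrightarrow> \<exists>z\<in>L.OK. z \<noteq> 0 \<and> \<bar>norm4 z\<bar> \<le> C \<and> \<bar>z\<bar> < r * \<bar>L.cj z\<bar>"
    using small_elements by blast
  define G where "G = {z \<in> L.OK. z \<noteq> 0 \<and> \<bar>norm4 z\<bar> \<le> C}"
  \<comment> \<open>Divisible by every positive integer up to \<open>C\<close>, so by the norm of
    each \<open>y\<close> in \<open>G\<close> and by \<open>y\<close> itself. This makes
    \<open>x / y = 1 + (x - y) / real m * (real m / y)\<close> integral.\<close>
  define m :: nat where "m = fact (nat \<lfloor>C\<rfloor>)"
  have m: "m > 0" by (simp add: m_def)
  define rho where "rho z = \<bar>z\<bar> / \<bar>L.cj z\<bar>" for z
  have cj_nz: "L.cj z \<noteq> 0" if "z \<in> L.OK" "z \<noteq> 0" for z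
    using that L.cj_zero_iff L.OK_sub_fld by blast
  have rho_pos: "rho z > 0" if "z \<in> G" for z using that cj_nz by (auto simp: rho_def G_def)
  have small: "\<exists>z\<in>G. rho z < r" if "r > 0" for r
    using C[OF that] cj_nz by (auto simp: rho_def G_def field_simps)
  obtain f :: "real \<Rightarrow> int \<times> int \<times> int \<times> int" where f: "finite (f ` L.OK)"
    "\<And>x y. x \<in> L.OK \<Longrightarrow> y \<in> L.OK \<Longrightarrow> f x = f y \<Longrightarrow> (x - y) / real m \<in> L.OK"
    using finite_residues[OF m] by blast
  have "\<exists>a\<in>G. \<exists>b\<in>G. f a = f b \<and> rho a \<noteq> rho b"
  proof (rule ccontr)
    assume *: "\<not> ?thesis"
    have "rho ` G \<subseteq> (\<lambda>c. rho (SOME a. a \<in> G \<and> f a = c)) ` f ` L.OK"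
    proof
      fix t assume "t \<in> rho ` G"
      then obtain a where a: "a \<in> G" "t = rho a" by blast
      then have "(SOME b. b \<in> G \<and> f b = f a) \<in> G \<and> f (SOME b. b \<in> G \<and> f b = f a) = f a"
        using someI[of "\<lambda>b. b \<in> G \<and> f b = f a" a] by blast
      then have "t = rho (SOME b. b \<in> G \<and> f b = f a)" using * a by metis
      then show "t \<in> (\<lambda>c. rho (SOME a. a \<in> G \<and> f a = c)) ` f ` L.OK" using a by (auto simp: G_def)
    qed
    then have fin: "finite (rho ` G)" using f(1) by (meson finite_imageI finite_subset)
    have ne: "rho ` G \<noteq> {}" using small[of 1] by auto
    have "Min (rho ` G) > 0" using fin ne rho_pos by simp
    then obtain z where "z \<in> G" "rho z < Min (rho ` G)" using small by blast
    then show False using fin by (simp add: Min_gr_iff less_le_not_le)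
  qed
  then obtain a b where ab: "a \<in> G" "b \<in> G" "f a = f b" "rho a \<noteq> rho b" by blast
  have div: "x / y \<in> L.OK" if "x \<in> G" "y \<in> G" "f x = f y" for x y
  proof -
    have x: "x \<in> L.OK" and y: "y \<in> L.OK" "y \<noteq> 0" "\<bar>norm4 y\<bar> \<le> C" using that by (auto simp: G_def)
    obtain i where i: "norm4 y = of_int i" using norm4_OK[OF y(1)] by (elim Ints_cases)
    have i1: "\<bar>i\<bar> \<ge> 1" using norm4_ge_1[OF y(1,2)] unfolding i by linarith
    have "\<bar>i\<bar> \<le> \<lfloor>C\<rfloor>" using y(3) unfolding i by (simp add: le_floor_iff)
    then have "nat \<bar>i\<bar> dvd m" unfolding m_def using i1 by (intro dvd_fact) auto
    then obtain j where j: "m = nat \<bar>i\<bar> * j" by (elim dvdE)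
    have "real m = real_of_int \<bar>i\<bar> * real j" unfolding j by simp
    then have "real m = norm4 y * (of_int (sgn i) * real j)" unfolding i by (simp add: abs_sgn)
    then have "real m / y = (norm4 y / y) * (of_int (sgn i) * of_int (int j))" by simp
    then have my: "real m / y \<in> L.OK"
      using norm4_dvd[OF y(1,2)] by (simp only: L.fld.ints.mult_closed L.fld.ints.of_int_closed)
    have "x / y = 1 + (x - y) / real m * (real m / y)" using m y by (simp add: field_simps)
    then show ?thesis
      using L.fld.ints.plus_closed[OF L.fld.ints.one_closed L.fld.ints.mult_closed[OF f(2)[OF x y(1) that(3)] my]]
      by simp
  qed
  have nz: "a \<noteq> 0" "b \<noteq> 0" and OK: "a \<in> L.OK" "b \<in> L.OK" using ab by (auto simp: G_def)
  show thesis
  proof (rule that[of "a / b"])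
    show "a / b \<in> L.OK" using div ab by blast
    show "inverse (a / b) \<in> L.OK" using div[of b a] ab by simp
    show "a / b \<noteq> 0" using nz by simp
    show "\<bar>a / b\<bar> \<noteq> \<bar>L.cj (a / b)\<bar>"
    proof
      assume "\<bar>a / b\<bar> = \<bar>L.cj (a / b)\<bar>"
      then have "\<bar>a\<bar> / \<bar>b\<bar> = \<bar>L.cj a\<bar> / \<bar>L.cj b\<bar>" using OK by (simp add: L.cj_divide L.OK_sub_fld)
      then have "rho a = rho b" using nz cj_nz OK by (simp add: rho_def field_simps)
      then show False using ab by simp
    qed
  qed
qed

text \<open>Such a \<open>w\<close> is recovered from its trace \<open>w + inverse w\<close>. The
  trace is an integer of \<open>k\<close>, at most \<open>B + 1\<close> at the first place and at
  most 2 in absolute value at the second, where relative norm 1 puts \<open>w\<close> on the unit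
  circle.\<close>

lemma bounded_relative_units_finite:
  "finite {w \<in> L.OK. L.nm w = 1 \<and> 1 < w \<and> w \<le> B}" (is "finite ?W")
proof -
  have W_tr: "L.tr w = w + inverse w" if "w \<in> ?W" for w
  proof -
    have "w * L.cj w = 1" using that by (simp add: L.nm_def)
    then have "L.cj w = inverse w" by (metis inverse_unique)
    then show ?thesis by (simp add: L.tr_def)
  qed
  have "inj_on L.tr ?W"
  proof (rule inj_onI)
    fix w v assume wv: "w \<in> ?W" "v \<in> ?W" "L.tr w = L.tr v"
    then have gt: "w > 1" "v > 1" by auto
    have "(w + inverse w - v - inverse v) * (w * v) =
        w * w * v + (inverse w * w) * v - v * w * v - (inverse v * v) * w"
      by (simp only: algebra_simps)
    also have "\<dots> = w * w * v + v - v * w * v - w" using gt by simp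
    also have "\<dots> = (w - v) * (w * v - 1)" by (simp add: algebra_simps)
    finally have "(w + inverse w - v - inverse v) * (w * v) = (w - v) * (w * v - 1)" .
    moreover have "w + inverse w - v - inverse v = 0" using wv W_tr by simp
    moreover have "w * v > 1" using gt less_1_mult by blast
    ultimately show "w = v" by simp
  qed
  moreover have "finite (L.tr ` ?W)"
  proof -
    \<comment> \<open>\<open>B + 3\<close> is \<open>B + 1\<close> plus 2, a bound for the
      difference of the trace and its conjugate. This difference controls the coordinate
      \<open>b\<close>, and then \<open>A\<close> bounds \<open>a\<close>.\<close>
    define R where "R = real p * (B + 3)"
    define A where "A = R + R * om"
    have "L.tr ` ?W \<subseteq> (\<lambda>(a, b). (of_int a + of_int b * om) / real p) ` ({- \<lceil>A\<rceil>..\<lceil>A\<rceil>} \<times> {- \<lceil>R\<rceil>..\<lceil>R\<rceil>})"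
    proof
      fix T assume "T \<in> L.tr ` ?W"
      then obtain w where w: "w \<in> ?W" "T = L.tr w" by blast
      then have wOK: "w \<in> L.OK" "L.nm w = 1" "1 < w" "w \<le> B" by auto
      obtain x y where xy: "x \<in> k.fld" "y \<in> k.fld" "w = x + y * se" using L.OK_sub_fld[OF wOK(1)] L.fldE by metis
      have T2: "T = 2 * x" unfolding w(2) L.tr_def xy(3) L.cj_repr[OF xy(1,2)] by simp
      have "k.cj x * k.cj x + k.cj y * k.cj y * inverse \<epsilon> = 1"
        using cj_nm_repr[OF xy(1,2)] wOK(2) k.cj_F[of 1] by (simp add: xy(3)[symmetric])
      moreover have "k.cj y * k.cj y * inverse \<epsilon> \<ge> 0" using eps_pos by simp
      ultimately have "k.cj x * k.cj x \<le> 1" by linarith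
      then have "\<bar>k.cj x\<bar> \<le> 1" using abs_le_square_iff[of "k.cj x" 1] by (simp add: power2_eq_square)
      moreover have "k.cj T = 2 * k.cj x" unfolding T2 using xy(1) k.cj_plus[OF xy(1) xy(1)] by simp
      ultimately have cT: "\<bar>k.cj T\<bar> \<le> 2" by simp
      have "inverse w < 1" "inverse w > 0" using wOK by (auto simp: field_simps)
      moreover have "T = w + inverse w" using w W_tr by simp
      ultimately have T: "0 < T" "T \<le> B + 1" using wOK by linarith+
      have TOK: "T \<in> k.OK" unfolding w(2) by (rule L.tr_OK[OF wOK(1)])
      obtain a b where ab: "real p * T = of_int a + of_int b * om" using p_mult_repr[OF TOK] by blast
      have "k.cj (real p * T) = real p * k.cj T"
        using k.cj_mult[OF k.F_sub_fld[of "real p"] k.OK_sub_fld[OF TOK]] by (simp add: k.cj_F)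
      then have "real p * k.cj T = of_int a + of_int b * (1 - om)"
        unfolding ab using cj_om_repr(2)[of "of_int a" "of_int b"] by simp
      then have "of_int b * sp = real p * (T - k.cj T)" using ab by (simp add: om_def field_simps)
      then have bsp: "\<bar>of_int b * sp\<bar> = real p * \<bar>T - k.cj T\<bar>" by (simp add: abs_mult)
      have "\<bar>T - k.cj T\<bar> \<le> B + 3" using T cT by linarith
      then have "\<bar>of_int b * sp\<bar> \<le> R" unfolding bsp R_def by (intro mult_left_mono) auto
      moreover have "\<bar>real_of_int b\<bar> * 1 \<le> \<bar>real_of_int b\<bar> * sp" using p_gt1 by (intro mult_left_mono) auto
      ultimately have bR: "\<bar>real_of_int b\<bar> \<le> R" by (simp add: abs_mult)
      have "\<bar>real p * T\<bar> \<le> R" unfolding R_def abs_mult using T by (intro mult_mono) auto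
      moreover have "\<bar>of_int b * om\<bar> \<le> R * om" using bR om_gt1 by (simp add: abs_mult mult_right_mono)
      ultimately have aA: "\<bar>real_of_int a\<bar> \<le> A" using ab unfolding A_def by linarith
      have "a \<in> {- \<lceil>A\<rceil>..\<lceil>A\<rceil>}" "b \<in> {- \<lceil>R\<rceil>..\<lceil>R\<rceil>}" using aA bR by (auto simp: abs_le_iff) linarith+
      moreover have "T = (of_int a + of_int b * om) / real p" using ab p_gt1 by (simp add: field_simps)
      ultimately show "T \<in> (\<lambda>(a, b). (of_int a + of_int b * om) / real p) ` ({- \<lceil>A\<rceil>..\<lceil>A\<rceil>} \<times> {- \<lceil>R\<rceil>..\<lceil>R\<rceil>})"
        by force
    qed
    then show ?thesis by (rule finite_subset) auto
  qed
  ultimately show ?thesis using finite_imageD by blast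
qed

text \<open>The least unit of relative norm 1 above 1 qualifies: a square root would, up to sign, be
  a smaller one, and it is positive. One exists because \<open>u / L.cj u\<close> has relative norm
  1 and absolute value other than 1.\<close>

lemma relative_unit_nonsquare:
  obtains u where "u \<in> L.OK" "L.nm u = 1"
    "\<And>v. v \<in> L.OK \<Longrightarrow> L.nm v = 1 \<Longrightarrow> u \<noteq> v * v \<and> u \<noteq> - (v * v)"
proof -
  define W where "W = {w \<in> L.OK. L.nm w = 1 \<and> 1 < w}"
  have abs_W: "\<bar>w\<bar> \<in> W" if "w \<in> L.OK" "L.nm w = 1" "\<bar>w\<bar> > 1" for w
  proof -
    have "L.nm (- w) = 1" using that L.OK_sub_fld by (simp add: L.nm_def L.cj_uminus)
    then show ?thesis using that L.fld.ints.minus_closed by (auto simp: W_def abs_if)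
  qed
  obtain u where u: "u \<in> L.OK" "inverse u \<in> L.OK" "u \<noteq> 0" "\<bar>u\<bar> \<noteq> \<bar>L.cj u\<bar>" using unit_exists by blast
  have uf: "u \<in> L.fld" "L.cj u \<in> L.fld" "L.cj u \<noteq> 0" using u by (auto simp: L.OK_sub_fld L.cj_in_fld L.cj_zero_iff)
  define w where "w = u / L.cj u"
  have "inverse (L.cj u) \<in> L.OK" using L.cj_OK[OF u(2)] uf by (simp add: L.cj_inverse)
  then have w: "w \<in> L.OK" unfolding w_def divide_inverse using u by (intro L.fld.ints.mult_closed)
  have nw: "L.nm w = 1" using uf u by (simp add: w_def L.nm_divide L.nm_cj L.nm_zero_iff)
  then have "w * L.cj w = 1" by (simp add: L.nm_def)
  then have aw: "\<bar>w\<bar> * \<bar>L.cj w\<bar> = 1" by (metis abs_mult abs_one)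
  have "\<bar>w\<bar> \<noteq> 1" using u(4) uf by (simp add: w_def field_simps)
  have "\<bar>w\<bar> > 1 \<or> \<bar>L.cj w\<bar> > 1"
  proof (rule ccontr)
    assume *: "\<not> ?thesis"
    then have "\<bar>w\<bar> * \<bar>L.cj w\<bar> \<le> \<bar>w\<bar> * 1" by (intro mult_left_mono) auto
    then show False using * aw \<open>\<bar>w\<bar> \<noteq> 1\<close> by linarith
  qed
  then obtain w1 where w1: "w1 \<in> W"
    using abs_W[OF w nw] abs_W[OF L.cj_OK[OF w]] nw L.nm_cj[OF L.OK_sub_fld[OF w]] by auto
  define S where "S = {v \<in> W. v \<le> w1}"
  have fin: "finite S"
    using bounded_relative_units_finite[of w1] by (rule finite_subset[rotated]) (auto simp: S_def W_def)
  have "w1 \<in> S" using w1 by (simp add: S_def)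
  then have min: "Min S \<in> S" "\<And>v. v \<in> W \<Longrightarrow> Min S \<le> v"
  proof -
    show "Min S \<in> S" using fin \<open>w1 \<in> S\<close> by (intro Min_in) auto
    fix v assume "v \<in> W"
    show "Min S \<le> v"
    proof (cases "v \<le> w1")
      case True
      then show ?thesis using \<open>v \<in> W\<close> fin by (intro Min_le) (auto simp: S_def)
    next
      case False
      then show ?thesis using fin \<open>w1 \<in> S\<close> Min_le[of S w1] by linarith
    qed
  qed
  have M: "Min S \<in> L.OK" "L.nm (Min S) = 1" "1 < Min S" using min(1) by (auto simp: S_def W_def)
  show thesis
  proof (rule that[OF M(1,2)])
    fix v assume v: "v \<in> L.OK" "L.nm v = 1"
    have "Min S \<noteq> v * v"
    proof
      assume eq: "Min S = v * v"
      then have "\<bar>v\<bar> * \<bar>v\<bar> > 1" using M by simp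
      then have v1: "\<bar>v\<bar> > 1" using mult_le_one[of "\<bar>v\<bar>" "\<bar>v\<bar>"] by linarith
      then have "Min S \<le> \<bar>v\<bar>" using min(2) abs_W[OF v] by blast
      moreover have "\<bar>v\<bar> * 1 < \<bar>v\<bar> * \<bar>v\<bar>" using v1 by (intro mult_strict_left_mono) auto
      ultimately show False using eq by simp
    qed
    moreover have "v * v \<ge> 0" by simp
    then have "Min S \<noteq> - (v * v)" using M by linarith
    ultimately show "Min S \<noteq> v * v \<and> Min S \<noteq> - (v * v)" by blast
  qed
qed

end

subsection \<open>Parity of the class number\<close>

lemma even_card_involution:
  assumes "finite A" "\<And>x. x \<in> A \<Longrightarrow> f x \<in> A \<and> f (f x) = x \<and> f x \<noteq> x"
  shows "even (card A)"
  using assms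
proof (induction A rule: finite_psubset_induct)
  case (psubset A)
  show ?case
  proof (cases "A = {}")
    case False
    then obtain x where x: "x \<in> A" by blast
    define Y where "Y = A - {x, f x}"
    have "Y \<subset> A" using x by (auto simp: Y_def)
    moreover have "f y \<in> Y \<and> f (f y) = y \<and> f y \<noteq> y" if "y \<in> Y" for y
      using that psubset.prems[of y] psubset.prems[OF x] by (auto simp: Y_def)
    ultimately have "even (card Y)" by (rule psubset.IH)
    moreover have "card {x, f x} = 2" using psubset.prems[OF x] by (auto simp: card_insert_if)
    then have "card A = card Y + 2"
      using x psubset.prems[OF x] psubset.hyps(1) card_Diff_subset[of "{x, f x}" A]
        card_mono[of A "{x, f x}"] by (simp add: Y_def)
    ultimately show ?thesis by simp
  qed simp
qed

lemma odd_card_involution: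
  assumes "finite A" "\<And>x. x \<in> A \<Longrightarrow> f x \<in> A \<and> f (f x) = x"
    and "c \<in> A" "\<And>x. x \<in> A \<Longrightarrow> f x = x \<longleftrightarrow> x = c"
  shows "odd (card A)"
proof -
  have "f x \<noteq> c" if "x \<in> A" "x \<noteq> c" for x using assms that by metis
  then have "even (card (A - {c}))"
    using assms by (intro even_card_involution[of _ f]) auto
  then show ?thesis using assms(1,3) by (simp add: card_Diff_singleton card_gt_0_iff even_diff_nat)
      (metis card_gt_0_iff empty_iff even_Suc Suc_pred')
qed

text \<open>Together with \<open>same_class\<close> this mirrors \<open>nonzero_ideals\<close> and
  \<open>ideal_class_rel\<close> on plain sets; ring records enter only at the end.\<close>

definition integral_ideals :: "'a::field set \<Rightarrow> 'a set set"
  where "integral_ideals R = {I. frac_ideal R I \<and> I \<subseteq> R}"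

definition same_class :: "'a::field set \<Rightarrow> ('a set \<times> 'a set) set"
  where "same_class R = {(I, J). I \<in> integral_ideals R \<and> J \<in> integral_ideals R \<and>
    (\<exists>a\<in>R - {0}. \<exists>b\<in>R - {0}. a \<cdot> I = b \<cdot> J)}"

definition principal :: "'a::field set \<Rightarrow> 'a set \<Rightarrow> bool"
  where "principal R I \<longleftrightarrow> (\<exists>c. c \<noteq> 0 \<and> I = c \<cdot> R)"

context dedekind_ring
begin

text \<open>Any multiplier is a quotient of ring elements: \<open>c\<close> is \<open>c * x\<close>
  over \<open>x\<close> for a nonzero \<open>x\<close> in \<open>I\<close>.\<close>

lemma same_classI:
  assumes I: "I \<in> integral_ideals R" and J: "J \<in> integral_ideals R"
    and eq: "c \<cdot> I = J" "c \<noteq> 0"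
  shows "(I, J) \<in> same_class R"
proof -
  obtain x where x: "x \<in> I" "x \<noteq> 0" using I by (auto simp: integral_ideals_def frac_ideal_def)
  have "x \<in> R" "c * x \<in> R" using x I J eq scale_mem[OF x(1), of c] by (auto simp: integral_ideals_def)
  moreover have "(c * x) \<cdot> I = x \<cdot> J" unfolding eq(1)[symmetric] scale_scale by (simp add: mult.commute)
  moreover have "c * x \<noteq> 0" using x eq(2) by simp
  ultimately show ?thesis using I J x(2) unfolding same_class_def by blast
qed

text \<open>Uniqueness of inverse classes, by cancelling the invertible ideal
  \<open>I\<close>.\<close>

lemma principal_prod_same_class:
  assumes I: "I \<in> integral_ideals R" and J: "J \<in> integral_ideals R" and K: "K \<in> integral_ideals R"
    and pr: "principal R (I \<star> J)"
  shows "principal R (I \<star> K) \<longleftrightarrow> (J, K) \<in> same_class R"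
proof
  have fr: "frac_ideal R I" "frac_ideal R J" "frac_ideal R K" using assms by (auto simp: integral_ideals_def)
  obtain c where c: "c \<noteq> 0" "I \<star> J = c \<cdot> R" using pr by (auto simp: principal_def)
  {
    assume "principal R (I \<star> K)"
    then obtain d where d: "d \<noteq> 0" "I \<star> K = d \<cdot> R" by (auto simp: principal_def)
    have fc: "fraction R c" "fraction R d"
      using frac_fraction[OF frac_prod[OF fr(1,2)]] frac_fraction[OF frac_prod[OF fr(1,3)]]
      unfolding c d by (auto intro: principal_mem)
    have "I \<star> (d \<cdot> J) = I \<star> (c \<cdot> K)" by (simp add: scale_prod_right c d scale_scale mult.commute)
    then have "d \<cdot> J = c \<cdot> K" by (rule cancel[OF fr(1) frac_scale[OF fr(2) fc(2) d(1)] frac_scale[OF fr(3) fc(1) c(1)]])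
    then have "inverse c \<cdot> d \<cdot> J = inverse c \<cdot> c \<cdot> K" by simp
    then have "(inverse c * d) \<cdot> J = K" using c by (simp add: scale_scale)
    then show "(J, K) \<in> same_class R" by (rule same_classI[OF J K]) (use c d in simp)
  }
  assume "(J, K) \<in> same_class R"
  then obtain a b where ab: "a \<noteq> 0" "b \<noteq> 0" "a \<cdot> J = b \<cdot> K" by (auto simp: same_class_def)
  have "b \<cdot> (I \<star> K) = a \<cdot> (I \<star> J)" by (simp only: scale_prod_right[symmetric] ab)
  then have "inverse b \<cdot> b \<cdot> (I \<star> K) = inverse b \<cdot> a \<cdot> c \<cdot> R" by (simp add: c)
  then have "I \<star> K = (inverse b * a * c) \<cdot> R" using ab by (simp add: scale_scale mult.assoc)
  then show "principal R (I \<star> K)" unfolding principal_def using ab c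
    by (intro exI[of _ "inverse b * a * c"]) simp
qed

lemma integral_inverse:
  assumes I: "I \<in> integral_ideals R"
  obtains J where "J \<in> integral_ideals R" "principal R (I \<star> J)"
proof -
  obtain J where J: "frac_ideal R J" "I \<star> J = R" using invertible I by (auto simp: integral_ideals_def)
  obtain d where d: "d \<in> R" "d \<noteq> 0" "\<And>x. x \<in> J \<Longrightarrow> d * x \<in> R" using J unfolding frac_ideal_def by blast
  have "d \<cdot> J \<in> integral_ideals R"
    using d J frac_scale[OF J(1) fraction_closed[OF d(1)]] by (auto simp: integral_ideals_def scale_def)
  moreover have "principal R (I \<star> (d \<cdot> J))"
    unfolding principal_def using d J by (intro exI[of _ d]) (simp add: scale_prod_right)
  ultimately show ?thesis using that by blast
qed

text \<open>Inversion is an involution on the classes, and its fixed points are the classes of order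
  at most 2. By \<open>two\<close> only the principal class is fixed, and the others pair
  off.\<close>

theorem odd_card_classes:
  assumes equiv: "equiv (integral_ideals R) (same_class R)"
    and fin: "finite (integral_ideals R // same_class R)"
    and two: "\<And>I. frac_ideal R I \<Longrightarrow> principal R (I \<star> I) \<Longrightarrow> principal R I"
  shows "odd (card (integral_ideals R // same_class R))"
proof -
  \<comment> \<open>The inverse class, without a choice of representative.\<close>
  define f where "f C = {J \<in> integral_ideals R. \<forall>I\<in>C. principal R (I \<star> J)}" for C
  have f_class: "f (same_class R `` {I}) = same_class R `` {J}"
    if I: "I \<in> integral_ideals R" and J: "J \<in> integral_ideals R" and pr: "principal R (I \<star> J)" for I J
  proof
    show "f (same_class R `` {I}) \<subseteq> same_class R `` {J}"
    proof
      fix K assume K: "K \<in> f (same_class R `` {I})"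
      have "(I, I) \<in> same_class R" using equiv_class_self[OF equiv I] by blast
      then have "principal R (I \<star> K)" "K \<in> integral_ideals R" using K by (auto simp: f_def)
      then show "K \<in> same_class R `` {J}" using principal_prod_same_class[OF I J _ pr] by blast
    qed
    show "same_class R `` {J} \<subseteq> f (same_class R `` {I})"
    proof
      fix K assume "K \<in> same_class R `` {J}"
      then have K: "(J, K) \<in> same_class R" "K \<in> integral_ideals R" by (auto simp: same_class_def)
      then have "principal R (I \<star> K)" using principal_prod_same_class[OF I J K(2) pr] by blast
      then have KI: "principal R (K \<star> I)" by (simp add: prod_span_commute)
      have "principal R (I' \<star> K)" if "(I, I') \<in> same_class R" for I'
      proof -
        have "I' \<in> integral_ideals R" using that by (auto simp: same_class_def)
        then have "principal R (K \<star> I')" using principal_prod_same_class[OF K(2) I _ KI] that by blast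
        then show ?thesis by (simp add: prod_span_commute)
      qed
      then show "K \<in> f (same_class R `` {I})" using K by (auto simp: f_def)
    qed
  qed
  have R: "R \<in> integral_ideals R" using frac_ring by (auto simp: integral_ideals_def)
  have pR: "principal R R" unfolding principal_def by (rule exI[of _ 1]) simp
  show ?thesis
  proof (rule odd_card_involution[OF fin, where f = f and c = "same_class R `` {R}"])
    show "same_class R `` {R} \<in> integral_ideals R // same_class R" by (rule quotientI[OF R])
    fix C assume "C \<in> integral_ideals R // same_class R"
    then obtain I where I: "I \<in> integral_ideals R" "C = same_class R `` {I}" by (rule quotientE)
    obtain J where J: "J \<in> integral_ideals R" "principal R (I \<star> J)" using integral_inverse[OF I(1)] by blast
    have fC: "f C = same_class R `` {J}" unfolding I(2) by (rule f_class[OF I(1) J])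
    have "principal R (J \<star> I)" using J by (simp add: prod_span_commute)
    from f_class[OF J(1) I(1) this] have "f (f C) = C" by (simp only: fC I(2)[symmetric])
    then show "f C \<in> integral_ideals R // same_class R \<and> f (f C) = C"
      using quotientI[OF J(1)] fC by simp
    show "f C = C \<longleftrightarrow> C = same_class R `` {R}"
    proof
      assume "f C = C"
      then have "(J, I) \<in> same_class R" using fC I equiv_class_self[OF equiv I(1)] by blast
      then have "principal R (I \<star> I)" using principal_prod_same_class[OF I(1) J(1) I(1) J(2)] by blast
      then have "principal R I" using two I by (auto simp: integral_ideals_def)
      then obtain c where "c \<noteq> 0" "c \<cdot> R = I" by (auto simp: principal_def)
      then have "(R, I) \<in> same_class R" by (intro same_classI[OF R I(1)])
      then show "C = same_class R `` {R}" unfolding I(2) using equiv_class_eq[OF equiv] by metis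
    next
      assume "C = same_class R `` {R}"
      then show "f C = C" using f_class[OF R R] pR ring_prod_ring by simp
    qed
  qed
qed

end

subsection \<open>Ring records of subrings of a field\<close>

lemma subfield_ring_simps [simp]:
  "carrier (subfield_ring R) = R" "x \<otimes>\<^bsub>subfield_ring R\<^esub> y = x * y" "x \<oplus>\<^bsub>subfield_ring R\<^esub> y = x + y"
  "\<one>\<^bsub>subfield_ring R\<^esub> = 1" "\<zero>\<^bsub>subfield_ring R\<^esub> = 0"
  by (simp_all add: subfield_ring_def ring_of_type_algebra_def)

lemma domain_subfield_ring:
  fixes R :: "'a::field_char_0 set"
  assumes "subring_of_field R"
  shows "domain (subfield_ring R)"
proof -
  interpret subring_of_field R by fact
  have "abelian_group (subfield_ring R)"
  proof (rule abelian_groupI)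
    fix x assume "x \<in> carrier (subfield_ring R)"
    then show "\<exists>y\<in>carrier (subfield_ring R). y \<oplus>\<^bsub>subfield_ring R\<^esub> x = \<zero>\<^bsub>subfield_ring R\<^esub>"
      using minus_closed by (intro bexI[of _ "- x"]) auto
  qed (auto simp: zero_closed plus_closed algebra_simps)
  moreover have "Group.comm_monoid (subfield_ring R)"
    by (rule comm_monoidI) (auto simp: one_closed mult_closed algebra_simps)
  ultimately have "cring (subfield_ring R)"
    by (rule cringI) (auto simp: algebra_simps)
  then show ?thesis
    unfolding domain_def domain_axioms_def by simp
qed

lemma nonzero_ideals_subfield_ring:
  fixes R :: "'a::field_char_0 set"
  assumes "subring_of_field R"
  shows "nonzero_ideals (subfield_ring R) = integral_ideals R"
proof -
  interpret subring_of_field R by fact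
  interpret D: domain "subfield_ring R" by (rule domain_subfield_ring[OF assms])
  have "frac_ideal R I \<and> I \<subseteq> R" if I: "ideal I (subfield_ring R)" "I \<noteq> {0}" for I
  proof -
    interpret ideal I "subfield_ring R" by fact
    have sub: "I \<subseteq> R" using a_subset by simp
    have "0 \<in> I" using zero_closed by simp
    then have "\<exists>x\<in>I. x \<noteq> 0" using I(2) by blast
    moreover have "\<forall>x\<in>I. \<forall>y\<in>I. x + y \<in> I" using a_closed by simp
    moreover have "\<forall>r\<in>R. \<forall>x\<in>I. r * x \<in> I" using I_l_closed by simp
    moreover have "\<exists>d\<in>R. d \<noteq> 0 \<and> (\<forall>x\<in>I. d * x \<in> R)"
      using sub one_closed by (intro bexI[of _ 1]) auto
    ultimately show ?thesis using sub by (simp add: frac_ideal_def)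
  qed
  moreover have "ideal I (subfield_ring R) \<and> I \<noteq> {0}" if I: "frac_ideal R I" "I \<subseteq> R" for I
  proof
    show "I \<noteq> {0}" using I by (auto simp: frac_ideal_def)
    show "ideal I (subfield_ring R)"
    proof (rule idealI)
      show "ring (subfield_ring R)" by (rule D.ring_axioms)
      show "subgroup I (add_monoid (subfield_ring R))"
      proof (rule D.add.subgroupI)
        show "I \<subseteq> carrier (subfield_ring R)" using I by simp
        show "I \<noteq> {}" using I by (auto simp: frac_ideal_def)
        fix x assume x: "x \<in> I"
        then have "- x \<in> I" "x \<in> R" "- x \<in> R" using frac_minus[OF I(1)] I by auto
        moreover from this have "\<ominus>\<^bsub>subfield_ring R\<^esub> x = - x" by (intro D.minus_equality) auto
        ultimately show "\<ominus>\<^bsub>subfield_ring R\<^esub> x \<in> I" by simp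
        fix y assume "y \<in> I"
        then show "x \<oplus>\<^bsub>subfield_ring R\<^esub> y \<in> I" using frac_plus[OF I(1) x] by simp
      qed
      fix x r assume "x \<in> I" "r \<in> carrier (subfield_ring R)"
      then show "r \<otimes>\<^bsub>subfield_ring R\<^esub> x \<in> I" "x \<otimes>\<^bsub>subfield_ring R\<^esub> r \<in> I"
        using frac_mult[OF I(1), of r x] by (auto simp: mult.commute)
    qed
  qed
  ultimately show ?thesis by (auto simp: nonzero_ideals_def integral_ideals_def)
qed

lemma l_coset_subfield_ring: "a <#\<^bsub>subfield_ring R\<^esub> I = a \<cdot> I"
  by (auto simp: l_coset_def scale_def)

lemma ideal_class_rel_subfield_ring:
  "subring_of_field R \<Longrightarrow> ideal_class_rel (subfield_ring R) = same_class R"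
  unfolding ideal_class_rel_def same_class_def
  by (simp add: nonzero_ideals_subfield_ring l_coset_subfield_ring)

lemma class_number_subfield_ring:
  "subring_of_field R \<Longrightarrow> class_number (subfield_ring R) = card (integral_ideals R // same_class R)"
  by (simp add: class_number_def nonzero_ideals_subfield_ring ideal_class_rel_subfield_ring)

lemma equiv_same_class:
  fixes R :: "'a::field_char_0 set"
  assumes "subring_of_field R"
  shows "equiv (integral_ideals R) (same_class R)"
  using domain.equiv_ideal_class_rel[OF domain_subfield_ring[OF assms]] assms
  by (simp add: nonzero_ideals_subfield_ring ideal_class_rel_subfield_ring)

section \<open>Fields generated inside the ambient type\<close>

lemma rota_simps:
  "carrier (ring_of_type_algebra :: 'a::field_char_0 ring) = UNIV"
  "x \<otimes>\<^bsub>ring_of_type_algebra\<^esub> y = x * y" "x \<oplus>\<^bsub>ring_of_type_algebra\<^esub> y = x + y"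
  "\<one>\<^bsub>ring_of_type_algebra\<^esub> = 1" "\<zero>\<^bsub>ring_of_type_algebra\<^esub> = 0"
  by (simp_all add: ring_of_type_algebra_def)

lemma rota_inverses:
  fixes x :: "'a::field_char_0"
  shows "\<ominus>\<^bsub>ring_of_type_algebra\<^esub> x = - x"
    and "x \<noteq> 0 \<Longrightarrow> inv\<^bsub>ring_of_type_algebra\<^esub> x = inverse x"
proof -
  interpret field "ring_of_type_algebra :: 'a ring" by (rule field_from_type_algebra)
  show "\<ominus>\<^bsub>ring_of_type_algebra\<^esub> x = - x" by (rule minus_equality) (auto simp: rota_simps)
  show "x \<noteq> 0 \<Longrightarrow> inv\<^bsub>ring_of_type_algebra\<^esub> x = inverse x" by (rule comm_inv_char) (auto simp: rota_simps)
qed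

lemma field_gen_least:
  fixes A :: "'a::field_char_0 set"
  assumes "S \<subseteq> A" "subfield_set A"
  shows "field_gen S \<subseteq> A"
proof
  interpret subfield_set A by fact
  fix x assume "x \<in> field_gen S"
  then have "x \<in> generate_field ring_of_type_algebra S" by (simp add: field_gen_def)
  then show "x \<in> A"
    by induction (use assms(1) in \<open>auto simp: rota_simps rota_inverses F_closed F_mult\<close>)
qed

lemma subfield_field_gen: "subfield_set (field_gen S)"
proof
  show "1 \<in> field_gen S"
    using generate_field.one[of ring_of_type_algebra S] by (simp add: field_gen_def rota_simps)
  fix x y assume xy: "x \<in> field_gen S" "y \<in> field_gen S"
  show "x * y \<in> field_gen S"
    using generate_field.eng_mult[of x ring_of_type_algebra S y] xy by (simp add: field_gen_def rota_simps)
  have "- y \<in> field_gen S"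
    using generate_field.a_inv[of y ring_of_type_algebra S] xy by (simp add: field_gen_def rota_inverses)
  then show "x - y \<in> field_gen S"
    using generate_field.eng_add[of x ring_of_type_algebra S "- y"] xy by (simp add: field_gen_def rota_simps)
  show "inverse x \<in> field_gen S"
  proof (cases "x = 0")
    case False
    then show ?thesis
      using generate_field.m_inv[of x ring_of_type_algebra S] xy
      by (simp add: field_gen_def rota_simps rota_inverses)
  qed (use xy in simp)
qed

lemma field_gen_incl: "x \<in> S \<Longrightarrow> x \<in> field_gen S"
  by (simp add: field_gen_def generate_field.incl)

lemma (in subfield_set) Rats_sub: "\<rat> \<subseteq> F"
  by (auto elim!: Rats_cases' intro: F_divide F.of_int_closed)

text \<open>The assumptions fit both steps of the tower: the root alone as generator over
  \<open>\<rat>\<close>, and the root together with the base \<open>k\<close>.\<close>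

lemma (in quadratic_extension) field_gen_eq_fld:
  assumes "F \<subseteq> field_gen S" "\<delta> \<in> S" "S \<subseteq> insert \<delta> F"
  shows "field_gen S = fld"
proof
  show "field_gen S \<subseteq> fld"
    using assms(3) by (intro field_gen_least fld.subfield_set_axioms) (auto intro: F_sub_fld delta_in_fld)
  interpret G: subfield_set "field_gen S" by (rule subfield_field_gen)
  show "fld \<subseteq> field_gen S"
    using assms field_gen_incl[of \<delta> S] by (auto simp: fld_def intro!: G.F.plus_closed G.F_mult)
qed

lemma ring_of_integers_eq:
  assumes "subfield_set K"
  shows "ring_of_integers K = subfield_ring (subfield_set.ints K)"
  by (simp add: ring_of_integers_def subfield_set.ints_def[OF assms])

subsection \<open>The complex embeddings of \<open>\<rat>(\<surd>p)\<close>\<close>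

lemma ring_hom_Rats:
  fixes h :: "'a::field_char_0 \<Rightarrow> complex"
  assumes K: "subfield_set K" and h: "h \<in> Ring.ring_hom (subfield_ring K) (subfield_ring UNIV)"
  shows "h (of_rat q) = of_rat q"
proof -
  interpret subfield_set K by fact
  have add: "h (x + y) = h x + h y" and mult: "h (x * y) = h x * h y" if "x \<in> K" "y \<in> K" for x y
    using ring_hom_add[OF h, of x y] ring_hom_mult[OF h, of x y] that by auto
  have one: "h 1 = 1" using ring_hom_one[OF h] by simp
  have zero: "h 0 = 0" using add[of 0 0] F_closed by simp
  have nat: "h (of_nat n) = of_nat n" for n
    by (induction n) (auto simp: zero one add F_closed)
  have neg: "h (- x) = - h x" if "x \<in> K" for x
    using add[of x "- x"] that F_closed zero by (simp add: eq_neg_iff_add_eq_0 add.commute)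
  have int: "h (of_int n) = of_int n" for n
  proof (cases "n \<ge> 0")
    case True
    then show ?thesis using nat[of "nat n"] by simp
  next
    case False
    then show ?thesis using nat[of "nat (- n)"] neg[of "of_nat (nat (- n))"] F_closed by simp
  qed
  obtain a b where q: "q = Rat.Fract a b" "b > 0" by (cases q)
  have "h (of_rat q) * h (of_int b) = h (of_rat q * of_int b)"
    using Rats_sub F_closed by (intro mult[symmetric]) auto
  also have "of_rat q * of_int b = (of_int a :: 'a)" using q by (simp add: of_rat_rat)
  finally have "h (of_rat q) * of_int b = of_int a" by (simp add: int)
  then show ?thesis using q by (simp add: of_rat_rat field_simps)
qed

context quadratic_prime
begin

lemma of_real_of_rat: "complex_of_real (of_rat r) = of_rat r"
  by (cases r) (simp add: of_rat_rat)

lemma embedding_hom: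
  assumes c: "\<And>x y. x \<in> k.fld \<Longrightarrow> y \<in> k.fld \<Longrightarrow> c (x + y) = c x + c y \<and> c (x * y) = c x * c y"
    and one: "c 1 = (1 :: real)"
  shows "restrict (\<lambda>x. complex_of_real (c x)) k.fld \<in> field_embeddings k.fld"
proof -
  have "restrict (\<lambda>x. complex_of_real (c x)) k.fld \<in> Ring.ring_hom (subfield_ring k.fld) (subfield_ring UNIV)"
    by (rule ring_hom_memI)
       (auto simp: c one k.fld_plus k.fld_mult k.fld.F_one)
  then show ?thesis by (simp add: field_embeddings_def)
qed

text \<open>An embedding fixes \<open>\<rat>\<close> and sends \<open>sp\<close> to a square root of
  \<open>p\<close>, which leaves a choice of sign.\<close>

lemma field_embeddings_eq:
  "field_embeddings k.fld =
    {restrict (\<lambda>x. complex_of_real x) k.fld, restrict (\<lambda>x. complex_of_real (k.cj x)) k.fld}"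
proof
  show "{restrict (\<lambda>x. complex_of_real x) k.fld, restrict (\<lambda>x. complex_of_real (k.cj x)) k.fld}
      \<subseteq> field_embeddings k.fld"
    using embedding_hom[of "\<lambda>x. x"] embedding_hom[of k.cj] k.cj_F[of 1]
    by (auto simp: k.cj_plus k.cj_mult)
  show "field_embeddings k.fld \<subseteq>
      {restrict (\<lambda>x. complex_of_real x) k.fld, restrict (\<lambda>x. complex_of_real (k.cj x)) k.fld}"
  proof
    fix h assume "h \<in> field_embeddings k.fld"
    then have h: "h \<in> Ring.ring_hom (subfield_ring k.fld) (subfield_ring UNIV)" "h \<in> extensional k.fld"
      by (auto simp: field_embeddings_def)
    have sp: "sp \<in> k.fld" by (rule k.delta_in_fld)
    have rat: "h x = complex_of_real x" if "x \<in> \<rat>" for x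
      using that ring_hom_Rats[OF k.fld.subfield_set_axioms h(1)] by (auto elim!: Rats_cases simp: of_real_of_rat)
    have "h sp * h sp = h (sp * sp)" using ring_hom_mult[OF h(1), of sp sp] sp by simp
    also have "\<dots> = complex_of_real (sp * sp)" unfolding sp_sq by (rule rat) simp
    finally have "(h sp - complex_of_real sp) * (h sp + complex_of_real sp) = 0"
      by (simp only: of_real_mult) (simp add: algebra_simps)
    then have h_sp: "h sp = complex_of_real sp \<or> h sp = - complex_of_real sp"
      by (auto simp: eq_neg_iff_add_eq_0)
    have hx: "h (x + y * sp) = complex_of_real x + complex_of_real y * h sp"
      if "x \<in> \<rat>" "y \<in> \<rat>" for x y
    proof -
      have xy: "x \<in> k.fld" "y \<in> k.fld" using that k.F_sub_fld by auto
      then show ?thesis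
        using ring_hom_add[OF h(1), of x "y * sp"] ring_hom_mult[OF h(1), of y sp] sp rat that
        by (simp add: k.fld_mult)
    qed
    from h_sp have "(\<forall>z\<in>k.fld. h z = complex_of_real z) \<or> (\<forall>z\<in>k.fld. h z = complex_of_real (k.cj z))"
    proof
      assume s: "h sp = complex_of_real sp"
      have "h z = complex_of_real z" if "z \<in> k.fld" for z
        using that by (elim k.fldE) (simp add: hx s)
      then show ?thesis by blast
    next
      assume s: "h sp = - complex_of_real sp"
      have "h z = complex_of_real (k.cj z)" if "z \<in> k.fld" for z
        using that by (elim k.fldE) (simp add: hx s k.cj_repr)
      then show ?thesis by blast
    qed
    then show "h \<in> {restrict (\<lambda>x. complex_of_real x) k.fld, restrict (\<lambda>x. complex_of_real (k.cj x)) k.fld}"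
    proof
      assume "\<forall>z\<in>k.fld. h z = complex_of_real z"
      then have "h = restrict (\<lambda>x. complex_of_real x) k.fld"
        using h(2) by (intro extensionalityI[of _ k.fld]) auto
      then show ?thesis by simp
    next
      assume "\<forall>z\<in>k.fld. h z = complex_of_real (k.cj z)"
      then have "h = restrict (\<lambda>x. complex_of_real (k.cj x)) k.fld"
        using h(2) by (intro extensionalityI[of _ k.fld]) auto
      then show ?thesis by simp
    qed
  qed
qed

lemma field_norm_eq:
  assumes "x \<in> k.fld"
  shows "field_norm k.fld x = complex_of_real (k.nm x)"
proof -
  let ?a = "restrict (\<lambda>x. complex_of_real x) k.fld"
  let ?b = "restrict (\<lambda>x. complex_of_real (k.cj x)) k.fld"
  \<comment> \<open>If the two embeddings coincided, the product over the set would have a single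
    factor.\<close>
  have "?a sp \<noteq> ?b sp" using k.delta_in_fld p_gt1 by (simp add: k.cj_delta)
  then have "?a \<noteq> ?b" by metis
  then show ?thesis
    using assms unfolding field_norm_def field_embeddings_eq by (simp add: k.nm_def)
qed

end

section \<open>The class number of \<open>L\<close>\<close>

context quadratic_prime_unit
begin

text \<open>Every class contains an integral ideal to which the fixed number \<open>m\<close>
  belongs, and there are finitely many such ideals.\<close>

lemma finite_classes: "finite (integral_ideals L.OK // same_class L.OK)"
proof -
  obtain m :: nat where m: "m > 0"
    "\<And>I. frac_ideal L.OK I \<Longrightarrow> I \<subseteq> L.OK \<Longrightarrow>
      \<exists>a\<in>L.fld. a \<noteq> 0 \<and> a \<cdot> I \<subseteq> L.OK \<and> real m \<in> a \<cdot> I"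
    using class_representative by blast
  define S where "S = {A. frac_ideal L.OK A \<and> A \<subseteq> L.OK \<and> real m \<in> A}"
  have "integral_ideals L.OK // same_class L.OK \<subseteq> (\<lambda>A. same_class L.OK `` {A}) ` S"
  proof
    fix C assume "C \<in> integral_ideals L.OK // same_class L.OK"
    then obtain I where I: "I \<in> integral_ideals L.OK" "C = same_class L.OK `` {I}" by (rule quotientE)
    then have fr: "frac_ideal L.OK I" by (simp add: integral_ideals_def)
    obtain a where a: "a \<in> L.fld" "a \<noteq> 0" "a \<cdot> I \<subseteq> L.OK" "real m \<in> a \<cdot> I"
      using m(2)[OF fr] I(1) unfolding integral_ideals_def by blast
    have "frac_ideal L.OK (a \<cdot> I)" by (rule L.fld.ints.frac_scale[OF fr L.fraction_fld[OF a(1)] a(2)])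
    then have "a \<cdot> I \<in> S" "a \<cdot> I \<in> integral_ideals L.OK" using a by (auto simp: S_def integral_ideals_def)
    moreover have "(I, a \<cdot> I) \<in> same_class L.OK" by (rule L.OK.same_classI[OF I(1) calculation(2) refl a(2)])
    ultimately show "C \<in> (\<lambda>A. same_class L.OK `` {A}) ` S"
      unfolding I(2) using equiv_class_eq[OF equiv_same_class[OF L.fld.ints.subring_of_field_axioms]] by blast
  qed
  then show ?thesis
    using finite_ideals_containing[OF m(1)] unfolding S_def by (meson finite_imageI finite_subset)
qed

lemma odd_class_number: "odd (class_number (subfield_ring L.OK))"
  unfolding class_number_subfield_ring[OF L.fld.ints.subring_of_field_axioms]
proof (rule L.OK.odd_card_classes[OF equiv_same_class[OF L.fld.ints.subring_of_field_axioms] finite_classes])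
  fix I assume I: "frac_ideal L.OK I" "principal L.OK (I \<star> I)"
  then obtain b where b: "b \<noteq> 0" "I \<star> I = b \<cdot> L.OK" by (auto simp: principal_def)
  then have "b \<in> L.fld"
    using L.frac_sub_fld[OF L.fld.ints.frac_prod[OF I(1) I(1)]] L.fld.ints.principal_mem by blast
  then show "principal L.OK I"
    using relative_unit_nonsquare square_principal_imp_principal[OF _ _ _ I(1) b(2) _ b(1)]
    unfolding principal_def by metis
qed

end

theorem theorem8:
  fixes p :: nat and k :: "real set" and \<epsilon> :: real
  assumes "Factorial_Ring.prime p" and "[p = 1] (mod 8)"
    and "k = field_gen {sqrt (real p)}"
    and "\<epsilon> > 0" and "\<epsilon> \<in> Units (ring_of_integers k)" and "field_norm k \<epsilon> = -1"
  shows "odd (class_number (ring_of_integers (field_adjoin k (sqrt \<epsilon>))))"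
proof -
  interpret Q: quadratic_prime p
    using assms(1,2) by unfold_locales (simp_all add: Cong.cong_def)
  have Rats: "\<rat> \<subseteq> field_gen {sqrt (real p)}"
    by (rule subfield_set.Rats_sub[OF subfield_field_gen])
  have k: "k = Q.k.fld"
    unfolding assms(3) by (rule Q.k.field_gen_eq_fld[OF Rats]) auto
  have eps: "\<epsilon> \<in> Q.k.OK"
    using assms(5) unfolding k ring_of_integers_eq[OF Q.k.fld.subfield_set_axioms] by (simp add: Units_def)
  have "complex_of_real (Q.k.nm \<epsilon>) = complex_of_real (- 1)"
    using assms(6) Q.field_norm_eq[OF Q.k.OK_sub_fld[OF eps]] unfolding k by simp
  then have "Q.k.nm \<epsilon> = - 1" by (simp only: of_real_eq_iff)
  then interpret U: quadratic_prime_unit p \<epsilon>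
    using assms(4) eps by unfold_locales
  have "field_adjoin k (sqrt \<epsilon>) = U.L.fld"
    unfolding field_adjoin_def
    by (rule U.L.field_gen_eq_fld) (auto simp: k field_gen_incl)
  then show ?thesis
    using U.odd_class_number ring_of_integers_eq[OF U.L.fld.subfield_set_axioms] by simp
qed

end
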